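(* Let $L_1=(L_1(x))_{x\in\mathbb R}$ be the local time up to time $1$ of a standard real Brownian motion $B$. Then $$\sup_{V\in\mathcal V_k}\mathbb E\left[\big(d(L_1,V)\big)^{-1}\right]=k^{\frac12+o(1)},\qquad\text{as }k\to+\infty .$$ That is, for every $\eta_0>0$ there exists $C>1$ such that for every integer $k\ge1$, $C^{-1}k^{\frac12-\eta_0}\le\sup_{V\in\mathcal V_k}\mathbb E[(d(L_1,V))^{-1}]\le Ck^{\frac12+\eta_0}$.
   Context: $L_1(x)$ is the (continuous in $x$) density with respect to Lebesgue measure of the occupation measure of $B$ on $[0,1]$; it is a random element of $L^2(\mathbb R)$. $\mathcal V_k$ is the set of linear subspaces of $L^2(\mathbb R)$ of dimension at most $k$, and $d(f,V)=\inf_{g\in V}\|f-g\|_{L^2(\mathbb R)}$. *)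

theory Defs
  imports "HOL-Probability.Probability" "HOL-Library.Landau_Symbols"
begin

section \<open>The real Hilbert space of square-integrable functions on the line\<close>

definition square_integrable :: "(real \<Rightarrow> real) \<Rightarrow> bool" where
  "square_integrable f \<longleftrightarrow> f \<in> borel_measurable lborel \<and> integrable lborel (\<lambda>x. (f x)\<^sup>2)"

definition L2_rel :: "(real \<Rightarrow> real) \<Rightarrow> (real \<Rightarrow> real) \<Rightarrow> bool" where
  "L2_rel f g \<longleftrightarrow> square_integrable f \<and> square_integrable g \<and> (AE x in lborel. f x = g x)"

lemma square_integrable_zero: "square_integrable (\<lambda>_. 0)"
  by (simp add: square_integrable_def)

lemma square_integrable_mult_integrable:
  assumes "square_integrable f" "square_integrable g"
  shows "integrable lborel (\<lambda>x. f x * g x)"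
proof (rule Bochner_Integration.integrable_bound)
  show "integrable lborel (\<lambda>x. (f x)\<^sup>2 + (g x)\<^sup>2)"
    using assms by (auto simp: square_integrable_def)
  show "(\<lambda>x. f x * g x) \<in> borel_measurable lborel"
    using assms by (auto simp: square_integrable_def)
  have "\<bar>a * b\<bar> \<le> a\<^sup>2 + b\<^sup>2" for a b :: real
  proof -
    have "2 * \<bar>a\<bar> * \<bar>b\<bar> \<le> a\<^sup>2 + b\<^sup>2"
      using sum_squares_bound[of "\<bar>a\<bar>" "\<bar>b\<bar>"] by simp
    moreover have "0 \<le> \<bar>a\<bar> * \<bar>b\<bar>" by simp
    ultimately show ?thesis unfolding abs_mult by linarith
  qed
  then show "AE x in lborel. norm (f x * g x) \<le> norm ((f x)\<^sup>2 + (g x)\<^sup>2)"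
    by (auto intro!: AE_I2)
qed

lemma square_integrable_add:
  assumes "square_integrable f" "square_integrable g"
  shows "square_integrable (\<lambda>x. f x + g x)"
proof -
  have "integrable lborel (\<lambda>x. (f x)\<^sup>2 + (g x)\<^sup>2 + 2 * (f x * g x))"
    using assms square_integrable_mult_integrable[OF assms]
    by (auto simp: square_integrable_def)
  moreover have "(f x)\<^sup>2 + (g x)\<^sup>2 + 2 * (f x * g x) = (f x + g x)\<^sup>2" for x
    by (simp add: power2_sum)
  ultimately show ?thesis
    using assms by (auto simp: square_integrable_def)
qed

lemma square_integrable_cmult:
  "square_integrable f \<Longrightarrow> square_integrable (\<lambda>x. c * f x)"
  by (auto simp: square_integrable_def power_mult_distrib)

quotient_type L2 = "real \<Rightarrow> real" / partial: L2_rel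
  morphisms rep_L2 abs_L2
proof (rule part_equivpI)
  show "\<exists>f. L2_rel f f"
    by (rule exI[of _ "\<lambda>_. 0"]) (simp add: L2_rel_def square_integrable_zero)
  show "symp L2_rel"
    by (rule sympI) (auto simp: L2_rel_def)
  show "transp L2_rel"
    by (rule transpI) (auto simp: L2_rel_def elim: AE_mp)
qed

instantiation L2 :: real_inner
begin

lift_definition zero_L2 :: L2 is "\<lambda>_. 0"
  by (simp add: L2_rel_def square_integrable_zero)

lift_definition plus_L2 :: "L2 \<Rightarrow> L2 \<Rightarrow> L2" is "\<lambda>f g x. f x + g x"
  by (auto simp: L2_rel_def square_integrable_add)

lift_definition uminus_L2 :: "L2 \<Rightarrow> L2" is "\<lambda>f x. - f x"
  using square_integrable_cmult[of _ "-1"] by (auto simp: L2_rel_def)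

lift_definition scaleR_L2 :: "real \<Rightarrow> L2 \<Rightarrow> L2" is "\<lambda>c f x. c * f x"
  by (auto simp: L2_rel_def square_integrable_cmult)

lift_definition inner_L2 :: "L2 \<Rightarrow> L2 \<Rightarrow> real" is "\<lambda>f g. LINT x|lborel. f x * g x"
  by (rule integral_cong_AE) (auto simp: L2_rel_def square_integrable_def)

definition minus_L2 :: "L2 \<Rightarrow> L2 \<Rightarrow> L2" where
  "minus_L2 f g = f + - g"

definition norm_L2 :: "L2 \<Rightarrow> real" where
  "norm_L2 f = sqrt (inner f f)"

definition sgn_L2 :: "L2 \<Rightarrow> L2" where
  "sgn_L2 f = scaleR (inverse (norm f)) f"

definition dist_L2 :: "L2 \<Rightarrow> L2 \<Rightarrow> real" where
  "dist_L2 f g = norm (f - g)"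

definition uniformity_L2 :: "(L2 \<times> L2) filter" where
  "uniformity_L2 = (INF e\<in>{0 <..}. principal {(f, g). dist f g < e})"

definition open_L2 :: "L2 set \<Rightarrow> bool" where
  "open_L2 U \<longleftrightarrow> (\<forall>f\<in>U. eventually (\<lambda>(f', g). f' = f \<longrightarrow> g \<in> U) uniformity)"

instance
proof
  fix f g h :: L2 and a b :: real
  show "f + g + h = f + (g + h)"
    by transfer (auto simp: L2_rel_def add.assoc square_integrable_add)
  show "f + g = g + f"
    by transfer (auto simp: L2_rel_def add.commute square_integrable_add)
  show "0 + f = f"
    by transfer (auto simp: L2_rel_def)
  show "- f + f = 0"
    by transfer (auto simp: L2_rel_def square_integrable_zero)
  show "f - g = f + - g"
    by (simp add: minus_L2_def)
  show "a *\<^sub>R (f + g) = a *\<^sub>R f + a *\<^sub>R g"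
    by transfer
      (auto simp: L2_rel_def distrib_left square_integrable_add square_integrable_cmult)
  show "(a + b) *\<^sub>R f = a *\<^sub>R f + b *\<^sub>R f"
    by transfer
      (auto simp: L2_rel_def distrib_right square_integrable_add square_integrable_cmult)
  show "a *\<^sub>R b *\<^sub>R f = (a * b) *\<^sub>R f"
    by transfer (auto simp: L2_rel_def mult.assoc square_integrable_cmult)
  show "1 *\<^sub>R f = f"
    by transfer (auto simp: L2_rel_def)
  show "inner f g = inner g f"
    by transfer (simp add: mult.commute)
  show "inner (f + g) h = inner f h + inner g h"
    by transfer (auto simp: L2_rel_def distrib_right square_integrable_mult_integrable)
  show "inner (a *\<^sub>R f) g = a * inner f g"
    by transfer (simp add: mult.assoc)
  show "0 \<le> inner f f"
    by transfer (simp add: integral_nonneg_AE)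
  show "inner f f = 0 \<longleftrightarrow> f = 0"
  proof transfer
    fix u assume "L2_rel u u"
    then have u: "square_integrable u" by (simp add: L2_rel_def)
    have "(LINT x|lborel. u x * u x) = 0 \<longleftrightarrow> (AE x in lborel. u x * u x = 0)"
      using square_integrable_mult_integrable[OF u u]
      by (intro integral_nonneg_eq_0_iff_AE) auto
    then show "(LINT x|lborel. u x * u x) = 0 \<longleftrightarrow> L2_rel u (\<lambda>_. 0)"
      using u by (simp add: L2_rel_def square_integrable_zero)
  qed
  show "norm f = sqrt (inner f f)"
    by (simp add: norm_L2_def)
  show "sgn f = scaleR (inverse (norm f)) f"
    by (simp add: sgn_L2_def)
  show "dist f g = norm (f - g)"
    by (simp add: dist_L2_def)
  show "(uniformity :: (L2 \<times> L2) filter) = (INF e\<in>{0 <..}. principal {(f, g). dist f g < e})"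
    by (simp add: uniformity_L2_def)
next
  fix U :: "L2 set"
  show "open U \<longleftrightarrow> (\<forall>f\<in>U. eventually (\<lambda>(f', g). f' = f \<longrightarrow> g \<in> U) uniformity)"
    by (simp add: open_L2_def)
qed

end

lemma norm_abs_L2:
  assumes "square_integrable f"
  shows "norm (abs_L2 f) = sqrt (LINT x|lborel. (f x)\<^sup>2)"
  using assms by (simp add: norm_eq_sqrt_inner inner_L2.abs_eq eq_onp_def L2_rel_def power2_eq_square)

text \<open>
  Linear subspaces of dimension at most \<open>k\<close>. The library's \<^const>\<open>dim\<close> is 0 on
  infinite-dimensional subspaces, so a finite basis is asked for explicitly.
\<close>

definition subspaces_dim_le :: "nat \<Rightarrow> L2 set set" where
  "subspaces_dim_le k =
     {V. subspace V \<and> (\<exists>b. finite b \<and> independent b \<and> span b = V \<and> card b \<le> k)}"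


section \<open>Brownian motion and its local time\<close>

text \<open>
  Time is the half-line \<open>{0..}\<close>; the values of \<open>B\<close> at negative times are irrelevant.
\<close>

definition standard_brownian_motion :: "'a measure \<Rightarrow> (real \<Rightarrow> 'a \<Rightarrow> real) \<Rightarrow> bool" where
  "standard_brownian_motion M B \<longleftrightarrow>
     prob_space M \<and>
     (\<forall>t\<ge>0. B t \<in> borel_measurable M) \<and>
     (AE \<omega> in M. B 0 \<omega> = 0) \<and>
     (\<forall>(n::nat) t. 0 \<le> t 0 \<and> (\<forall>i<n. t i < t (Suc i)) \<longrightarrow>
        prob_space.indep_vars M (\<lambda>_. borel) (\<lambda>i \<omega>. B (t (Suc i)) \<omega> - B (t i) \<omega>) {..<n}) \<and>
     (\<forall>s t. 0 \<le> s \<and> s < t \<longrightarrow>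
        distributed M lborel (\<lambda>\<omega>. B t \<omega> - B s \<omega>) (normal_density 0 (sqrt (t - s)))) \<and>
     (AE \<omega> in M. continuous_on {0..} (\<lambda>t. B t \<omega>))"

definition occupation_measure :: "real \<Rightarrow> (real \<Rightarrow> real) \<Rightarrow> real measure" where
  "occupation_measure T w = distr (restrict_space lborel {0..T}) borel w"

text \<open>
  \<open>is_local_time M B T L\<close> says that \<open>L x \<omega>\<close> is the local time of \<open>B\<close> at level \<open>x\<close> up to
  time \<open>T\<close>. Almost surely, a continuous density of the occupation measure is unique, so this
  determines the process up to indistinguishability.
\<close>

definition is_local_time ::
  "'a measure \<Rightarrow> (real \<Rightarrow> 'a \<Rightarrow> real) \<Rightarrow> real \<Rightarrow> (real \<Rightarrow> 'a \<Rightarrow> real) \<Rightarrow> bool" where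
  "is_local_time M B T L \<longleftrightarrow>
     (\<forall>x. L x \<in> borel_measurable M) \<and>
     (AE \<omega> in M.
        continuous_on UNIV (\<lambda>x. L x \<omega>) \<and> (\<forall>x. 0 \<le> L x \<omega>) \<and>
        occupation_measure T (\<lambda>t. B t \<omega>) = density lborel (\<lambda>x. ennreal (L x \<omega>)))"

text \<open>
  The supremum over \<open>V\<close> of the expected inverse distance, with values in \<open>[0, \<infinity>]\<close>; the inverse
  is taken in \<^typ>\<open>ennreal\<close>, so that it is infinite at distance 0.
  The class \<^term>\<open>abs_L2 f\<close> is meaningful only for square-integrable \<open>f\<close>; the local time is
  almost surely continuous with compact support.
\<close>

definition sup_expected_inverse_distance :: "'a measure \<Rightarrow> (real \<Rightarrow> 'a \<Rightarrow> real) \<Rightarrow> nat \<Rightarrow> ennreal" where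
  "sup_expected_inverse_distance M L k =
     (SUP V\<in>subspaces_dim_le k.
        \<integral>\<^sup>+ \<omega>. inverse (ennreal (infdist (abs_L2 (\<lambda>x. L x \<omega>)) V)) \<partial>M)"

end

theory Submission
  imports Defs
begin

text \<open>
  The true order is \<open>k\<^sup>1\<^sup>/\<^sup>2\<close>, without any \<open>o(1)\<close>. If \<open>B\<close> stays in \<open>[-R, R]\<close> up to
  time 1, the Fourier coefficients of \<open>L\<^sub>1\<close> on \<open>[-R, R]\<close> are the numbers
  \<open>c(\<xi>) = \<integral>\<^sub>0\<^sup>1 exp(i \<xi> B\<^sub>s) ds\<close>, whose moments are explicit.

  Lower bound: \<open>E \<bar>c(\<xi>)\<bar>\<^sup>2 \<le> 4 / \<xi>\<^sup>2\<close>, so \<open>L\<^sub>1\<close> is approximated in mean square within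
  \<open>O(k\<^sup>-\<^sup>1\<^sup>/\<^sup>2)\<close> by the span of the first \<open>k\<close> cosines.

  Upper bound: we show \<open>P(d(L\<^sub>1, V) < \<delta>) = O(k \<delta>\<^sup>2)\<close>. Take the \<open>N\<close> frequencies \<open>\<xi> \<in> (\<pi> / R) \<int>\<close>
  in \<open>[\<Lambda>, 3 \<Lambda> / 2)\<close>, where \<open>\<Lambda> = 2 \<pi> N / R\<close>. Projecting to their span bounds \<open>R d(L\<^sub>1, V)\<^sup>2\<close>
  below by \<open>Z - Y\<close>, with \<open>Z = \<Sum> \<bar>c(\<xi>)\<bar>\<^sup>2\<close> and \<open>Y\<close> the part of this sum captured by at most \<open>k\<close>
  directions. The \<open>c(\<xi>)\<close> and the \<open>\<bar>c(\<xi>)\<bar>\<^sup>2\<close> are nearly uncorrelated, with covariances of order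
  \<open>\<Lambda>\<^sup>-\<^sup>2 / (1 + (\<xi> - \<eta>)\<^sup>2)\<close> and \<open>\<Lambda>\<^sup>-\<^sup>4 / (1 + (\<xi> - \<eta>)\<^sup>2)\<close>. Hence \<open>E Z\<close> is of order \<open>N \<Lambda>\<^sup>-\<^sup>2\<close>,
  \<open>Var Z = O(N R \<Lambda>\<^sup>-\<^sup>4)\<close> and \<open>E Y = O(k R \<Lambda>\<^sup>-\<^sup>2)\<close>; by Chebyshev and Markov, \<open>Z - Y\<close> is of order
  \<open>N \<Lambda>\<^sup>-\<^sup>2\<close> outside an event of probability \<open>O(k R / N)\<close>. Finally choose \<open>N\<close> of order
  \<open>R / \<delta>\<^sup>2\<close> and \<open>R\<close> so large that leaving \<open>[-R, R]\<close> is negligible.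
\<close>

section \<open>Distance to a finite-dimensional subspace\<close>

definition orthonormal_on :: "'i set \<Rightarrow> ('i \<Rightarrow> 'b::real_inner) \<Rightarrow> bool" where
  "orthonormal_on T e \<longleftrightarrow> (\<forall>i\<in>T. \<forall>j\<in>T. inner (e i) (e j) = (if i = j then 1 else 0))"

definition fourier_proj :: "'i set \<Rightarrow> ('i \<Rightarrow> 'b::real_inner) \<Rightarrow> 'b \<Rightarrow> 'b" where
  "fourier_proj T e x = (\<Sum>i\<in>T. inner x (e i) *\<^sub>R e i)"

lemma linear_fourier_proj: "linear (fourier_proj T e)"
  unfolding fourier_proj_def
  by (rule linearI) (simp_all add: inner_add_left scaleR_add_left sum.distrib scaleR_sum_right)

lemma fourier_proj_in_span: "fourier_proj T e x \<in> span (e ` T)"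
  unfolding fourier_proj_def by (intro span_sum span_scale span_base) auto

lemma inner_fourier_proj:
  assumes "finite T" "orthonormal_on T e" "j \<in> T"
  shows "inner (fourier_proj T e x) (e j) = inner x (e j)"
proof -
  have "inner (fourier_proj T e x) (e j) = (\<Sum>i\<in>T. inner x (e i) * (if i = j then 1 else 0))"
    unfolding fourier_proj_def inner_sum_left using assms
    by (intro sum.cong) (auto simp: orthonormal_on_def)
  then show ?thesis using assms by (simp add: if_distrib sum.delta cong: if_cong)
qed

lemma inner_fourier_proj_right:
  "inner y (fourier_proj T e x) = (\<Sum>i\<in>T. inner x (e i) * inner y (e i))"
  by (simp add: fourier_proj_def inner_sum_right)

lemma norm_fourier_proj:
  assumes "finite T" "orthonormal_on T e"
  shows "(norm (fourier_proj T e x))\<^sup>2 = (\<Sum>i\<in>T. (inner x (e i))\<^sup>2)"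
  unfolding power2_norm_eq_inner inner_fourier_proj_right
  using inner_fourier_proj[OF assms] by (intro sum.cong) (auto simp: power2_eq_square)

lemma inner_fourier_residual:
  assumes "finite T" "orthonormal_on T e" "y \<in> span (e ` T)"
  shows "inner (x - fourier_proj T e x) y = 0"
  using assms(3)
proof (induction rule: span_induct_alt)
  case (step c z y)
  then show ?case using inner_fourier_proj[OF assms(1,2)]
    by (auto simp: inner_add_right inner_diff_left)
qed simp

lemma fourier_proj_pythagoras:
  assumes "finite T" "orthonormal_on T e" "y \<in> span (e ` T)"
  shows "(norm (x - y))\<^sup>2 = (norm (x - fourier_proj T e x))\<^sup>2 + (norm (fourier_proj T e x - y))\<^sup>2"
proof -
  have "fourier_proj T e x - y \<in> span (e ` T)"
    using assms fourier_proj_in_span by (intro span_diff)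
  from inner_fourier_residual[OF assms(1,2) this]
  have "inner (x - fourier_proj T e x) (fourier_proj T e x - y) = 0" .
  then show ?thesis
    using norm_add_Pythagorean[of "x - fourier_proj T e x" "fourier_proj T e x - y"]
    by (simp add: orthogonal_def)
qed

lemma bessel_inequality:
  assumes "finite T" "orthonormal_on T e"
  shows "(\<Sum>i\<in>T. (inner x (e i))\<^sup>2) \<le> (norm x)\<^sup>2"
  using fourier_proj_pythagoras[OF assms span_zero, of x] norm_fourier_proj[OF assms, of x]
  by simp

lemma fourier_proj_id:
  assumes "finite T" "orthonormal_on T e" "y \<in> span (e ` T)"
  shows "fourier_proj T e y = y"
  using fourier_proj_pythagoras[OF assms, of y] by (simp add: sum_power2_eq_zero_iff)

text \<open>Pythagoras yields lower bounds in squared form. A negative \<open>v\<close> is settled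
  first, because afterwards \<open>sqrt v\<close> is compared with the infimum and squared back to
  \<open>v\<close>.\<close>

lemma le_infdist_square:
  assumes "V \<noteq> {}" "\<And>y. y \<in> V \<Longrightarrow> v \<le> (dist x y)\<^sup>2"
  shows "v \<le> (infdist x V)\<^sup>2"
proof (cases "v \<le> 0")
  case True
  then show ?thesis by (meson order_trans zero_le_power2)
next
  case False
  have "sqrt v \<le> infdist x V"
    unfolding infdist_notempty[OF assms(1)]
    by (rule cINF_greatest[OF assms(1)]) (simp add: real_le_lsqrt assms(2))
  then have "(sqrt v)\<^sup>2 \<le> (infdist x V)\<^sup>2"
    using False by (intro power_mono) auto
  then show ?thesis using False by simp
qed

text \<open>The projection \<open>P\<close> onto the span of \<open>e\<close> is a contraction, so
  the distance from \<open>x\<close> to \<open>span b\<close> is at least that from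
  \<open>P x\<close> to the image of \<open>span b\<close>. This image has an orthonormal basis of
  at most \<open>k\<close> vectors, and Pythagoras gives the distance to it. \<open>W\<close>
  consists of the coordinates of these vectors in \<open>e\<close>; it is chosen before
  \<open>x\<close>, so it stays deterministic when \<open>x\<close> is the random local
  time.\<close>

lemma infdist_span_ge:
  fixes e :: "'i \<Rightarrow> 'b::real_inner"
  assumes T: "finite T" "orthonormal_on T e" and b: "finite b" "card b \<le> k"
  shows "\<exists>W. finite W \<and> card W \<le> k \<and> (\<forall>w\<in>W. (\<Sum>i\<in>T. (w i)\<^sup>2) = 1) \<and>
    (\<forall>x. (\<Sum>i\<in>T. (inner x (e i))\<^sup>2) - (\<Sum>w\<in>W. (\<Sum>i\<in>T. w i * inner x (e i))\<^sup>2)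
            \<le> (infdist x (span b))\<^sup>2)"
proof -
  let ?P = "fourier_proj T e"
  obtain C where C: "finite C" "card C \<le> card (?P ` b)" "span C = span (?P ` b)"
    "pairwise orthogonal C"
    using basis_orthogonal[of "?P ` b"] b by auto
  have span_C: "span C = ?P ` span b"
    using C(3) linear_fourier_proj linear_span_image by metis
  \<comment> \<open>The orthogonal family may contain 0, which has to go before normalising.\<close>
  define D where "D = C - {0}"
  define f where "f c = c /\<^sub>R norm c" for c :: 'b
  define coef where "coef c = (\<lambda>i. inner (f c) (e i))" for c
  have D: "finite D" "card D \<le> k"
    using C(1,2) b card_image_le[OF b(1), of ?P] card_mono[OF C(1), of D] by (auto simp: D_def)
  have orth: "orthonormal_on D f"
    using C(4) unfolding orthonormal_on_def f_def D_def pairwise_def orthogonal_def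
    by (auto simp: dot_square_norm power2_eq_square divide_simps)
  have span_D: "span (f ` D) = span C"
  proof -
    have "c \<in> span (f ` D)" if "c \<in> C" for c
    proof (cases "c = 0")
      case False
      then have "c = norm c *\<^sub>R f c" by (simp add: f_def)
      moreover have "f c \<in> span (f ` D)" using that False by (intro span_base) (auto simp: D_def)
      ultimately show ?thesis by (metis span_scale)
    qed (simp add: span_zero)
    then have "span C \<subseteq> span (f ` D)" by (metis span_minimal subsetI subspace_span)
    moreover have "f ` D \<subseteq> span C" by (auto simp: f_def D_def intro: span_scale span_base)
    then have "span (f ` D) \<subseteq> span C" by (metis span_minimal subspace_span)
    ultimately show ?thesis by simp
  qed
  have fixf: "?P (f c) = f c" if "c \<in> D" for c
  proof -
    have "f c \<in> ?P ` span b"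
      using that span_D span_C span_base[of "f c" "f ` D"] by auto
    then show ?thesis
      using fourier_proj_id[OF T] fourier_proj_in_span[of T e] by auto
  qed
  have inner_f: "inner x (f c) = (\<Sum>i\<in>T. coef c i * inner x (e i))" if "c \<in> D" for x c
    using inner_fourier_proj_right[of x T e "f c"] fixf[OF that] by (simp add: coef_def)
  have unit: "(\<Sum>i\<in>T. (coef c i)\<^sup>2) = 1" if "c \<in> D" for c
    using inner_f[OF that, of "f c"] orth that
    by (simp add: orthonormal_on_def coef_def power2_eq_square)
  have inner_P: "inner (?P x) (f c) = inner x (f c)" if "c \<in> D" for x c
    unfolding inner_f[OF that] using inner_fourier_proj[OF T] by (intro sum.cong) auto
  have main: "(\<Sum>i\<in>T. (inner x (e i))\<^sup>2) - (\<Sum>c\<in>D. (\<Sum>i\<in>T. coef c i * inner x (e i))\<^sup>2)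
            \<le> (infdist x (span b))\<^sup>2" for x
  proof (rule le_infdist_square)
    show "span b \<noteq> {}" using span_zero by blast
    fix y assume y: "y \<in> span b"
    have Py: "?P y \<in> span (f ` D)" using y span_D span_C by auto
    have "(\<Sum>i\<in>T. (inner x (e i))\<^sup>2) - (\<Sum>c\<in>D. (\<Sum>i\<in>T. coef c i * inner x (e i))\<^sup>2)
        = (norm (?P x))\<^sup>2 - (\<Sum>c\<in>D. (inner (?P x) (f c))\<^sup>2)"
      using norm_fourier_proj[OF T] inner_f inner_P by (auto intro!: sum.cong)
    also have "\<dots> = (norm (?P x - fourier_proj D f (?P x)))\<^sup>2"
      using fourier_proj_pythagoras[OF D(1) orth span_zero, of "?P x"] norm_fourier_proj[OF D(1) orth, of "?P x"]
      by simp
    also have "\<dots> \<le> (norm (?P x - ?P y))\<^sup>2"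
      using fourier_proj_pythagoras[OF D(1) orth Py, of "?P x"] by simp
    also have "\<dots> = (norm (?P (x - y)))\<^sup>2" by (simp add: linear_diff[OF linear_fourier_proj])
    also have "\<dots> \<le> (norm (x - y))\<^sup>2"
      unfolding norm_fourier_proj[OF T] by (rule bessel_inequality[OF T])
    finally show "(\<Sum>i\<in>T. (inner x (e i))\<^sup>2) - (\<Sum>c\<in>D. (\<Sum>i\<in>T. coef c i * inner x (e i))\<^sup>2)
      \<le> (dist x y)\<^sup>2" by (simp add: dist_norm)
  qed
  \<comment> \<open>Passing from \<open>D\<close> to the set of coordinate vectors loses no term:
    equal coordinates force inner product 1, which orthonormality allows only for equal
    indices.\<close>
  have "(\<Sum>w\<in>coef ` D. (\<Sum>i\<in>T. w i * inner x (e i))\<^sup>2)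
      = (\<Sum>c\<in>D. (\<Sum>i\<in>T. coef c i * inner x (e i))\<^sup>2)" for x
  proof (rule sum.reindex[unfolded comp_def], rule inj_onI)
    fix c d assume cd: "c \<in> D" "d \<in> D" "coef c = coef d"
    then have "inner (f c) (f d) = 1"
      using inner_f[OF cd(2), of "f c"] inner_f[OF cd(2), of "f d"] orth
      by (simp add: coef_def orthonormal_on_def fun_eq_iff)
    then show "c = d" using orth cd by (auto simp: orthonormal_on_def split: if_splits)
  qed
  then show ?thesis
    using D unit main card_image_le[OF D(1), of coef]
    by (intro exI[of _ "coef ` D"]) auto
qed

text \<open>A tail form of Parseval for \<open>x\<close> in the closure of the span: an
  approximation \<open>y\<close> involves finitely many vectors, and the projection onto these
  together with the first \<open>k\<close> does at least as well. The tail is a series in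
  \<open>ennreal\<close>, so it always has a value and its expectation can be taken term by
  term.\<close>

lemma infdist_span_le:
  fixes e :: "nat \<Rightarrow> 'b::real_inner"
  assumes orth: "orthonormal_on UNIV e"
    and dense: "\<And>\<epsilon>. \<epsilon> > 0 \<Longrightarrow> \<exists>y \<in> span (range e). dist x y < \<epsilon>"
  shows "ennreal ((infdist x (span (e ` {..<k})))\<^sup>2) \<le> (\<Sum>j. ennreal ((inner x (e (j + k)))\<^sup>2))"
proof (rule ennreal_le_epsilon)
  fix \<epsilon> :: real assume "\<epsilon> > 0"
  then obtain y where y: "y \<in> span (range e)" "dist x y < sqrt \<epsilon>" using dense[of "sqrt \<epsilon>"] by auto
  have orth': "orthonormal_on {..<n} e" for n using orth by (simp add: orthonormal_on_def)
  obtain n0 where n0: "y \<in> span (e ` {..<n0})"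
  proof -
    obtain t r where t: "finite t" "t \<subseteq> range e" "y = (\<Sum>a\<in>t. r a *\<^sub>R a)"
      using y(1) unfolding span_explicit by auto
    then obtain I where I: "finite I" "t = e ` I" by (meson finite_subset_image)
    then obtain n where "I \<subseteq> {..<n}" using finite_nat_iff_bounded by auto
    then have "y \<in> span (e ` {..<n})" unfolding t(3) I(2)
      by (intro span_sum span_scale span_base) auto
    then show ?thesis using that by blast
  qed
  \<comment> \<open>With this \<open>n\<close>, both \<open>y\<close> and the projection onto the
    first \<open>k\<close> vectors lie in the span of the first \<open>n\<close>.\<close>
  define n where "n = n0 + k"
  have yn: "y \<in> span (e ` {..<n})"
    using n0 span_mono[of "e ` {..<n0}" "e ` {..<n}"] by (force simp: n_def)
  let ?P = "\<lambda>n. fourier_proj {..<n} e"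
  have kn: "?P k x \<in> span (e ` {..<n})"
    using fourier_proj_in_span[of "{..<k}" e x] span_mono[of "e ` {..<k}" "e ` {..<n}"]
    by (force simp: n_def)
  have diff: "(norm (?P n x - ?P k x))\<^sup>2 = (\<Sum>j<n0. (inner x (e (j + k)))\<^sup>2)"
  proof -
    have split: "(\<Sum>j<n. h j) = (\<Sum>j<k. h j) + (\<Sum>j<n0. h (j + k))" for h :: "nat \<Rightarrow> real"
    proof -
      have "(\<Sum>j<n. h j) = (\<Sum>j<k. h j) + (\<Sum>j\<in>{k..<n}. h j)"
        by (subst sum.union_disjoint[symmetric]) (auto intro!: sum.cong simp: n_def)
      also have "(\<Sum>j\<in>{k..<n}. h j) = (\<Sum>j<n0. h (j + k))"
        using sum.shift_bounds_nat_ivl[of h 0 k n0] by (simp add: n_def atLeast0LessThan)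
      finally show ?thesis .
    qed
    have "(norm (?P n x))\<^sup>2 = (norm (?P k x))\<^sup>2 + (norm (?P n x - ?P k x))\<^sup>2"
    proof -
      have "?P k (?P n x) = ?P k x"
        unfolding fourier_proj_def[of "{..<k}"]
        by (intro sum.cong refl) (simp add: inner_fourier_proj[OF _ orth'] n_def)
      then show ?thesis
        using fourier_proj_pythagoras[OF _ orth' span_zero, of k "?P n x"] by simp
    qed
    then show ?thesis
      using split[of "\<lambda>j. (inner x (e j))\<^sup>2"] norm_fourier_proj[OF _ orth', of n x] norm_fourier_proj[OF _ orth', of k x]
      by simp
  qed
  have "infdist x (span (e ` {..<k})) \<le> norm (x - ?P k x)"
    using infdist_le[OF fourier_proj_in_span[of "{..<k}" e x], where x = x] by (simp add: dist_norm)
  then have "(infdist x (span (e ` {..<k})))\<^sup>2 \<le> (norm (x - ?P k x))\<^sup>2"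
    by (intro power_mono infdist_nonneg)
  also have "\<dots> = (norm (x - ?P n x))\<^sup>2 + (\<Sum>j<n0. (inner x (e (j + k)))\<^sup>2)"
    using fourier_proj_pythagoras[OF _ orth' kn, of x] diff by simp
  also have "(norm (x - ?P n x))\<^sup>2 \<le> (norm (x - y))\<^sup>2"
    using fourier_proj_pythagoras[OF _ orth' yn, of x] by simp
  also have "\<dots> \<le> \<epsilon>"
    using y(2) \<open>\<epsilon> > 0\<close> power_mono[of "norm (x - y)" "sqrt \<epsilon>" 2] by (simp add: dist_norm)
  finally have "(infdist x (span (e ` {..<k})))\<^sup>2 \<le> \<epsilon> + (\<Sum>j<n0. (inner x (e (j + k)))\<^sup>2)" by simp
  then have "ennreal ((infdist x (span (e ` {..<k})))\<^sup>2) \<le> ennreal (\<epsilon> + (\<Sum>j<n0. (inner x (e (j + k)))\<^sup>2))"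
    by (rule ennreal_leI)
  also have "\<dots> = (\<Sum>j<n0. ennreal ((inner x (e (j + k)))\<^sup>2)) + ennreal \<epsilon>"
    using \<open>\<epsilon> > 0\<close> by (simp add: ennreal_plus sum_nonneg sum_ennreal add.commute)
  also have "\<dots> \<le> (\<Sum>j. ennreal ((inner x (e (j + k)))\<^sup>2)) + ennreal \<epsilon>"
    by (intro add_right_mono sum_le_suminf) auto
  finally show "ennreal ((infdist x (span (e ` {..<k})))\<^sup>2) \<le> (\<Sum>j. ennreal ((inner x (e (j + k)))\<^sup>2)) + ennreal \<epsilon>" .
qed

section \<open>Exponential kernels on the unit time interval\<close>

text \<open>Time as a probability space: constants integrate to themselves, and bounded measurable
  integrands are integrable.\<close>

definition unit_time :: "real measure" where
  "unit_time = restrict_space lborel {0..1}"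

lemma space_unit_time [simp]: "space unit_time = {0..1}"
  by (simp add: unit_time_def space_restrict_space)

lemma borel_measurable_unit_time:
  "f \<in> borel_measurable borel \<Longrightarrow> f \<in> borel_measurable unit_time"
  unfolding unit_time_def by (rule measurable_restrict_space1) simp

lemma prob_space_unit_time: "prob_space unit_time"
  by (rule prob_spaceI) (simp add: unit_time_def emeasure_restrict_space space_restrict_space)

lemma integral_unit_time:
  "(\<integral>t. f t \<partial>unit_time) = (\<integral>t. indicator {0..1} t * (f t :: real) \<partial>lborel)"
  unfolding unit_time_def by (subst integral_restrict_space) auto

lemma integral_exp_kernel:
  fixes a x :: real
  assumes "a > 0" "x \<in> {0..1}"
  shows "(\<integral>y. exp (- a * \<bar>x - y\<bar>) \<partial>unit_time) = (2 - exp (- a * x) - exp (- a * (1 - x))) / a"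
proof -
  have 1: "has_bochner_integral lborel (\<lambda>y. exp (- a * (x - y)) * indicator {0..x} y)
      (exp (- a * (x - x)) / a - exp (- a * (x - 0)) / a)"
    using assms by (intro has_bochner_integral_FTC_Icc_real)
      (auto intro!: derivative_eq_intros continuous_intros)
  have 2: "has_bochner_integral lborel (\<lambda>y. exp (- a * (y - x)) * indicator {x..1} y)
      (- exp (- a * (1 - x)) / a - - exp (- a * (x - x)) / a)"
    using assms by (intro has_bochner_integral_FTC_Icc_real)
      (auto intro!: derivative_eq_intros continuous_intros)
  have "has_bochner_integral lborel (\<lambda>y. indicator {0..1} y * exp (- a * \<bar>x - y\<bar>))
      ((exp (- a * (x - x)) / a - exp (- a * (x - 0)) / a) +
       (- exp (- a * (1 - x)) / a - - exp (- a * (x - x)) / a))"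
  proof (rule has_bochner_integralI_AE[OF has_bochner_integral_add[OF 1 2]])
    \<comment> \<open>Both pieces contain the point \<open>y = x\<close>, so the two sides agree
      only off this null set.\<close>
    show "AE y in lborel. exp (- a * (x - y)) * indicator {0..x} y + exp (- a * (y - x)) * indicator {x..1} y
        = indicator {0..1} y * exp (- a * \<bar>x - y\<bar>)"
      using AE_lborel_singleton[of x] by eventually_elim (use assms in \<open>auto simp: indicator_def\<close>)
  qed simp
  from has_bochner_integral_integral_eq[OF this] show ?thesis
    unfolding integral_unit_time by (simp add: diff_divide_distrib add_divide_distrib)
qed

lemma exp_kernel_le:
  fixes a x :: real
  assumes "a > 0" "x \<in> {0..1}"
  shows "(\<integral>y. exp (- a * \<bar>x - y\<bar>) \<partial>unit_time) \<le> 2 / a"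
proof -
  have "2 - exp (- a * x) - exp (- a * (1 - x)) \<le> 2"
    using exp_gt_zero[of "- a * x"] exp_gt_zero[of "- a * (1 - x)"] by linarith
  then show ?thesis
    unfolding integral_exp_kernel[OF assms] using assms by (intro divide_right_mono) auto
qed

lemma exp_kernel_le_one:
  fixes a x :: real
  assumes "a \<ge> 0"
  shows "(\<integral>y. exp (- a * \<bar>x - y\<bar>) \<partial>unit_time) \<le> 1"
proof -
  interpret prob_space unit_time by (rule prob_space_unit_time)
  have "(\<integral>y. exp (- a * \<bar>x - y\<bar>) \<partial>unit_time) \<le> (\<integral>y. 1 \<partial>unit_time)"
    using assms
    by (intro integral_mono integrable_const_bound[where B = 1] borel_measurable_unit_time) auto
  then show ?thesis using prob_space by simp
qed

text \<open>One of \<open>x\<close> and \<open>1 - x\<close> is at least 1/2, so one of the two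
  exponentials in the exact value is at most exp (-1/2) <= 3/4. The other is at most 1, which leaves
  1/4 of the numerator.\<close>

lemma exp_kernel_ge:
  fixes a x :: real
  assumes "a \<ge> 1" "x \<in> {0..1}"
  shows "1 / (4 * a) \<le> (\<integral>y. exp (- a * \<bar>x - y\<bar>) \<partial>unit_time)"
proof -
  have half: "exp (- a * z) \<le> 3 / 4" if "z \<ge> 1 / 2" for z
  proof -
    have "a * z \<ge> 1 * (1 / 2)" using assms that by (intro mult_mono) auto
    then have "exp (- a * z) \<le> exp (- (1/2))" by simp
    also have "\<dots> = 1 / exp (1 / 2)" by (simp add: exp_minus divide_simps)
    also have "\<dots> \<le> 1 / (1 + 1 / 2)"
      using exp_ge_add_one_self[of "1 / 2 :: real"] by (intro divide_left_mono) auto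
    finally show ?thesis by simp
  qed
  have one: "exp (- a * z) \<le> 1" if "z \<ge> 0" for z using assms that by simp
  have "exp (- a * x) + exp (- a * (1 - x)) \<le> 3 / 4 + 1"
  proof (cases "x \<ge> 1 / 2")
    case True
    then show ?thesis using half[of x] one[of "1 - x"] assms unfolding atLeastAtMost_iff by linarith
  next
    case False
    then show ?thesis using half[of "1 - x"] one[of x] assms unfolding atLeastAtMost_iff by linarith
  qed
  then have "1 / 4 \<le> 2 - exp (- a * x) - exp (- a * (1 - x))" by linarith
  then have "(1 / 4) / a \<le> (2 - exp (- a * x) - exp (- a * (1 - x))) / a"
    using assms(1) by (intro divide_right_mono) linarith+
  then show ?thesis using integral_exp_kernel[of a x] assms by simp
qed

text \<open>For small \<open>\<kappa>\<close> the trivial bound 1 applies, otherwise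
  \<open>4 / \<kappa>\<^sup>2\<close>. The constant 5 puts both under one expression that can be
  summed over a lattice of frequencies.\<close>

lemma exp_square_kernel_le:
  fixes \<kappa> x :: real
  assumes "x \<in> {0..1}"
  shows "(\<integral>y. exp (- (\<kappa>\<^sup>2 / 2) * \<bar>x - y\<bar>) \<partial>unit_time) \<le> 5 / (1 + \<kappa>\<^sup>2)"
proof (cases "\<kappa>\<^sup>2 \<le> 4")
  case True
  then have "1 \<le> 5 / (1 + \<kappa>\<^sup>2)" by (simp add: divide_simps add_pos_nonneg)
  then show ?thesis using exp_kernel_le_one[of "\<kappa>\<^sup>2 / 2" x] by simp
next
  case False
  then have "2 / (\<kappa>\<^sup>2 / 2) \<le> 5 / (1 + \<kappa>\<^sup>2)" by (simp add: divide_simps add_pos_nonneg)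
  then show ?thesis using exp_kernel_le[of "\<kappa>\<^sup>2 / 2" x] False assms by linarith
qed

section \<open>Lattice sums of 1 / (1 + z^2)\<close>

lemma arctan_increment_ge:
  fixes a b :: real
  assumes "0 \<le> a" "a \<le> b"
  shows "(b - a) / (1 + b\<^sup>2) \<le> arctan b - arctan a"
proof (cases "a = b")
  case False
  then obtain z where z: "a < z" "z < b" "arctan b - arctan a = (b - a) * inverse (1 + z\<^sup>2)"
    using MVT2[of a b arctan "\<lambda>z. inverse (1 + z\<^sup>2)"] DERIV_arctan assms by auto
  have "z\<^sup>2 \<le> b\<^sup>2" using z assms by (intro power_mono) auto
  then have "inverse (1 + b\<^sup>2) \<le> inverse (1 + z\<^sup>2)"
    by (intro le_imp_inverse_le) (auto simp: add_pos_nonneg)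
  then show ?thesis
    using z assms by (auto simp: divide_inverse intro: mult_left_mono)
qed simp

text \<open>A right-endpoint Riemann sum of mesh \<open>pi / R\<close> for a function decreasing on
  the half-line: each term is at most \<open>R / pi\<close> times an increment of
  \<open>arctan\<close>, and these telescope to at most \<open>pi / 2\<close>. Right endpoints start
  at index 1, hence \<open>0 \<notin> F\<close>.\<close>

lemma sum_inverse_one_plus_square_le:
  fixes R :: real and F :: "nat set"
  assumes "R > 0" "finite F" "0 \<notin> F"
  shows "(\<Sum>i\<in>F. 1 / (1 + (pi * real i / R)\<^sup>2)) \<le> R / 2"
proof -
  obtain n where n: "F \<subseteq> {..<Suc n}" using finite_nat_iff_bounded[of F] assms(2)
    by (metis lessThan_Suc_atMost lessThan_subset_iff order.trans le_SucI le_refl)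
  let ?h = "\<lambda>i. 1 / (1 + (pi * real i / R)\<^sup>2)"
  have "(\<Sum>i\<in>F. ?h i) \<le> (\<Sum>i<n. ?h (Suc i))"
  proof -
    have "(\<Sum>i\<in>F. ?h i) \<le> (\<Sum>i\<in>Suc ` {..<n}. ?h i)"
    proof (rule sum_mono2)
      show "F \<subseteq> Suc ` {..<n}"
      proof
        fix x assume "x \<in> F"
        then show "x \<in> Suc ` {..<n}" using n assms(3) by (cases x) auto
      qed
    qed auto
    then show ?thesis by (simp add: sum.reindex)
  qed
  also have "\<dots> \<le> (\<Sum>i<n. (R / pi) * (arctan (pi * real (Suc i) / R) - arctan (pi * real i / R)))"
  proof (rule sum_mono)
    fix i
    have "(pi * real (Suc i) / R - pi * real i / R) / (1 + (pi * real (Suc i) / R)\<^sup>2)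
      \<le> arctan (pi * real (Suc i) / R) - arctan (pi * real i / R)"
      using assms by (intro arctan_increment_ge divide_right_mono) auto
    then have "(R / pi) * ((pi * real (Suc i) / R - pi * real i / R) / (1 + (pi * real (Suc i) / R)\<^sup>2))
      \<le> (R / pi) * (arctan (pi * real (Suc i) / R) - arctan (pi * real i / R))"
      using assms by (intro mult_left_mono) auto
    moreover have "pi * real (Suc i) / R - pi * real i / R = pi / R"
      by (simp add: distrib_left add_divide_distrib)
    ultimately show "?h (Suc i) \<le> (R / pi) * (arctan (pi * real (Suc i) / R) - arctan (pi * real i / R))"
      using assms by simp
  qed
  also have "\<dots> = (R / pi) * arctan (pi * real n / R)"
    unfolding sum_distrib_left[symmetric] by (subst sum_lessThan_telescope) simp
  also have "\<dots> \<le> (R / pi) * (pi / 2)"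
    using assms arctan_ubound[of "pi * real n / R"] by (intro mult_left_mono) auto
  finally show ?thesis using pi_gt_zero by simp
qed

text \<open>Indices above \<open>j\<close> contribute at most \<open>R / 2\<close>, so do those
  below, and \<open>j\<close> itself at most 1. These are the row sums of the covariance bounds;
  they do not grow with the number of frequencies.\<close>

lemma sum_inverse_one_plus_square_diff_le:
  fixes R :: real and J :: "nat set"
  assumes "R > 0" "finite J"
  shows "(\<Sum>l\<in>J. 1 / (1 + (pi * real j / R - pi * real l / R)\<^sup>2)) \<le> 1 + R"
proof -
  let ?h = "\<lambda>i::nat. 1 / (1 + (pi * real i / R)\<^sup>2)"
  let ?g = "\<lambda>l::nat. 1 / (1 + (pi * real j / R - pi * real l / R)\<^sup>2)"
  have g1: "?g l = ?h (l - j)" if "l \<ge> j" for l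
  proof -
    have "pi * real j / R - pi * real l / R = - (pi * real (l - j) / R)"
      using that by (simp add: of_nat_diff right_diff_distrib diff_divide_distrib)
    then show ?thesis by (simp only: power2_minus)
  qed
  have g2: "?g l = ?h (j - l)" if "l \<le> j" for l
  proof -
    have "pi * real j / R - pi * real l / R = pi * real (j - l) / R"
      using that by (simp add: of_nat_diff right_diff_distrib diff_divide_distrib)
    then show ?thesis by (simp only:)
  qed
  have above: "(\<Sum>l\<in>J \<inter> {j<..}. ?g l) \<le> R / 2"
  proof -
    have "(\<Sum>l\<in>J \<inter> {j<..}. ?g l) = (\<Sum>l\<in>J \<inter> {j<..}. ?h (l - j))"
      by (rule sum.cong[OF refl g1]) simp
    also have "\<dots> = (\<Sum>i\<in>(\<lambda>l. l - j) ` (J \<inter> {j<..}). ?h i)"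
      by (rule sum.reindex[unfolded comp_def, symmetric]) (auto simp: inj_on_def)
    also have "\<dots> \<le> R / 2"
      using assms by (intro sum_inverse_one_plus_square_le) auto
    finally show ?thesis .
  qed
  have below: "(\<Sum>l\<in>J \<inter> {..<j}. ?g l) \<le> R / 2"
  proof -
    have "(\<Sum>l\<in>J \<inter> {..<j}. ?g l) = (\<Sum>l\<in>J \<inter> {..<j}. ?h (j - l))"
      by (rule sum.cong[OF refl g2]) simp
    also have "\<dots> = (\<Sum>i\<in>(\<lambda>l. j - l) ` (J \<inter> {..<j}). ?h i)"
      by (rule sum.reindex[unfolded comp_def, symmetric]) (auto simp: inj_on_def)
    also have "\<dots> \<le> R / 2"
      using assms by (intro sum_inverse_one_plus_square_le) auto
    finally show ?thesis .
  qed
  have diag: "(\<Sum>l\<in>J \<inter> {j}. ?g l) \<le> 1" by (cases "j \<in> J") simp_all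
  have "(\<Sum>l\<in>J. ?g l) = (\<Sum>l\<in>J \<inter> {j<..}. ?g l) + (\<Sum>l\<in>J \<inter> {..<j}. ?g l) + (\<Sum>l\<in>J \<inter> {j}. ?g l)"
  proof -
    have "J = (J \<inter> {j<..}) \<union> (J \<inter> {..<j}) \<union> (J \<inter> {j})" by auto
    then have "(\<Sum>l\<in>J. ?g l) = (\<Sum>l\<in>(J \<inter> {j<..}) \<union> (J \<inter> {..<j}) \<union> (J \<inter> {j}). ?g l)"
      by (rule arg_cong)
    also have "\<dots> = (\<Sum>l\<in>(J \<inter> {j<..}) \<union> (J \<inter> {..<j}). ?g l) + (\<Sum>l\<in>J \<inter> {j}. ?g l)"
      using assms by (intro sum.union_disjoint) auto
    also have "(\<Sum>l\<in>(J \<inter> {j<..}) \<union> (J \<inter> {..<j}). ?g l)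
        = (\<Sum>l\<in>J \<inter> {j<..}. ?g l) + (\<Sum>l\<in>J \<inter> {..<j}. ?g l)"
      using assms by (intro sum.union_disjoint) auto
    finally show ?thesis .
  qed
  then show ?thesis using above below diag by linarith
qed

section \<open>Brownian motion with continuous paths\<close>

text \<open>Setting the path to 0 on the exceptional null set, and freezing it at time 0 for
  negative times, makes it continuous on the whole line for every outcome. Later identities can then
  be stated path by path.\<close>

lemma brownian_regularization:
  assumes "standard_brownian_motion M B"
  obtains X where "\<And>t. X t \<in> borel_measurable M"
    and "\<And>\<omega>. \<omega> \<in> space M \<Longrightarrow> continuous_on UNIV (\<lambda>t. X t \<omega>)"
    and "\<And>\<omega>. \<omega> \<in> space M \<Longrightarrow> X 0 \<omega> = 0"
    and "AE \<omega> in M. \<forall>t\<ge>0. X t \<omega> = B t \<omega>"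
proof -
  have B: "B t \<in> borel_measurable M" if "t \<ge> 0" for t
    using assms that by (auto simp: standard_brownian_motion_def)
  have "AE \<omega> in M. B 0 \<omega> = 0 \<and> continuous_on {0..} (\<lambda>t. B t \<omega>)"
    using assms by (auto simp: standard_brownian_motion_def)
  then obtain N where N: "N \<in> null_sets M"
    "\<And>\<omega>. \<omega> \<in> space M \<Longrightarrow> \<omega> \<notin> N \<Longrightarrow> B 0 \<omega> = 0 \<and> continuous_on {0..} (\<lambda>t. B t \<omega>)"
    unfolding eventually_ae_filter by auto
  note [measurable] = null_setsD2[OF N(1)]
  define X where "X t \<omega> = (if \<omega> \<in> N then 0 else B (max 0 t) \<omega>)" for t \<omega>
  show thesis
  proof
    show "X t \<in> borel_measurable M" for t
      using B[of "max 0 t"] unfolding X_def by measurable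
    show "continuous_on UNIV (\<lambda>t. X t \<omega>)" if "\<omega> \<in> space M" for \<omega>
    proof (cases "\<omega> \<in> N")
      case False
      then have "continuous_on UNIV ((\<lambda>t. B t \<omega>) \<circ> (\<lambda>t::real. max 0 t))"
        by (intro continuous_on_compose continuous_on_subset[OF conjunct2[OF N(2)[OF that False]]]
            continuous_intros) auto
      then show ?thesis using False by (simp add: X_def comp_def)
    qed (simp add: X_def)
    show "X 0 \<omega> = 0" if "\<omega> \<in> space M" for \<omega>
      using N(2)[OF that] by (simp add: X_def)
    show "AE \<omega> in M. \<forall>t\<ge>0. X t \<omega> = B t \<omega>"
      using AE_not_in[OF N(1)] by eventually_elim (simp add: X_def)
  qed
qed

lemma (in prob_space) expectation_iexp_normal:
  assumes "distributed M lborel Y (normal_density 0 \<sigma>)" "\<sigma> > 0"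
  shows "(CLINT \<omega>|M. iexp (\<kappa> * Y \<omega>)) = exp (- (\<kappa>\<^sup>2 * \<sigma>\<^sup>2) / 2)"
proof -
  have D: "distributed M lborel (\<lambda>\<omega>. Y \<omega> / \<sigma>) std_normal_density"
    using normal_standard_normal_convert[OF assms(2), of Y 0] assms(1) by simp
  have eq: "distr M lborel (\<lambda>\<omega>. Y \<omega> / \<sigma>) = std_normal_distribution"
    using D by (simp add: distributed_def)
  have "(CLINT \<omega>|M. iexp (\<kappa> * Y \<omega>)) = (CLINT \<omega>|M. iexp ((\<kappa> * \<sigma>) * (Y \<omega> / \<sigma>)))"
    using assms(2) by simp
  also have "\<dots> = (CLINT y|distr M lborel (\<lambda>\<omega>. Y \<omega> / \<sigma>). iexp ((\<kappa> * \<sigma>) * y))"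
    using distributed_measurable[OF D] by (subst integral_distr) auto
  also have "\<dots> = char std_normal_distribution (\<kappa> * \<sigma>)"
    unfolding eq char_def ..
  also have "\<dots> = exp (- (\<kappa>\<^sup>2 * \<sigma>\<^sup>2) / 2)"
    by (simp add: char_std_normal_distribution power_mult_distrib)
  finally show ?thesis .
qed

text \<open>Three consecutive increments are enough for all that follows: the highest moments used
  are second moments of \<open>\<bar>c(\<xi>)\<bar>\<^sup>2\<close>, which involve four
  times.\<close>

lemma brownian_char_strict:
  assumes bm: "standard_brownian_motion M B" and t: "0 \<le> a" "a < b" "b < c" "c < d"
  shows "(CLINT \<omega>|M. iexp (p * (B b \<omega> - B a \<omega>) + q * (B c \<omega> - B b \<omega>) + r * (B d \<omega> - B c \<omega>)))
     = exp (- (p\<^sup>2 * (b - a) + q\<^sup>2 * (c - b) + r\<^sup>2 * (d - c)) / 2)"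
proof -
  interpret prob_space M using bm by (simp add: standard_brownian_motion_def)
  define s where "s i = [a, b, c, d] ! i" for i :: nat
  define \<kappa> where "\<kappa> i = [p, q, r] ! i" for i :: nat
  have s_mono: "s i < s (Suc i)" if "i < 3" for i
    using that t by (auto simp: s_def nth_Cons' less_Suc_eq numeral_3_eq_3)
  have s_nonneg: "s i \<ge> 0" if "i < 3" for i
    using that t by (auto simp: s_def nth_Cons' less_Suc_eq numeral_3_eq_3)
  have "indep_vars (\<lambda>_. borel) (\<lambda>i \<omega>. B (s (Suc i)) \<omega> - B (s i) \<omega>) {..<3}"
    using bm s_mono s_nonneg[of 0] by (auto simp: standard_brownian_motion_def)
  then have ind: "indep_vars (\<lambda>_. borel) (\<lambda>i \<omega>. iexp (\<kappa> i * (B (s (Suc i)) \<omega> - B (s i) \<omega>))) {..<3}"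
    by (rule indep_vars_compose2) measurable
  have int: "integrable M (\<lambda>\<omega>. iexp (\<kappa> i * (B (s (Suc i)) \<omega> - B (s i) \<omega>)))" if "i \<in> {..<3}" for i
    using ind that by (intro integrable_const_bound[where B = 1]) (auto simp: indep_vars_def)
  have normal: "(CLINT \<omega>|M. iexp (\<kappa> i * (B (s (Suc i)) \<omega> - B (s i) \<omega>)))
      = exp (- ((\<kappa> i)\<^sup>2 * (s (Suc i) - s i)) / 2)" if "i < 3" for i
  proof -
    have "distributed M lborel (\<lambda>\<omega>. B (s (Suc i)) \<omega> - B (s i) \<omega>) (normal_density 0 (sqrt (s (Suc i) - s i)))"
      using bm s_mono[OF that] s_nonneg[OF that] by (auto simp: standard_brownian_motion_def)
    from expectation_iexp_normal[OF this, of "\<kappa> i"] show ?thesis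
      using s_mono[OF that] by simp
  qed
  have "(CLINT \<omega>|M. (\<Prod>i<3. iexp (\<kappa> i * (B (s (Suc i)) \<omega> - B (s i) \<omega>))))
      = (\<Prod>i<3. CLINT \<omega>|M. iexp (\<kappa> i * (B (s (Suc i)) \<omega> - B (s i) \<omega>)))"
    by (rule indep_vars_lebesgue_integral[OF _ ind int]) auto
  also have "\<dots> = (\<Prod>i<3. complex_of_real (exp (- ((\<kappa> i)\<^sup>2 * (s (Suc i) - s i)) / 2)))"
    using normal by (intro prod.cong) auto
  finally show ?thesis
    by (simp add: numeral_3_eq_3 s_def \<kappa>_def flip: exp_add of_real_add of_real_mult)
      (simp add: algebra_simps add_divide_distrib diff_divide_distrib flip: exp_add)
qed

text \<open>Iterated time integrals also meet coinciding times, while independence and normality are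
  given for strictly increasing ones. Path continuity and dominated convergence supply the
  degenerate cases.\<close>

lemma brownian_char:
  assumes bm: "standard_brownian_motion M B" and X: "\<And>t. X t \<in> borel_measurable M"
    and cont: "\<And>\<omega>. \<omega> \<in> space M \<Longrightarrow> continuous_on UNIV (\<lambda>t. X t \<omega>)"
    and AE: "AE \<omega> in M. \<forall>t\<ge>0. X t \<omega> = B t \<omega>"
    and t: "0 \<le> a" "a \<le> b" "b \<le> c" "c \<le> d"
  shows "(CLINT \<omega>|M. iexp (p * (X b \<omega> - X a \<omega>) + q * (X c \<omega> - X b \<omega>) + r * (X d \<omega> - X c \<omega>)))
     = exp (- (p\<^sup>2 * (b - a) + q\<^sup>2 * (c - b) + r\<^sup>2 * (d - c)) / 2)"
proof -
  interpret prob_space M using bm by (simp add: standard_brownian_motion_def)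
  note [measurable] = X
  define h where "h n = 1 / real (Suc n)" for n
  have h_pos: "h n > 0" for n by (simp add: h_def)
  have h_lim: "h \<longlonglongrightarrow> 0" unfolding h_def by (rule LIMSEQ_Suc) (rule lim_1_over_n)
  \<comment> \<open>Shifts by one, two and three times \<open>h n\<close> separate coinciding times
    and keep their order.\<close>
  let ?b = "\<lambda>n. b + h n" and ?c = "\<lambda>n. c + 2 * h n" and ?d = "\<lambda>n. d + 3 * h n"
  let ?F = "\<lambda>b c d \<omega>. iexp (p * (X b \<omega> - X a \<omega>) + q * (X c \<omega> - X b \<omega>) + r * (X d \<omega> - X c \<omega>))"
  let ?G = "\<lambda>b c d. complex_of_real (exp (- (p\<^sup>2 * (b - a) + q\<^sup>2 * (c - b) + r\<^sup>2 * (d - c)) / 2))"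
  have 1: "integral\<^sup>L M (?F (?b n) (?c n) (?d n)) = ?G (?b n) (?c n) (?d n)" for n
  proof -
    have t': "0 \<le> a" "a < ?b n" "?b n < ?c n" "?c n < ?d n" using t h_pos[of n] by auto
    have B: "B s \<in> borel_measurable M" if "s \<ge> 0" for s
      using bm that by (auto simp: standard_brownian_motion_def)
    have [measurable]: "B a \<in> borel_measurable M" "B (?b n) \<in> borel_measurable M"
      "B (?c n) \<in> borel_measurable M" "B (?d n) \<in> borel_measurable M"
      using t' by (auto intro!: B)
    have "integral\<^sup>L M (?F (?b n) (?c n) (?d n)) = (CLINT \<omega>|M. iexp (p * (B (?b n) \<omega> - B a \<omega>)
        + q * (B (?c n) \<omega> - B (?b n) \<omega>) + r * (B (?d n) \<omega> - B (?c n) \<omega>)))"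
    proof (rule integral_cong_AE)
      show "AE \<omega> in M. ?F (?b n) (?c n) (?d n) \<omega> = iexp (p * (B (?b n) \<omega> - B a \<omega>)
        + q * (B (?c n) \<omega> - B (?b n) \<omega>) + r * (B (?d n) \<omega> - B (?c n) \<omega>))"
        using AE by eventually_elim (use t' in simp)
    qed measurable
    then show ?thesis using brownian_char_strict[OF bm t'] by simp
  qed
  have 2: "(\<lambda>n. integral\<^sup>L M (?F (?b n) (?c n) (?d n))) \<longlonglongrightarrow> integral\<^sup>L M (?F b c d)"
  proof (rule integral_dominated_convergence[where w = "\<lambda>_. 1"])
    show "AE \<omega> in M. (\<lambda>n. ?F (?b n) (?c n) (?d n) \<omega>) \<longlonglongrightarrow> ?F b c d \<omega>"
    proof (rule AE_I2)
      fix \<omega> assume "\<omega> \<in> space M"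
      then have iso: "isCont (\<lambda>t. X t \<omega>) t" for t
        using cont continuous_on_eq_continuous_at[of UNIV] by auto
      have lim: "(\<lambda>n. X (t + C * h n) \<omega>) \<longlonglongrightarrow> X t \<omega>" for t C
        using h_lim by (intro isCont_tendsto_compose[OF iso]) (auto intro!: tendsto_eq_intros)
      show "(\<lambda>n. ?F (?b n) (?c n) (?d n) \<omega>) \<longlonglongrightarrow> ?F b c d \<omega>"
        using lim[of b 1] lim[of c 2] lim[of d 3] by (intro tendsto_intros) auto
    qed
  qed (auto simp: integrable_const)
  have 3: "(\<lambda>n. ?G (?b n) (?c n) (?d n)) \<longlonglongrightarrow> ?G b c d"
    using h_lim by (auto intro!: tendsto_eq_intros)
  show ?thesis
    using LIMSEQ_unique[OF 2] 3 unfolding 1 by blast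
qed

lemma measurable_unit_time_borel [measurable_dest]:
  "f \<in> N \<rightarrow>\<^sub>M unit_time \<Longrightarrow> f \<in> borel_measurable N"
  using measurable_compose[OF _ borel_measurable_unit_time[of "\<lambda>x. x"]] by simp

lemma integral_exp_square_kernel2_le:
  "(\<integral>s. \<integral>t. exp (- (\<kappa>\<^sup>2 / 2) * \<bar>s - t\<bar>) \<partial>unit_time \<partial>unit_time) \<le> 5 / (1 + \<kappa>\<^sup>2)"
proof -
  note borel_measurable_unit_time [measurable (raw)]
  interpret T: prob_space unit_time by (rule prob_space_unit_time)
  have "(\<integral>s. \<integral>t. exp (- (\<kappa>\<^sup>2 / 2) * \<bar>s - t\<bar>) \<partial>unit_time \<partial>unit_time)
      \<le> (\<integral>s. 5 / (1 + \<kappa>\<^sup>2) \<partial>unit_time)"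
  proof (rule integral_mono)
    show "integrable unit_time (\<lambda>s. \<integral>t. exp (- (\<kappa>\<^sup>2 / 2) * \<bar>s - t\<bar>) \<partial>unit_time)"
    proof (rule T.integrable_const_bound[where B = 1])
      show "AE s in unit_time. norm (\<integral>t. exp (- (\<kappa>\<^sup>2 / 2) * \<bar>s - t\<bar>) \<partial>unit_time) \<le> 1"
        using exp_kernel_le_one[of "\<kappa>\<^sup>2 / 2"]
        by (intro AE_I2) (subst real_norm_def, subst abs_of_nonneg, auto intro!: integral_nonneg_AE)
    qed measurable
  qed (use exp_square_kernel_le in auto)
  then show ?thesis using T.prob_space by simp
qed

text \<open>Rounding time down to a rational grid serves twice: for joint measurability of the path,
  and for confinement tested at rational times.\<close>

lemma floor_approx_tendsto:
  "(\<lambda>n. real_of_int \<lfloor>real (Suc n) * x\<rfloor> / real (Suc n)) \<longlonglongrightarrow> x"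
proof (rule real_tendsto_sandwich)
  have "(\<lambda>n. x - 1 / real (Suc n)) \<longlonglongrightarrow> x - 0"
    by (intro tendsto_intros LIMSEQ_Suc lim_1_over_n)
  then show "(\<lambda>n. x - 1 / real (Suc n)) \<longlonglongrightarrow> x" by simp
  have "x - 1 / real (Suc n) \<le> real_of_int \<lfloor>real (Suc n) * x\<rfloor> / real (Suc n)" for n
  proof -
    have "(real (Suc n) * x - 1) / real (Suc n) \<le> real_of_int \<lfloor>real (Suc n) * x\<rfloor> / real (Suc n)"
      by (intro divide_right_mono) linarith+
    then show ?thesis by (simp add: diff_divide_distrib)
  qed
  then show "\<forall>\<^sub>F n in sequentially. x - 1 / real (Suc n) \<le> real_of_int \<lfloor>real (Suc n) * x\<rfloor> / real (Suc n)"
    by simp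
  have "real_of_int \<lfloor>real (Suc n) * x\<rfloor> / real (Suc n) \<le> x" for n
  proof -
    have "real_of_int \<lfloor>real (Suc n) * x\<rfloor> / real (Suc n) \<le> (real (Suc n) * x) / real (Suc n)"
      by (intro divide_right_mono) linarith+
    then show ?thesis by simp
  qed
  then show "\<forall>\<^sub>F n in sequentially. real_of_int \<lfloor>real (Suc n) * x\<rfloor> / real (Suc n) \<le> x"
    by simp
qed simp

text \<open>\<open>X_char\<close> carries the probabilistic content: independence and normality of
  the increments enter only through this joint characteristic function.\<close>

locale brownian_path = prob_space M for M :: "'a measure" +
  fixes X :: "real \<Rightarrow> 'a \<Rightarrow> real"
  assumes X_meas: "X t \<in> borel_measurable M"
    and X_cont: "\<omega> \<in> space M \<Longrightarrow> continuous_on UNIV (\<lambda>t. X t \<omega>)"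
    and X_zero: "\<omega> \<in> space M \<Longrightarrow> X 0 \<omega> = 0"
    and X_char: "0 \<le> a \<Longrightarrow> a \<le> b \<Longrightarrow> b \<le> c \<Longrightarrow> c \<le> d \<Longrightarrow>
      (CLINT \<omega>|M. iexp (p * (X b \<omega> - X a \<omega>) + q * (X c \<omega> - X b \<omega>) + r * (X d \<omega> - X c \<omega>)))
     = exp (- (p\<^sup>2 * (b - a) + q\<^sup>2 * (c - b) + r\<^sup>2 * (d - c)) / 2)"
begin

sublocale T: prob_space unit_time by (rule prob_space_unit_time)
sublocale TM: pair_prob_space unit_time M ..

text \<open>With time rounded to a grid, the path is a countable patchwork of measurable functions,
  and continuity passes measurability to the limit. Fubini over time and chance rests on
  this.\<close>

lemma X_measurable:
  assumes f: "f \<in> N \<rightarrow>\<^sub>M M" and g: "g \<in> borel_measurable N"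
  shows "(\<lambda>x. X (g x) (f x)) \<in> borel_measurable N"
proof (rule borel_measurable_LIMSEQ_metric)
  fix n :: nat
  have "(\<lambda>x. X (real_of_int i / real (Suc n)) (f x)) \<in> borel_measurable N" for i
    using measurable_compose[OF f X_meas] .
  moreover have "(\<lambda>x. \<lfloor>real (Suc n) * g x\<rfloor>) \<in> N \<rightarrow>\<^sub>M count_space UNIV" using g by measurable
  ultimately show "(\<lambda>x. X (real_of_int \<lfloor>real (Suc n) * g x\<rfloor> / real (Suc n)) (f x)) \<in> borel_measurable N"
    by (rule measurable_compose_countable)
next
  fix x assume "x \<in> space N"
  then have iso: "isCont (\<lambda>t. X t (f x)) (g x)"
    using X_cont[of "f x"] measurable_space[OF f] continuous_on_eq_continuous_at[of UNIV] by auto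
  show "(\<lambda>n. X (real_of_int \<lfloor>real (Suc n) * g x\<rfloor> / real (Suc n)) (f x)) \<longlonglongrightarrow> X (g x) (f x)"
    by (rule isCont_tendsto_compose[OF iso floor_approx_tendsto])
qed

lemma X_measurable_const [measurable (raw)]:
  "f \<in> N \<rightarrow>\<^sub>M M \<Longrightarrow> (\<lambda>x. X s (f x)) \<in> borel_measurable N"
  by (rule measurable_compose[OF _ X_meas])
lemma X_measurable_unit_time [measurable (raw)]:
  assumes f: "f \<in> N \<rightarrow>\<^sub>M M" and g: "g \<in> N \<rightarrow>\<^sub>M unit_time"
  shows "(\<lambda>x. X (g x) (f x)) \<in> borel_measurable N"
  using X_measurable[OF f measurable_unit_time_borel[OF g]] .

section \<open>Trigonometric moments at two and four times\<close>

lemma expectation_cos: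
  assumes "0 \<le> a" "a \<le> b" "b \<le> c" "c \<le> d"
  shows "expectation (\<lambda>\<omega>. cos (p * (X b \<omega> - X a \<omega>) + q * (X c \<omega> - X b \<omega>) + r * (X d \<omega> - X c \<omega>)))
     = exp (- (p\<^sup>2 * (b - a) + q\<^sup>2 * (c - b) + r\<^sup>2 * (d - c)) / 2)"
proof -
  let ?F = "\<lambda>\<omega>. iexp (p * (X b \<omega> - X a \<omega>) + q * (X c \<omega> - X b \<omega>) + r * (X d \<omega> - X c \<omega>))"
  have "integrable M ?F"
    by (rule integrable_const_bound[where B = 1]) auto
  then have "Re (integral\<^sup>L M ?F) = expectation (\<lambda>\<omega>. Re (?F \<omega>))"
    by simp
  then show ?thesis unfolding X_char[OF assms] by (simp add: Re_exp)
qed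

lemma expectation_cos_increment:
  assumes "s \<in> {0..1}" "t \<in> {0..1}"
  shows "expectation (\<lambda>\<omega>. cos (\<xi> * (X s \<omega> - X t \<omega>))) = exp (- (\<xi>\<^sup>2 / 2) * \<bar>s - t\<bar>)"
proof (cases "s \<le> t")
  case True
  have "expectation (\<lambda>\<omega>. cos (\<xi> * (X s \<omega> - X t \<omega>)))
      = expectation (\<lambda>\<omega>. cos (\<xi> * (X t \<omega> - X s \<omega>) + 0 * (X t \<omega> - X t \<omega>) + 0 * (X t \<omega> - X t \<omega>)))"
    by (intro Bochner_Integration.integral_cong refl) (metis add.right_neutral cos_minus minus_diff_eq mult_minus_right mult_zero_left)
  then show ?thesis using expectation_cos[of s t t t \<xi> 0 0] True assms by simp
next
  case False
  then show ?thesis using expectation_cos[of t s s s \<xi> 0 0] assms by simp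
qed

lemma expectation_cos_cos:
  assumes "0 \<le> a" "a \<le> b" "b \<le> c" "c \<le> d"
  shows "expectation (\<lambda>\<omega>. cos (p * (X b \<omega> - X a \<omega>) + q * (X c \<omega> - X b \<omega>) + r * (X d \<omega> - X c \<omega>))
         * cos (p' * (X b \<omega> - X a \<omega>) + q' * (X c \<omega> - X b \<omega>) + r' * (X d \<omega> - X c \<omega>)))
     = (exp (- ((p + p')\<^sup>2 * (b - a) + (q + q')\<^sup>2 * (c - b) + (r + r')\<^sup>2 * (d - c)) / 2)
       + exp (- ((p - p')\<^sup>2 * (b - a) + (q - q')\<^sup>2 * (c - b) + (r - r')\<^sup>2 * (d - c)) / 2)) / 2"
proof -
  let ?F = "\<lambda>p q r \<omega>. cos (p * (X b \<omega> - X a \<omega>) + q * (X c \<omega> - X b \<omega>) + r * (X d \<omega> - X c \<omega>))"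
  have int: "integrable M (?F p q r)" for p q r
    by (rule integrable_const_bound[where B = 1]) auto
  have eq: "?F p q r \<omega> * ?F p' q' r' \<omega> = (?F (p + p') (q + q') (r + r') \<omega> + ?F (p - p') (q - q') (r - r') \<omega>) / 2" for \<omega>
    by (simp add: cos_times_cos algebra_simps)
  show ?thesis
    unfolding eq using int
    by (simp add: expectation_cos[OF assms] del: add_divide_distrib)
qed

lemma exp_three_le:
  fixes x y z :: real
  assumes "\<Lambda>\<^sup>2 \<le> A" "\<kappa>\<^sup>2 \<le> B" "\<Lambda>\<^sup>2 \<le> C" "0 \<le> x" "0 \<le> y" "0 \<le> z"
  shows "exp (- (A * x + B * y + C * z) / 2) \<le> exp (- (\<kappa>\<^sup>2 / 2) * y) * exp (- (\<Lambda>\<^sup>2 / 2) * (x + z))"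
proof -
  have "\<Lambda>\<^sup>2 * x \<le> A * x" "\<kappa>\<^sup>2 * y \<le> B * y" "\<Lambda>\<^sup>2 * z \<le> C * z"
    using assms by (auto intro: mult_right_mono)
  then have "- (A * x + B * y + C * z) / 2 \<le> - (\<kappa>\<^sup>2 / 2) * y + - (\<Lambda>\<^sup>2 / 2) * (x + z)"
    by (simp add: field_simps)
  then show ?thesis unfolding exp_add[symmetric] by simp
qed

text \<open>For crossing pairs the phases on the three gaps are \<open>\<xi>\<close>, then
  \<open>\<xi>\<close> plus or minus \<open>\<eta>\<close>, then \<open>\<eta>\<close>. The outer
  gaps decay at least at the fast rate \<open>\<Lambda>\<^sup>2\<close>, the middle gap possibly
  only at the slow rate \<open>(\<xi> - \<eta>)\<^sup>2\<close>.\<close>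

lemma expectation_cos_crossing_le:
  assumes t: "0 \<le> a" "a \<le> b" "b \<le> c" "c \<le> d"
    and \<xi>: "\<Lambda> \<le> \<xi>" "\<Lambda> \<le> \<eta>" "\<Lambda> > 0"
  shows "expectation (\<lambda>\<omega>. cos (\<xi> * (X a \<omega> - X c \<omega>)) * cos (\<eta> * (X b \<omega> - X d \<omega>)))
    \<le> exp (- ((\<xi> - \<eta>)\<^sup>2 / 2) * (c - b)) * exp (- (\<Lambda>\<^sup>2 / 2) * ((b - a) + (d - c)))"
proof -
  have sq: "\<Lambda>\<^sup>2 \<le> \<xi>\<^sup>2" "\<Lambda>\<^sup>2 \<le> \<eta>\<^sup>2" using \<xi> by (auto intro: power_mono)
  have sum: "(\<xi> - \<eta>)\<^sup>2 \<le> (\<xi> + \<eta>)\<^sup>2" using \<xi> by (simp add: power2_eq_square algebra_simps)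
  have "cos (\<xi> * (X a \<omega> - X c \<omega>)) = cos (\<xi> * (X b \<omega> - X a \<omega>) + \<xi> * (X c \<omega> - X b \<omega>) + 0 * (X d \<omega> - X c \<omega>))" for \<omega>
    by (subst cos_minus[symmetric]) (simp add: algebra_simps)
  moreover have "cos (\<eta> * (X b \<omega> - X d \<omega>)) = cos (0 * (X b \<omega> - X a \<omega>) + \<eta> * (X c \<omega> - X b \<omega>) + \<eta> * (X d \<omega> - X c \<omega>))" for \<omega>
    by (subst cos_minus[symmetric]) (simp add: algebra_simps)
  ultimately show ?thesis
    using exp_three_le[OF sq(1) sum sq(2), of "b - a" "c - b" "d - c"]
      exp_three_le[OF sq(1) order_refl sq(2), of "b - a" "c - b" "d - c" "\<xi> - \<eta>"] t
    by (simp only: expectation_cos_cos[OF t]) simp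
qed

text \<open>For nested pairs both outer gaps see \<open>\<xi>\<close> alone and the middle gap sees
  both frequencies, so the decay is bounded as for crossing pairs.\<close>

lemma expectation_cos_nested_le:
  assumes t: "0 \<le> a" "a \<le> b" "b \<le> c" "c \<le> d"
    and \<xi>: "\<Lambda> \<le> \<xi>" "\<Lambda> \<le> \<eta>" "\<Lambda> > 0"
  shows "expectation (\<lambda>\<omega>. cos (\<xi> * (X a \<omega> - X d \<omega>)) * cos (\<eta> * (X b \<omega> - X c \<omega>)))
    \<le> exp (- ((\<xi> - \<eta>)\<^sup>2 / 2) * (c - b)) * exp (- (\<Lambda>\<^sup>2 / 2) * ((b - a) + (d - c)))"
proof -
  have sq: "\<Lambda>\<^sup>2 \<le> \<xi>\<^sup>2" using \<xi> by (auto intro: power_mono)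
  have sum: "(\<xi> - \<eta>)\<^sup>2 \<le> (\<xi> + \<eta>)\<^sup>2" using \<xi> by (simp add: power2_eq_square algebra_simps)
  have "cos (\<xi> * (X a \<omega> - X d \<omega>)) = cos (\<xi> * (X b \<omega> - X a \<omega>) + \<xi> * (X c \<omega> - X b \<omega>) + \<xi> * (X d \<omega> - X c \<omega>))" for \<omega>
    by (subst cos_minus[symmetric]) (simp add: algebra_simps)
  moreover have "cos (\<eta> * (X b \<omega> - X c \<omega>)) = cos (0 * (X b \<omega> - X a \<omega>) + \<eta> * (X c \<omega> - X b \<omega>) + 0 * (X d \<omega> - X c \<omega>))" for \<omega>
    by (subst cos_minus[symmetric]) (simp add: algebra_simps)
  ultimately show ?thesis
    using exp_three_le[OF sq sum sq, of "b - a" "c - b" "d - c"]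
      exp_three_le[OF sq order_refl sq, of "b - a" "c - b" "d - c" "\<xi> - \<eta>"] t
    by (simp only: expectation_cos_cos[OF t]) simp
qed

text \<open>The phase vanishes on the middle gap, so the two factors are uncorrelated: disjoint time
  intervals contribute nothing to the covariance.\<close>

lemma expectation_cos_disjoint:
  assumes t: "0 \<le> a" "a \<le> b" "b \<le> c" "c \<le> d"
  shows "expectation (\<lambda>\<omega>. cos (\<xi> * (X a \<omega> - X b \<omega>)) * cos (\<eta> * (X c \<omega> - X d \<omega>)))
    = exp (- (\<xi>\<^sup>2 / 2) * (b - a)) * exp (- (\<eta>\<^sup>2 / 2) * (d - c))"
proof -
  have "cos (\<xi> * (X a \<omega> - X b \<omega>)) = cos (\<xi> * (X b \<omega> - X a \<omega>) + 0 * (X c \<omega> - X b \<omega>) + 0 * (X d \<omega> - X c \<omega>))" for \<omega>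
    by (subst cos_minus[symmetric]) (simp add: algebra_simps)
  moreover have "cos (\<eta> * (X c \<omega> - X d \<omega>)) = cos (0 * (X b \<omega> - X a \<omega>) + 0 * (X c \<omega> - X b \<omega>) + \<eta> * (X d \<omega> - X c \<omega>))" for \<omega>
    by (subst cos_minus[symmetric]) (simp add: algebra_simps)
  ultimately show ?thesis
    by (simp only: expectation_cos_cos[OF t]) (simp add: add_divide_distrib diff_divide_distrib flip: exp_add)
qed

text \<open>Half of the fast decay over \<open>n\<close> is spent on lengthening the slow factor
  from \<open>m\<close> to \<open>l\<close>; the condition
  \<open>\<kappa>\<^sup>2 \<le> \<Lambda>\<^sup>2 / 2\<close> makes it affordable.\<close>

lemma exp_overlap_le:
  fixes \<kappa> \<Lambda> n l m :: real
  assumes "\<kappa>\<^sup>2 \<le> \<Lambda>\<^sup>2 / 2" "l \<le> m + n" "0 \<le> n"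
  shows "exp (- (\<kappa>\<^sup>2 / 2) * m) * exp (- (\<Lambda>\<^sup>2 / 2) * n) \<le> exp (- (\<kappa>\<^sup>2 / 2) * l) * exp (- (\<Lambda>\<^sup>2 / 4) * n)"
proof -
  have "\<kappa>\<^sup>2 * l \<le> \<kappa>\<^sup>2 * (m + n)" using assms by (intro mult_left_mono) auto
  moreover have "\<kappa>\<^sup>2 * n \<le> \<Lambda>\<^sup>2 / 2 * n" using assms by (intro mult_right_mono) auto
  ultimately have "- (\<kappa>\<^sup>2 / 2) * m + - (\<Lambda>\<^sup>2 / 2) * n \<le> - (\<kappa>\<^sup>2 / 2) * l + - (\<Lambda>\<^sup>2 / 4) * n"
    by (simp add: field_simps)
  then show ?thesis unfolding exp_add[symmetric] by simp
qed

text \<open>Beyond the product of the second moments there is one term, concentrated near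
  \<open>s = u\<close> and \<open>t = v\<close>; this is what survives in the covariance.\<close>

lemma expectation_cos_cos_le_ordered:
  assumes st: "0 \<le> s" "s \<le> t" "0 \<le> u" "u \<le> v"
    and \<xi>: "\<Lambda> \<le> \<xi>" "\<Lambda> \<le> \<eta>" "\<Lambda> > 0" "(\<xi> - \<eta>)\<^sup>2 \<le> \<Lambda>\<^sup>2 / 2"
  shows "expectation (\<lambda>\<omega>. cos (\<xi> * (X s \<omega> - X t \<omega>)) * cos (\<eta> * (X u \<omega> - X v \<omega>)))
    \<le> exp (- (\<xi>\<^sup>2 / 2) * \<bar>s - t\<bar>) * exp (- (\<eta>\<^sup>2 / 2) * \<bar>u - v\<bar>)
      + exp (- ((\<xi> - \<eta>)\<^sup>2 / 2) * \<bar>s - t\<bar>) * exp (- (\<Lambda>\<^sup>2 / 4) * (\<bar>s - u\<bar> + \<bar>t - v\<bar>))"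
    (is "?E \<le> ?P + ?Q")
proof -
  have P: "0 \<le> ?P" and Q: "0 \<le> ?Q" by auto
  have comm: "?E = expectation (\<lambda>\<omega>. cos (\<eta> * (X u \<omega> - X v \<omega>)) * cos (\<xi> * (X s \<omega> - X t \<omega>)))"
    by (simp add: mult.commute)
  have \<kappa>: "(\<eta> - \<xi>)\<^sup>2 = (\<xi> - \<eta>)\<^sup>2" by (rule power2_commute)
  have overlap: "x \<le> ?P + ?Q"
    if "x \<le> exp (- ((\<xi> - \<eta>)\<^sup>2 / 2) * m) * exp (- (\<Lambda>\<^sup>2 / 2) * n)"
      "n = \<bar>s - u\<bar> + \<bar>t - v\<bar>" "\<bar>s - t\<bar> \<le> m + n" for x m n
  proof -
    have "0 \<le> n" using that(2) by simp
    from order_trans[OF that(1) exp_overlap_le[OF \<xi>(4) that(3) this]]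
    have "x \<le> ?Q" unfolding that(2) .
    then show ?thesis by (rule add_increasing[OF P])
  qed
  \<comment> \<open>The intervals [s, t] and [u, v] are disjoint, crossing or nested, each in two
    orders. When they overlap, \<open>m\<close> is the length of the intersection and
    \<open>n\<close> the total length of the two outer gaps.\<close>
  consider "t \<le> u" | "v \<le> s" | "s \<le> u" "u \<le> t" "t \<le> v" | "s \<le> u" "v \<le> t"
    | "u \<le> s" "s \<le> v" "v \<le> t" | "u \<le> s" "t \<le> v" using st by linarith
  then show ?thesis
  proof cases
    case 1
    then have "?E = ?P" using expectation_cos_disjoint[of s t u v \<xi> \<eta>] st by simp
    then show ?thesis using Q by simp
  next
    case 2
    then have "?E = ?P" unfolding comm using expectation_cos_disjoint[of u v s t \<eta> \<xi>] st
      by (simp add: mult.commute)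
    then show ?thesis using Q by simp
  next
    case 3
    show ?thesis
      by (rule overlap[OF expectation_cos_crossing_le[of s u t v \<Lambda> \<xi> \<eta>]]) (use 3 st \<xi> in auto)
  next
    case 4
    show ?thesis
      by (rule overlap[OF expectation_cos_nested_le[of s u v t \<Lambda> \<xi> \<eta>]]) (use 4 st \<xi> in auto)
  next
    case 5
    show ?thesis unfolding comm
      by (rule overlap[OF expectation_cos_crossing_le[of u s v t \<Lambda> \<eta> \<xi>, unfolded \<kappa>]]) (use 5 st \<xi> in auto)
  next
    case 6
    show ?thesis unfolding comm
      by (rule overlap[OF expectation_cos_nested_le[of u s t v \<Lambda> \<eta> \<xi>, unfolded \<kappa>]]) (use 6 st \<xi> in auto)
  qed
qed

text \<open>Exchanging the two times inside a cosine changes nothing, so either matching of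
  \<open>s\<close>, \<open>t\<close> with \<open>u\<close>, \<open>v\<close> can occur and both are
  added. Each kernel is split into factors of one pair of times, so that the variables can be
  integrated out one after another.\<close>

lemma expectation_cos_cos_le:
  assumes st: "0 \<le> s" "0 \<le> t" "0 \<le> u" "0 \<le> v"
    and \<xi>: "\<Lambda> \<le> \<xi>" "\<Lambda> \<le> \<eta>" "\<Lambda> > 0" "(\<xi> - \<eta>)\<^sup>2 \<le> \<Lambda>\<^sup>2 / 2"
  shows "expectation (\<lambda>\<omega>. cos (\<xi> * (X s \<omega> - X t \<omega>)) * cos (\<eta> * (X u \<omega> - X v \<omega>)))
    \<le> exp (- (\<xi>\<^sup>2 / 2) * \<bar>s - t\<bar>) * exp (- (\<eta>\<^sup>2 / 2) * \<bar>u - v\<bar>)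
      + exp (- ((\<xi> - \<eta>)\<^sup>2 / 2) * \<bar>s - t\<bar>) *
        (exp (- (\<Lambda>\<^sup>2 / 4) * \<bar>s - u\<bar>) * exp (- (\<Lambda>\<^sup>2 / 4) * \<bar>t - v\<bar>)
         + exp (- (\<Lambda>\<^sup>2 / 4) * \<bar>s - v\<bar>) * exp (- (\<Lambda>\<^sup>2 / 4) * \<bar>t - u\<bar>))"
proof -
  have swap: "cos (\<zeta> * (X x \<omega> - X y \<omega>)) = cos (\<zeta> * (X y \<omega> - X x \<omega>))" for \<zeta> x y :: real and \<omega>
    by (metis cos_minus minus_diff_eq mult_minus_right)
  have split: "exp (- (\<Lambda>\<^sup>2 / 4) * (x + y)) = exp (- (\<Lambda>\<^sup>2 / 4) * x) * exp (- (\<Lambda>\<^sup>2 / 4) * y)" for x y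
    unfolding exp_add[symmetric] by (simp only: distrib_left)
  note ordered = expectation_cos_cos_le_ordered[OF _ _ _ _ \<xi>, unfolded split]
  have weaken: "x \<le> p + g * (a + b)" if "x \<le> p + g * a \<or> x \<le> p + g * b" "0 \<le> a" "0 \<le> b" "0 \<le> g"
    for x p g a b :: real
  proof -
    have "g * a \<le> g * (a + b)" "g * b \<le> g * (a + b)" using that by (auto intro: mult_left_mono)
    then show ?thesis using that(1) by linarith
  qed
  show ?thesis
  proof (rule weaken)
    consider "s \<le> t" "u \<le> v" | "s \<le> t" "v \<le> u" | "t \<le> s" "u \<le> v" | "t \<le> s" "v \<le> u" by linarith
    then show "expectation (\<lambda>\<omega>. cos (\<xi> * (X s \<omega> - X t \<omega>)) * cos (\<eta> * (X u \<omega> - X v \<omega>)))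
      \<le> exp (- (\<xi>\<^sup>2 / 2) * \<bar>s - t\<bar>) * exp (- (\<eta>\<^sup>2 / 2) * \<bar>u - v\<bar>) + exp (- ((\<xi> - \<eta>)\<^sup>2 / 2) * \<bar>s - t\<bar>) *
        (exp (- (\<Lambda>\<^sup>2 / 4) * \<bar>s - u\<bar>) * exp (- (\<Lambda>\<^sup>2 / 4) * \<bar>t - v\<bar>)) \<or>
      expectation (\<lambda>\<omega>. cos (\<xi> * (X s \<omega> - X t \<omega>)) * cos (\<eta> * (X u \<omega> - X v \<omega>)))
      \<le> exp (- (\<xi>\<^sup>2 / 2) * \<bar>s - t\<bar>) * exp (- (\<eta>\<^sup>2 / 2) * \<bar>u - v\<bar>) + exp (- ((\<xi> - \<eta>)\<^sup>2 / 2) * \<bar>s - t\<bar>) *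
        (exp (- (\<Lambda>\<^sup>2 / 4) * \<bar>s - v\<bar>) * exp (- (\<Lambda>\<^sup>2 / 4) * \<bar>t - u\<bar>))"
    proof cases
      case 1
      then show ?thesis using ordered[of s t u v] st by simp
    next
      case 2
      then show ?thesis using ordered[of s t v u] st
        by (simp add: swap[of \<eta> u _ v] abs_minus_commute[of u v])
    next
      case 3
      then show ?thesis using ordered[of t s u v] st
        by (simp add: swap[of \<xi> s _ t] abs_minus_commute[of s t] mult.commute)
    next
      case 4
      then show ?thesis using ordered[of t s v u] st
        by (simp add: swap[of \<xi> s _ t] swap[of \<eta> u _ v] abs_minus_commute[of s t] abs_minus_commute[of u v] mult.commute)
    qed
  qed auto
qed

end

section \<open>Fourier coefficients of the occupation measure\<close>

text \<open>The bound includes non-integrable functions, whose Bochner integral is 0; this keeps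
  iterated integrals free of measurability side conditions.\<close>

lemma norm_integral_unit_time_le:
  fixes F :: "real \<Rightarrow> 'b::{banach, second_countable_topology}"
  assumes "\<And>t. t \<in> {0..1} \<Longrightarrow> norm (F t) \<le> K" "0 \<le> K"
  shows "norm (\<integral>t. F t \<partial>unit_time) \<le> K"
proof (cases "integrable unit_time F")
  case True
  interpret T: prob_space unit_time by (rule prob_space_unit_time)
  have "norm (\<integral>t. F t \<partial>unit_time) \<le> (\<integral>t. norm (F t) \<partial>unit_time)" by (rule integral_norm_bound)
  also have "\<dots> \<le> (\<integral>t. K \<partial>unit_time)"
    using assms True by (intro integral_mono) auto
  finally show ?thesis using T.prob_space by simp
qed (simp add: not_integrable_integral_eq assms)

lemma integrable_unit_time_bounded:
  fixes F :: "real \<Rightarrow> 'b::{banach, second_countable_topology}"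
  assumes "F \<in> borel_measurable unit_time" "\<And>t. t \<in> {0..1} \<Longrightarrow> norm (F t) \<le> K"
  shows "integrable unit_time F"
proof -
  interpret T: prob_space unit_time by (rule prob_space_unit_time)
  show ?thesis using assms by (intro T.integrable_const_bound[where B = K]) auto
qed

context brownian_path
begin

lemma norm_expectation_le:
  fixes F :: "'a \<Rightarrow> 'b::{banach, second_countable_topology}"
  assumes "\<And>\<omega>. \<omega> \<in> space M \<Longrightarrow> norm (F \<omega>) \<le> K" "0 \<le> K"
  shows "norm (integral\<^sup>L M F) \<le> K"
proof (cases "integrable M F")
  case True
  have "norm (integral\<^sup>L M F) \<le> (\<integral>\<omega>. norm (F \<omega>) \<partial>M)" by (rule integral_norm_bound)
  also have "\<dots> \<le> (\<integral>\<omega>. K \<partial>M)"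
    using assms True by (intro integral_mono) auto
  finally show ?thesis using prob_space by simp
qed (simp add: not_integrable_integral_eq assms)

lemma expectation_unit_time_swap:
  fixes F :: "real \<Rightarrow> 'a \<Rightarrow> 'b::{banach, second_countable_topology}"
  assumes meas: "(\<lambda>(t, \<omega>). F t \<omega>) \<in> borel_measurable (unit_time \<Otimes>\<^sub>M M)"
    and bound: "\<And>t \<omega>. t \<in> {0..1} \<Longrightarrow> \<omega> \<in> space M \<Longrightarrow> norm (F t \<omega>) \<le> K"
  shows "(\<integral>\<omega>. \<integral>t. F t \<omega> \<partial>unit_time \<partial>M) = (\<integral>t. \<integral>\<omega>. F t \<omega> \<partial>M \<partial>unit_time)"
  using meas bound
  by (intro TM.Fubini_integral TM.P.integrable_const_bound[where B = K] AE_I2)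
    (auto simp: space_pair_measure)

text \<open>The Fourier transform of the occupation measure, hence of the local time. Written
  through the path, it has moments that follow from \<open>X_char\<close>.\<close>

definition fcoef :: "real \<Rightarrow> 'a \<Rightarrow> complex" where
  "fcoef \<xi> \<omega> = (CLINT s|unit_time. iexp (\<xi> * X s \<omega>))"

lemma fcoef_measurable [measurable]: "fcoef \<xi> \<in> borel_measurable M"
  unfolding fcoef_def[abs_def] by measurable

lemma norm_fcoef_le: "norm (fcoef \<xi> \<omega>) \<le> 1"
  unfolding fcoef_def by (rule norm_integral_unit_time_le) auto

lemma fcoef_mult_cnj:
  "fcoef \<xi> \<omega> * cnj (fcoef \<eta> \<omega>)
    = (CLINT s|unit_time. CLINT t|unit_time. iexp (\<xi> * X s \<omega> - \<eta> * X t \<omega>))"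
proof -
  have "iexp (\<xi> * X s \<omega> - \<eta> * X t \<omega>) = iexp (\<xi> * X s \<omega>) * cnj (iexp (\<eta> * X t \<omega>))" for s t
    by (simp add: exp_cnj exp_diff exp_minus field_simps right_diff_distrib)
  then show ?thesis
    unfolding fcoef_def
    by (simp add: integral_mult_right_zero integral_mult_left_zero del: complex_cnj_mult)
qed

lemma norm_fcoef_square:
  assumes "\<omega> \<in> space M"
  shows "(norm (fcoef \<xi> \<omega>))\<^sup>2
    = (\<integral>s. \<integral>t. cos (\<xi> * (X s \<omega> - X t \<omega>)) \<partial>unit_time \<partial>unit_time)"
proof -
  have int: "integrable unit_time (\<lambda>t. iexp (\<xi> * X s \<omega> - \<xi> * X t \<omega>))" for s
    using assms by (intro integrable_unit_time_bounded[where K = 1]) auto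
  have "(norm (fcoef \<xi> \<omega>))\<^sup>2 = Re (fcoef \<xi> \<omega> * cnj (fcoef \<xi> \<omega>))"
    by (simp add: complex_mult_cnj cmod_power2)
  also have "\<dots> = (\<integral>s. Re (CLINT t|unit_time. iexp (\<xi> * X s \<omega> - \<xi> * X t \<omega>)) \<partial>unit_time)"
    unfolding fcoef_mult_cnj using assms
    by (intro integral_Re[symmetric] integrable_unit_time_bounded[where K = 1] norm_integral_unit_time_le) auto
  also have "\<dots> = (\<integral>s. \<integral>t. Re (iexp (\<xi> * X s \<omega> - \<xi> * X t \<omega>)) \<partial>unit_time \<partial>unit_time)"
    by (intro Bochner_Integration.integral_cong refl integral_Re[symmetric] int)
  finally show ?thesis by (simp add: Re_exp right_diff_distrib)
qed

lemma expectation_norm_fcoef_square: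
  "expectation (\<lambda>\<omega>. (norm (fcoef \<xi> \<omega>))\<^sup>2)
    = (\<integral>s. \<integral>t. exp (- (\<xi>\<^sup>2 / 2) * \<bar>s - t\<bar>) \<partial>unit_time \<partial>unit_time)"
proof -
  have "expectation (\<lambda>\<omega>. (norm (fcoef \<xi> \<omega>))\<^sup>2)
    = (\<integral>\<omega>. \<integral>s. \<integral>t. cos (\<xi> * (X s \<omega> - X t \<omega>)) \<partial>unit_time \<partial>unit_time \<partial>M)"
    by (intro Bochner_Integration.integral_cong refl norm_fcoef_square)
  also have "\<dots> = (\<integral>s. \<integral>\<omega>. \<integral>t. cos (\<xi> * (X s \<omega> - X t \<omega>)) \<partial>unit_time \<partial>M \<partial>unit_time)"
    by (rule expectation_unit_time_swap[where K = 1]) (measurable, intro norm_integral_unit_time_le, auto)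
  also have "\<dots> = (\<integral>s. \<integral>t. \<integral>\<omega>. cos (\<xi> * (X s \<omega> - X t \<omega>)) \<partial>M \<partial>unit_time \<partial>unit_time)"
    by (intro Bochner_Integration.integral_cong refl expectation_unit_time_swap[where K = 1]) auto
  also have "\<dots> = (\<integral>s. \<integral>t. exp (- (\<xi>\<^sup>2 / 2) * \<bar>s - t\<bar>) \<partial>unit_time \<partial>unit_time)"
    by (intro Bochner_Integration.integral_cong refl expectation_cos_increment) auto
  finally show ?thesis .
qed

lemma integrable_kernel:
  fixes a :: real
  assumes "0 \<le> a"
  shows "integrable unit_time (\<lambda>t. exp (- a * \<bar>s - t\<bar>))"
  using assms by (intro integrable_unit_time_bounded[where K = 1] borel_measurable_unit_time) auto

lemma integrable_kernel2:
  fixes a :: real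
  assumes "0 \<le> a"
  shows "integrable unit_time (\<lambda>s. \<integral>t. exp (- a * \<bar>s - t\<bar>) \<partial>unit_time)"
proof -
  note borel_measurable_unit_time [measurable (raw)]
  show ?thesis
    using assms by (intro integrable_unit_time_bounded[where K = 1] norm_integral_unit_time_le) auto
qed

lemma expectation_norm_fcoef_square_le:
  assumes "\<xi> \<noteq> 0"
  shows "expectation (\<lambda>\<omega>. (norm (fcoef \<xi> \<omega>))\<^sup>2) \<le> 4 / \<xi>\<^sup>2"
proof -
  have "(\<integral>s. \<integral>t. exp (- (\<xi>\<^sup>2 / 2) * \<bar>s - t\<bar>) \<partial>unit_time \<partial>unit_time) \<le> (\<integral>s. 4 / \<xi>\<^sup>2 \<partial>unit_time)"
    using exp_kernel_le[of "\<xi>\<^sup>2 / 2"] assms by (intro integral_mono integrable_kernel2) auto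
  then show ?thesis unfolding expectation_norm_fcoef_square using T.prob_space by simp
qed

text \<open>The condition \<open>\<xi>\<^sup>2 \<ge> 2\<close> says that the rate of the exponential
  kernel is at least 1, the range of \<open>exp_kernel_ge\<close>.\<close>

lemma expectation_norm_fcoef_square_ge:
  assumes "\<xi>\<^sup>2 \<ge> 2"
  shows "1 / (2 * \<xi>\<^sup>2) \<le> expectation (\<lambda>\<omega>. (norm (fcoef \<xi> \<omega>))\<^sup>2)"
proof -
  have "(\<integral>s. 1 / (2 * \<xi>\<^sup>2) \<partial>unit_time) \<le> (\<integral>s. \<integral>t. exp (- (\<xi>\<^sup>2 / 2) * \<bar>s - t\<bar>) \<partial>unit_time \<partial>unit_time)"
    using exp_kernel_ge[of "\<xi>\<^sup>2 / 2"] assms by (intro integral_mono integrable_kernel2) auto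
  then show ?thesis unfolding expectation_norm_fcoef_square using T.prob_space by simp
qed

text \<open>Up to the earlier of the two times the phase is \<open>\<xi> - \<eta>\<close>; between
  them a single frequency remains. The form |0 - s| matches the kernel of
  \<open>exp_square_kernel_le\<close> at the point 0.\<close>

lemma norm_expectation_iexp_le:
  assumes st: "0 \<le> s" "0 \<le> t"
    and \<xi>: "\<Lambda> \<le> \<xi>" "\<Lambda> \<le> \<eta>" "\<Lambda> > 0" "(\<xi> - \<eta>)\<^sup>2 \<le> \<Lambda>\<^sup>2 / 2"
  shows "norm (CLINT \<omega>|M. iexp (\<xi> * X s \<omega> - \<eta> * X t \<omega>))
    \<le> exp (- ((\<xi> - \<eta>)\<^sup>2 / 2) * \<bar>0 - s\<bar>) * exp (- (\<Lambda>\<^sup>2 / 4) * \<bar>s - t\<bar>)"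
proof -
  have sq: "\<Lambda>\<^sup>2 \<le> \<xi>\<^sup>2" "\<Lambda>\<^sup>2 \<le> \<eta>\<^sup>2" using \<xi> by (auto intro: power_mono)
  show ?thesis
  proof (cases "s \<le> t")
    case True
    have "(CLINT \<omega>|M. iexp (\<xi> * X s \<omega> - \<eta> * X t \<omega>))
      = (CLINT \<omega>|M. iexp ((\<xi> - \<eta>) * (X s \<omega> - X 0 \<omega>) + (- \<eta>) * (X t \<omega> - X s \<omega>) + 0 * (X t \<omega> - X t \<omega>)))"
      by (intro Bochner_Integration.integral_cong refl) (simp add: X_zero algebra_simps)
    also have "norm \<dots> = exp (- ((\<xi> - \<eta>)\<^sup>2 * s + \<eta>\<^sup>2 * (t - s)) / 2)"
      using X_char[of 0 s t t "\<xi> - \<eta>" "- \<eta>" 0] st True by simp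
    also have "\<dots> \<le> exp (- ((\<xi> - \<eta>)\<^sup>2 / 2) * \<bar>0 - s\<bar> + - (\<Lambda>\<^sup>2 / 4) * \<bar>s - t\<bar>)"
    proof -
      have *: "L * d \<le> z \<Longrightarrow> 0 \<le> L * d \<Longrightarrow> - (K * s + z) / 2 \<le> - (K / 2) * s + - (L / 4) * d" for L K d z :: real
        by (simp add: field_simps)
      have "- ((\<xi> - \<eta>)\<^sup>2 * s + \<eta>\<^sup>2 * (t - s)) / 2 \<le> - ((\<xi> - \<eta>)\<^sup>2 / 2) * s + - (\<Lambda>\<^sup>2 / 4) * (t - s)"
        by (rule *) (use sq True in \<open>auto intro!: mult_right_mono\<close>)
      then show ?thesis using True st by simp
    qed
    finally show ?thesis unfolding exp_add .
  next
    case False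
    have "(CLINT \<omega>|M. iexp (\<xi> * X s \<omega> - \<eta> * X t \<omega>))
      = (CLINT \<omega>|M. iexp ((\<xi> - \<eta>) * (X t \<omega> - X 0 \<omega>) + \<xi> * (X s \<omega> - X t \<omega>) + 0 * (X s \<omega> - X s \<omega>)))"
      by (intro Bochner_Integration.integral_cong refl) (simp add: X_zero algebra_simps)
    also have "norm \<dots> = exp (- ((\<xi> - \<eta>)\<^sup>2 * t + \<xi>\<^sup>2 * (s - t)) / 2)"
      using X_char[of 0 t s s "\<xi> - \<eta>" \<xi> 0] st False by simp
    \<comment> \<open>Here the slow factor runs only up to \<open>t\<close>. Part of the fast decay
      over \<open>s - t\<close> is spent on lengthening it to \<open>s\<close>.\<close>
    also have "\<dots> \<le> exp (- ((\<xi> - \<eta>)\<^sup>2 / 2) * \<bar>0 - s\<bar> + - (\<Lambda>\<^sup>2 / 4) * \<bar>s - t\<bar>)"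
    proof -
      have *: "L * d \<le> z \<Longrightarrow> K * d \<le> L / 2 * d \<Longrightarrow> - (K * (s - d) + z) / 2 \<le> - (K / 2) * s + - (L / 4) * d" for L K d z :: real
        by (simp add: field_simps)
      have "- ((\<xi> - \<eta>)\<^sup>2 * (s - (s - t)) + \<xi>\<^sup>2 * (s - t)) / 2 \<le> - ((\<xi> - \<eta>)\<^sup>2 / 2) * s + - (\<Lambda>\<^sup>2 / 4) * (s - t)"
        by (rule *) (use sq False \<xi>(4) in \<open>auto intro!: mult_right_mono\<close>)
      then show ?thesis using False st by simp
    qed
    finally show ?thesis unfolding exp_add .
  qed
qed

text \<open>Integrating the preceding bound over \<open>t\<close> costs
  \<open>2 / (\<Lambda>\<^sup>2 / 4)\<close>, and integrating the slow factor over \<open>s\<close>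
  gives the decay in \<open>\<xi> - \<eta>\<close>: coefficients at distant frequencies are nearly
  uncorrelated.\<close>

lemma norm_expectation_fcoef_mult_cnj_le:
  assumes \<xi>: "\<Lambda> \<le> \<xi>" "\<Lambda> \<le> \<eta>" "\<Lambda> > 0" "(\<xi> - \<eta>)\<^sup>2 \<le> \<Lambda>\<^sup>2 / 2"
  shows "norm (CLINT \<omega>|M. fcoef \<xi> \<omega> * cnj (fcoef \<eta> \<omega>)) \<le> 8 / \<Lambda>\<^sup>2 * (5 / (1 + (\<xi> - \<eta>)\<^sup>2))"
proof -
  let ?E = "\<lambda>s t. CLINT \<omega>|M. iexp (\<xi> * X s \<omega> - \<eta> * X t \<omega>)"
  have E_le: "norm (?E s t) \<le> 1" for s t by (rule norm_expectation_le) auto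
  have "(CLINT \<omega>|M. fcoef \<xi> \<omega> * cnj (fcoef \<eta> \<omega>))
    = (CLINT \<omega>|M. CLINT s|unit_time. CLINT t|unit_time. iexp (\<xi> * X s \<omega> - \<eta> * X t \<omega>))"
    unfolding fcoef_mult_cnj ..
  also have "\<dots> = (CLINT s|unit_time. CLINT \<omega>|M. CLINT t|unit_time. iexp (\<xi> * X s \<omega> - \<eta> * X t \<omega>))"
    by (rule expectation_unit_time_swap[where K = 1]) (measurable, intro norm_integral_unit_time_le, auto)
  also have "\<dots> = (CLINT s|unit_time. CLINT t|unit_time. ?E s t)"
    by (intro Bochner_Integration.integral_cong refl expectation_unit_time_swap[where K = 1]) auto
  finally have eq: "(CLINT \<omega>|M. fcoef \<xi> \<omega> * cnj (fcoef \<eta> \<omega>)) = (CLINT s|unit_time. CLINT t|unit_time. ?E s t)" .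
  have "norm (CLINT s|unit_time. CLINT t|unit_time. ?E s t)
      \<le> (\<integral>s. norm (CLINT t|unit_time. ?E s t) \<partial>unit_time)"
    by (rule integral_norm_bound)
  also have "\<dots> \<le> (\<integral>s. 8 / \<Lambda>\<^sup>2 * exp (- ((\<xi> - \<eta>)\<^sup>2 / 2) * \<bar>0 - s\<bar>) \<partial>unit_time)"
  proof (rule integral_mono)
    show "integrable unit_time (\<lambda>s. norm (CLINT t|unit_time. ?E s t))"
      by (intro integrable_norm integrable_unit_time_bounded[where K = 1] norm_integral_unit_time_le E_le) auto
    fix s assume "s \<in> space unit_time"
    then have s: "s \<in> {0..1}" by simp
    have "norm (CLINT t|unit_time. ?E s t) \<le> (\<integral>t. norm (?E s t) \<partial>unit_time)"
      by (rule integral_norm_bound)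
    also have "\<dots> \<le> (\<integral>t. exp (- ((\<xi> - \<eta>)\<^sup>2 / 2) * \<bar>0 - s\<bar>) * exp (- (\<Lambda>\<^sup>2 / 4) * \<bar>s - t\<bar>) \<partial>unit_time)"
    proof (rule integral_mono)
      show "integrable unit_time (\<lambda>t. norm (?E s t))"
        by (intro integrable_norm integrable_unit_time_bounded[where K = 1] E_le) measurable
      show "integrable unit_time (\<lambda>t. exp (- ((\<xi> - \<eta>)\<^sup>2 / 2) * \<bar>0 - s\<bar>) * exp (- (\<Lambda>\<^sup>2 / 4) * \<bar>s - t\<bar>))"
        by (intro integrable_mult_right integrable_kernel) simp
    qed (use norm_expectation_iexp_le[OF _ _ \<xi>] s in auto)
    also have "\<dots> = exp (- ((\<xi> - \<eta>)\<^sup>2 / 2) * \<bar>0 - s\<bar>) * (\<integral>t. exp (- (\<Lambda>\<^sup>2 / 4) * \<bar>s - t\<bar>) \<partial>unit_time)"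
      by (rule integral_mult_right_zero)
    also have "\<dots> \<le> exp (- ((\<xi> - \<eta>)\<^sup>2 / 2) * \<bar>0 - s\<bar>) * (2 / (\<Lambda>\<^sup>2 / 4))"
      using \<xi> s by (intro mult_left_mono exp_kernel_le) auto
    finally show "norm (CLINT t|unit_time. ?E s t) \<le> 8 / \<Lambda>\<^sup>2 * exp (- ((\<xi> - \<eta>)\<^sup>2 / 2) * \<bar>0 - s\<bar>)"
      by (simp add: mult.commute)
  qed (intro integrable_mult_right integrable_kernel, simp)
  also have "\<dots> = 8 / \<Lambda>\<^sup>2 * (\<integral>s. exp (- ((\<xi> - \<eta>)\<^sup>2 / 2) * \<bar>0 - s\<bar>) \<partial>unit_time)"
    by (rule integral_mult_right_zero)
  also have "\<dots> \<le> 8 / \<Lambda>\<^sup>2 * (5 / (1 + (\<xi> - \<eta>)\<^sup>2))"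
    by (intro mult_left_mono exp_square_kernel_le) auto
  finally show ?thesis unfolding eq .
qed

section \<open>Covariances of the squared moduli\<close>

lemma expectation_norm_fcoef_square_prod:
  "expectation (\<lambda>\<omega>. (norm (fcoef \<xi> \<omega>))\<^sup>2 * (norm (fcoef \<eta> \<omega>))\<^sup>2)
    = (\<integral>s. \<integral>t. \<integral>u. \<integral>v. expectation (\<lambda>\<omega>. cos (\<xi> * (X s \<omega> - X t \<omega>)) * cos (\<eta> * (X u \<omega> - X v \<omega>)))
        \<partial>unit_time \<partial>unit_time \<partial>unit_time \<partial>unit_time)"
proof -
  let ?F = "\<lambda>\<omega> s t u v. cos (\<xi> * (X s \<omega> - X t \<omega>)) * cos (\<eta> * (X u \<omega> - X v \<omega>))"
  have F: "norm (?F \<omega> s t u v) \<le> 1" for \<omega> s t u v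
    using mult_mono[of "\<bar>cos (\<xi> * (X s \<omega> - X t \<omega>))\<bar>" 1 "\<bar>cos (\<eta> * (X u \<omega> - X v \<omega>))\<bar>" 1]
    by (simp add: abs_mult)
  have "expectation (\<lambda>\<omega>. (norm (fcoef \<xi> \<omega>))\<^sup>2 * (norm (fcoef \<eta> \<omega>))\<^sup>2)
    = (\<integral>\<omega>. \<integral>s. \<integral>t. \<integral>u. \<integral>v. ?F \<omega> s t u v \<partial>unit_time \<partial>unit_time \<partial>unit_time \<partial>unit_time \<partial>M)"
    by (intro Bochner_Integration.integral_cong refl) (simp add: norm_fcoef_square)
  also have "\<dots> = (\<integral>s. \<integral>\<omega>. \<integral>t. \<integral>u. \<integral>v. ?F \<omega> s t u v \<partial>unit_time \<partial>unit_time \<partial>unit_time \<partial>M \<partial>unit_time)"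
    by (rule expectation_unit_time_swap[where K = 1]) (measurable, intro norm_integral_unit_time_le F, auto)
  also have "\<dots> = (\<integral>s. \<integral>t. \<integral>\<omega>. \<integral>u. \<integral>v. ?F \<omega> s t u v \<partial>unit_time \<partial>unit_time \<partial>M \<partial>unit_time \<partial>unit_time)"
    by (intro Bochner_Integration.integral_cong refl expectation_unit_time_swap[where K = 1] norm_integral_unit_time_le F) auto
  also have "\<dots> = (\<integral>s. \<integral>t. \<integral>u. \<integral>\<omega>. \<integral>v. ?F \<omega> s t u v \<partial>unit_time \<partial>M \<partial>unit_time \<partial>unit_time \<partial>unit_time)"
    by (intro Bochner_Integration.integral_cong refl expectation_unit_time_swap[where K = 1] norm_integral_unit_time_le F) auto
  also have "\<dots> = (\<integral>s. \<integral>t. \<integral>u. \<integral>v. \<integral>\<omega>. ?F \<omega> s t u v \<partial>M \<partial>unit_time \<partial>unit_time \<partial>unit_time \<partial>unit_time)"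
    by (intro Bochner_Integration.integral_cong refl expectation_unit_time_swap[where K = 1] norm_integral_unit_time_le F) auto
  finally show ?thesis .
qed

text \<open>The bound of \<open>expectation_cos_cos_le\<close> is integrated over \<open>v\<close>,
  \<open>u\<close>, \<open>t\<close>, \<open>s\<close> in turn. Its first term returns the product
  of expectations. Each of the two matchings carries two kernels of mass at most
  \<open>8 / \<Lambda>\<^sup>2\<close>, together 128 over the fourth power of
  \<open>\<Lambda>\<close>; the slow kernel contributes the 5 in 640 = 5 * 128.\<close>

lemma covariance_norm_fcoef_square_le:
  assumes \<xi>: "\<Lambda> \<le> \<xi>" "\<Lambda> \<le> \<eta>" "\<Lambda> > 0" "(\<xi> - \<eta>)\<^sup>2 \<le> \<Lambda>\<^sup>2 / 2"
  shows "expectation (\<lambda>\<omega>. (norm (fcoef \<xi> \<omega>))\<^sup>2 * (norm (fcoef \<eta> \<omega>))\<^sup>2)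
    \<le> expectation (\<lambda>\<omega>. (norm (fcoef \<xi> \<omega>))\<^sup>2) * expectation (\<lambda>\<omega>. (norm (fcoef \<eta> \<omega>))\<^sup>2)
      + 640 / \<Lambda>^4 * (1 / (1 + (\<xi> - \<eta>)\<^sup>2))"
proof -
  let ?E = "\<lambda>s t u v. expectation (\<lambda>\<omega>. cos (\<xi> * (X s \<omega> - X t \<omega>)) * cos (\<eta> * (X u \<omega> - X v \<omega>)))"
  have E: "norm (?E s t u v) \<le> 1" for s t u v
    using mult_mono[of "\<bar>cos (\<xi> * (X s \<omega> - X t \<omega>))\<bar>" 1 "\<bar>cos (\<eta> * (X u \<omega> - X v \<omega>))\<bar>" 1 for \<omega>]
    by (intro norm_expectation_le) (simp_all add: abs_mult)
  \<comment> \<open>\<open>k\<close> is the kernel, \<open>K\<close> its integral over one time and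
    \<open>G\<close> over both. Stating these as \<open>has_bochner_integral\<close> facts lets
    every integral below be read off term by term.\<close>
  define k where "k a s t = exp (- a * \<bar>s - t\<bar>)" for a s t :: real
  define K where "K a s = (\<integral>t. k a s t \<partial>unit_time)" for a s
  define G where "G a = (\<integral>s. K a s \<partial>unit_time)" for a
  define x y z w where "x = \<xi>\<^sup>2 / 2" and "y = \<eta>\<^sup>2 / 2" and "z = (\<xi> - \<eta>)\<^sup>2 / 2" and "w = \<Lambda>\<^sup>2 / 4"
  have nonneg: "x \<ge> 0" "y \<ge> 0" "z \<ge> 0" "w \<ge> 0" by (auto simp: x_def y_def z_def w_def)
  have k_pos: "k a s t \<ge> 0" for a s t by (simp add: k_def)
  have K_pos: "K a s \<ge> 0" for a s unfolding K_def by (intro integral_nonneg_AE) (simp add: k_pos)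
  have k1: "has_bochner_integral unit_time (k a s) (K a s)" if "a \<ge> 0" for a s
    using integrable_kernel[OF that, of s] unfolding has_bochner_integral_iff K_def k_def by simp
  have k2: "has_bochner_integral unit_time (K a) (G a)" if "a \<ge> 0" for a
    using integrable_kernel2[OF that] unfolding has_bochner_integral_iff K_def k_def G_def by simp
  have K_le: "K w s \<le> 8 / \<Lambda>\<^sup>2" if "s \<in> {0..1}" for s
    using exp_kernel_le[of w s] that \<xi> by (simp add: K_def k_def w_def)
  have 1: "(\<integral>v. ?E s t u v \<partial>unit_time) \<le> k x s t * K y u + k z s t * (k w s u * K w t + K w s * k w t u)"
    if s: "s \<in> {0..1}" "t \<in> {0..1}" "u \<in> {0..1}" for s t u
  proof -
    have int: "has_bochner_integral unit_time (\<lambda>v. k x s t * k y u v + k z s t * (k w s u * k w t v + k w s v * k w t u))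
      (k x s t * K y u + k z s t * (k w s u * K w t + K w s * k w t u))"
      by (intro has_bochner_integral_add has_bochner_integral_mult_right has_bochner_integral_mult_left k1 nonneg)
    have "(\<integral>v. ?E s t u v \<partial>unit_time)
      \<le> (\<integral>v. k x s t * k y u v + k z s t * (k w s u * k w t v + k w s v * k w t u) \<partial>unit_time)"
    proof (rule integral_mono)
      show "integrable unit_time (?E s t u)"
        by (intro integrable_unit_time_bounded[where K = 1] E) auto
      fix v assume "v \<in> space unit_time"
      then show "?E s t u v \<le> k x s t * k y u v + k z s t * (k w s u * k w t v + k w s v * k w t u)"
        using expectation_cos_cos_le[OF _ _ _ _ \<xi>, of s t u v] s
        unfolding k_def x_def y_def z_def w_def by simp
    qed (use int in \<open>simp add: has_bochner_integral_iff\<close>)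
    then show ?thesis using has_bochner_integral_integral_eq[OF int] by simp
  qed
  have 2: "(\<integral>u. \<integral>v. ?E s t u v \<partial>unit_time \<partial>unit_time) \<le> k x s t * G y + k z s t * (128 / \<Lambda>^4)"
    if s: "s \<in> {0..1}" "t \<in> {0..1}" for s t
  proof -
    have int: "has_bochner_integral unit_time (\<lambda>u. k x s t * K y u + k z s t * (k w s u * K w t + K w s * k w t u))
      (k x s t * G y + k z s t * (K w s * K w t + K w s * K w t))"
      by (intro has_bochner_integral_add has_bochner_integral_mult_right has_bochner_integral_mult_left k1 k2 nonneg)
    have "(\<integral>u. \<integral>v. ?E s t u v \<partial>unit_time \<partial>unit_time)
      \<le> (\<integral>u. k x s t * K y u + k z s t * (k w s u * K w t + K w s * k w t u) \<partial>unit_time)"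
    proof (rule integral_mono)
      show "integrable unit_time (\<lambda>u. \<integral>v. ?E s t u v \<partial>unit_time)"
        by (intro integrable_unit_time_bounded[where K = 1] norm_integral_unit_time_le E) auto
    qed (use int 1 s in \<open>auto simp add: has_bochner_integral_iff\<close>)
    also have "\<dots> = k x s t * G y + k z s t * (K w s * K w t + K w s * K w t)"
      by (rule has_bochner_integral_integral_eq[OF int])
    also have "\<dots> \<le> k x s t * G y + k z s t * (8 / \<Lambda>\<^sup>2 * (8 / \<Lambda>\<^sup>2) + 8 / \<Lambda>\<^sup>2 * (8 / \<Lambda>\<^sup>2))"
      using K_le s by (intro add_left_mono mult_left_mono add_mono mult_mono K_pos k_pos) auto
    finally show ?thesis by (simp add: power2_eq_square power4_eq_xxxx)
  qed
  have 3: "(\<integral>t. \<integral>u. \<integral>v. ?E s t u v \<partial>unit_time \<partial>unit_time \<partial>unit_time) \<le> K x s * G y + K z s * (128 / \<Lambda>^4)"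
    if s: "s \<in> {0..1}" for s
  proof -
    have int: "has_bochner_integral unit_time (\<lambda>t. k x s t * G y + k z s t * (128 / \<Lambda>^4))
      (K x s * G y + K z s * (128 / \<Lambda>^4))"
      by (intro has_bochner_integral_add has_bochner_integral_mult_left k1 nonneg)
    have "(\<integral>t. \<integral>u. \<integral>v. ?E s t u v \<partial>unit_time \<partial>unit_time \<partial>unit_time)
      \<le> (\<integral>t. k x s t * G y + k z s t * (128 / \<Lambda>^4) \<partial>unit_time)"
    proof (rule integral_mono)
      show "integrable unit_time (\<lambda>t. \<integral>u. \<integral>v. ?E s t u v \<partial>unit_time \<partial>unit_time)"
        by (intro integrable_unit_time_bounded[where K = 1] norm_integral_unit_time_le E) auto
    qed (use int 2 s in \<open>auto simp add: has_bochner_integral_iff\<close>)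
    then show ?thesis using has_bochner_integral_integral_eq[OF int] by simp
  qed
  have int: "has_bochner_integral unit_time (\<lambda>s. K x s * G y + K z s * (128 / \<Lambda>^4))
      (G x * G y + G z * (128 / \<Lambda>^4))"
    by (intro has_bochner_integral_add has_bochner_integral_mult_left k2 nonneg)
  have "(\<integral>s. \<integral>t. \<integral>u. \<integral>v. ?E s t u v \<partial>unit_time \<partial>unit_time \<partial>unit_time \<partial>unit_time)
    \<le> (\<integral>s. K x s * G y + K z s * (128 / \<Lambda>^4) \<partial>unit_time)"
  proof (rule integral_mono)
    show "integrable unit_time (\<lambda>s. \<integral>t. \<integral>u. \<integral>v. ?E s t u v \<partial>unit_time \<partial>unit_time \<partial>unit_time)"
      by (intro integrable_unit_time_bounded[where K = 1] norm_integral_unit_time_le E) auto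
  qed (use int 3 in \<open>auto simp add: has_bochner_integral_iff\<close>)
  also have "\<dots> = G x * G y + G z * (128 / \<Lambda>^4)"
    by (rule has_bochner_integral_integral_eq[OF int])
  also have "\<dots> \<le> G x * G y + 5 / (1 + (\<xi> - \<eta>)\<^sup>2) * (128 / \<Lambda>^4)"
    using integral_exp_square_kernel2_le[of "\<xi> - \<eta>"]
    by (intro add_left_mono mult_right_mono) (simp_all add: G_def K_def k_def z_def)
  finally show ?thesis
    unfolding expectation_norm_fcoef_square_prod expectation_norm_fcoef_square
    by (simp add: G_def K_def k_def x_def y_def mult.commute)
qed

lemma integrable_norm_fcoef_square [simp]:
  "integrable M (\<lambda>\<omega>. (norm (fcoef \<xi> \<omega>))\<^sup>2)"
  "integrable M (\<lambda>\<omega>. (norm (fcoef \<xi> \<omega>))\<^sup>2 * (norm (fcoef \<eta> \<omega>))\<^sup>2)"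
  by (intro integrable_const_bound[where B = 1] AE_I2;
      simp add: power_le_one norm_fcoef_le mult_le_one)+

lemma integrable_fcoef_mult_cnj [simp]:
  "integrable M (\<lambda>\<omega>. fcoef \<xi> \<omega> * cnj (fcoef \<eta> \<omega>))"
proof -
  have [measurable]: "(\<lambda>\<omega>. cnj (fcoef \<eta> \<omega>)) \<in> borel_measurable M"
    by (rule borel_measurable_continuous_on[where f = cnj]) (auto intro: continuous_intros)
  show ?thesis
    by (intro integrable_const_bound[where B = 1] AE_I2)
      (simp_all add: norm_mult norm_fcoef_le mult_le_one)
qed

text \<open>The variance is the double sum of the covariances, and each row is at most a multiple of
  \<open>S\<close>; hence the bound is linear in the number of rows.\<close>

lemma variance_sum_norm_fcoef_square_le:
  assumes J: "finite J" and \<xi>: "\<And>j. j \<in> J \<Longrightarrow> \<Lambda> \<le> \<xi> j" "\<Lambda> > 0"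
    and near: "\<And>i j. i \<in> J \<Longrightarrow> j \<in> J \<Longrightarrow> (\<xi> i - \<xi> j)\<^sup>2 \<le> \<Lambda>\<^sup>2 / 2"
    and S: "\<And>i. i \<in> J \<Longrightarrow> (\<Sum>j\<in>J. 1 / (1 + (\<xi> i - \<xi> j)\<^sup>2)) \<le> S"
  shows "variance (\<lambda>\<omega>. \<Sum>j\<in>J. (norm (fcoef (\<xi> j) \<omega>))\<^sup>2) \<le> 640 / \<Lambda>^4 * (real (card J) * S)"
proof -
  let ?c = "\<lambda>j \<omega>. (norm (fcoef (\<xi> j) \<omega>))\<^sup>2"
  have square: "(\<Sum>j\<in>J. ?c j \<omega>)\<^sup>2 = (\<Sum>i\<in>J. \<Sum>j\<in>J. ?c i \<omega> * ?c j \<omega>)" for \<omega>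
    by (simp add: power2_eq_square sum_product)
  have "variance (\<lambda>\<omega>. \<Sum>j\<in>J. ?c j \<omega>)
      = expectation (\<lambda>\<omega>. (\<Sum>j\<in>J. ?c j \<omega>)\<^sup>2) - (expectation (\<lambda>\<omega>. \<Sum>j\<in>J. ?c j \<omega>))\<^sup>2"
    by (intro variance_eq) (auto simp: square)
  also have "\<dots> = (\<Sum>i\<in>J. \<Sum>j\<in>J. expectation (\<lambda>\<omega>. ?c i \<omega> * ?c j \<omega>) - expectation (?c i) * expectation (?c j))"
    unfolding square by (simp add: power2_eq_square[of "sum _ _"] sum_product sum_subtractf)
  also have "\<dots> \<le> (\<Sum>i\<in>J. \<Sum>j\<in>J. 640 / \<Lambda>^4 * (1 / (1 + (\<xi> i - \<xi> j)\<^sup>2)))"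
    using covariance_norm_fcoef_square_le[OF \<xi>(1) \<xi>(1) \<xi>(2) near]
    by (intro sum_mono) (simp add: algebra_simps)
  also have "\<dots> = 640 / \<Lambda>^4 * (\<Sum>i\<in>J. \<Sum>j\<in>J. 1 / (1 + (\<xi> i - \<xi> j)\<^sup>2))"
    by (simp only: sum_distrib_left)
  also have "\<dots> \<le> 640 / \<Lambda>^4 * (\<Sum>i\<in>J. S)"
    using \<xi>(2) by (intro mult_left_mono sum_mono S) auto
  finally show ?thesis by simp
qed

text \<open>A Schur test: products of two moduli are replaced by the mean of their squares, and the
  symmetry of the kernel leaves only its row sums. Thus a fixed unit direction captures little of
  the coefficients in mean square.\<close>

lemma expectation_norm_sum_fcoef_square_le:
  fixes z :: "'i \<Rightarrow> complex"
  assumes J: "finite J" and \<xi>: "\<And>j. j \<in> J \<Longrightarrow> \<Lambda> \<le> \<xi> j" "\<Lambda> > 0"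
    and near: "\<And>i j. i \<in> J \<Longrightarrow> j \<in> J \<Longrightarrow> (\<xi> i - \<xi> j)\<^sup>2 \<le> \<Lambda>\<^sup>2 / 2"
    and S: "\<And>i. i \<in> J \<Longrightarrow> (\<Sum>j\<in>J. 1 / (1 + (\<xi> i - \<xi> j)\<^sup>2)) \<le> S"
  shows "expectation (\<lambda>\<omega>. (norm (\<Sum>j\<in>J. z j * fcoef (\<xi> j) \<omega>))\<^sup>2) \<le> 40 / \<Lambda>\<^sup>2 * S * (\<Sum>j\<in>J. (norm (z j))\<^sup>2)"
proof -
  let ?P = "\<lambda>i j \<omega>. fcoef (\<xi> i) \<omega> * cnj (fcoef (\<xi> j) \<omega>)"
  let ?h = "\<lambda>i j. 1 / (1 + (\<xi> i - \<xi> j)\<^sup>2)"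
  have eq: "complex_of_real ((norm (\<Sum>j\<in>J. z j * fcoef (\<xi> j) \<omega>))\<^sup>2)
      = (\<Sum>i\<in>J. \<Sum>j\<in>J. (z i * cnj (z j)) * ?P i j \<omega>)" for \<omega>
    unfolding complex_norm_square by (simp add: cnj_sum sum_product mult_ac)
  have "complex_of_real (expectation (\<lambda>\<omega>. (norm (\<Sum>j\<in>J. z j * fcoef (\<xi> j) \<omega>))\<^sup>2))
      = (CLINT \<omega>|M. (\<Sum>i\<in>J. \<Sum>j\<in>J. (z i * cnj (z j)) * ?P i j \<omega>))"
    unfolding eq[symmetric] by (rule integral_complex_of_real[symmetric])
  also have "\<dots> = (\<Sum>i\<in>J. \<Sum>j\<in>J. (z i * cnj (z j)) * integral\<^sup>L M (?P i j))"
    by simp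
  finally have complex: "complex_of_real (expectation (\<lambda>\<omega>. (norm (\<Sum>j\<in>J. z j * fcoef (\<xi> j) \<omega>))\<^sup>2))
      = (\<Sum>i\<in>J. \<Sum>j\<in>J. (z i * cnj (z j)) * integral\<^sup>L M (?P i j))" .
  have "expectation (\<lambda>\<omega>. (norm (\<Sum>j\<in>J. z j * fcoef (\<xi> j) \<omega>))\<^sup>2)
      \<le> norm (complex_of_real (expectation (\<lambda>\<omega>. (norm (\<Sum>j\<in>J. z j * fcoef (\<xi> j) \<omega>))\<^sup>2)))"
    unfolding norm_of_real by (rule abs_ge_self)
  also have "\<dots> = norm (\<Sum>i\<in>J. \<Sum>j\<in>J. (z i * cnj (z j)) * integral\<^sup>L M (?P i j))"
    unfolding complex ..
  also have "\<dots> \<le> (\<Sum>i\<in>J. \<Sum>j\<in>J. norm ((z i * cnj (z j)) * integral\<^sup>L M (?P i j)))"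
    by (intro order_trans[OF norm_sum] sum_mono order_refl)
  also have "\<dots> \<le> (\<Sum>i\<in>J. \<Sum>j\<in>J. ((norm (z i))\<^sup>2 + (norm (z j))\<^sup>2) / 2 * (40 / \<Lambda>\<^sup>2 * ?h i j))"
  proof (intro sum_mono)
    fix i j assume ij: "i \<in> J" "j \<in> J"
    have "norm (z i) * norm (z j) \<le> ((norm (z i))\<^sup>2 + (norm (z j))\<^sup>2) / 2"
      using sum_squares_bound[of "norm (z i)" "norm (z j)"] by simp
    moreover have "norm (integral\<^sup>L M (?P i j)) \<le> 40 / \<Lambda>\<^sup>2 * ?h i j"
      using norm_expectation_fcoef_mult_cnj_le[OF \<xi>(1)[OF ij(1)] \<xi>(1)[OF ij(2)] \<xi>(2) near[OF ij]] by simp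
    ultimately show "norm ((z i * cnj (z j)) * integral\<^sup>L M (?P i j))
        \<le> ((norm (z i))\<^sup>2 + (norm (z j))\<^sup>2) / 2 * (40 / \<Lambda>\<^sup>2 * ?h i j)"
      unfolding norm_mult complex_mod_cnj by (intro mult_mono) auto
  qed
  also have "\<dots> = (\<Sum>i\<in>J. \<Sum>j\<in>J. 40 / \<Lambda>\<^sup>2 * (norm (z i))\<^sup>2 * ?h i j)"
  proof -
    have sym: "(\<Sum>i\<in>J. \<Sum>j\<in>J. (norm (z j))\<^sup>2 * ?h i j) = (\<Sum>i\<in>J. \<Sum>j\<in>J. (norm (z i))\<^sup>2 * ?h i j)"
      by (subst sum.swap) (simp add: power2_commute)
    have "(\<Sum>i\<in>J. \<Sum>j\<in>J. ((norm (z i))\<^sup>2 + (norm (z j))\<^sup>2) / 2 * (40 / \<Lambda>\<^sup>2 * ?h i j))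
        = 20 / \<Lambda>\<^sup>2 * ((\<Sum>i\<in>J. \<Sum>j\<in>J. (norm (z i))\<^sup>2 * ?h i j) + (\<Sum>i\<in>J. \<Sum>j\<in>J. (norm (z j))\<^sup>2 * ?h i j))"
      unfolding sum_distrib_left sum.distrib[symmetric]
      by (intro sum.cong refl) (simp add: add_divide_distrib distrib_left distrib_right)
    then show ?thesis unfolding sym by (simp add: sum_distrib_left mult.assoc)
  qed
  also have "\<dots> = (\<Sum>i\<in>J. 40 / \<Lambda>\<^sup>2 * (norm (z i))\<^sup>2 * (\<Sum>j\<in>J. ?h i j))"
    by (simp only: sum_distrib_left)
  also have "\<dots> \<le> (\<Sum>i\<in>J. 40 / \<Lambda>\<^sup>2 * (norm (z i))\<^sup>2 * S)"
    by (intro sum_mono mult_left_mono S) auto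
  also have "\<dots> = 40 / \<Lambda>\<^sup>2 * S * (\<Sum>j\<in>J. (norm (z j))\<^sup>2)"
    unfolding sum_distrib_left by (intro sum.cong refl) simp
  finally show ?thesis .
qed

end

section \<open>Trigonometric bases and the local time\<close>

lemma inner_abs_L2:
  assumes "square_integrable f" "square_integrable g"
  shows "inner (abs_L2 f) (abs_L2 g) = (LINT x|lborel. f x * g x)"
  using assms by (simp add: inner_L2.abs_eq eq_onp_def L2_rel_def)

lemma dist_abs_L2:
  assumes "square_integrable f" "square_integrable g"
  shows "dist (abs_L2 f) (abs_L2 g) = sqrt (LINT x|lborel. (f x - g x)\<^sup>2)"
proof -
  have g: "square_integrable (\<lambda>x. - g x)"
    using square_integrable_cmult[OF assms(2), of "-1"] by simp
  have "abs_L2 f - abs_L2 g = abs_L2 (\<lambda>x. f x + - g x)"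
    using assms g square_integrable_add[OF assms(1) g]
    by (simp add: diff_conv_add_uminus uminus_L2.abs_eq plus_L2.abs_eq eq_onp_def L2_rel_def
        del: add_uminus_conv_diff)
  then show ?thesis
    unfolding dist_norm using norm_abs_L2[OF square_integrable_add[OF assms(1) g]] by simp
qed

text \<open>The free phase \<open>b\<close> covers cosines, sines (at \<open>- pi / 2\<close>) and
  the shifted cosines of the half-range basis.\<close>

definition cos_fun :: "real \<Rightarrow> real \<Rightarrow> real \<Rightarrow> real \<Rightarrow> real" where
  "cos_fun R a b x = indicator {-R..R} x * cos (a * x + b)"

lemma cos_fun_measurable [measurable]: "cos_fun R a b \<in> borel_measurable borel"
  unfolding cos_fun_def[abs_def] by measurable

lemma integral_cos_Icc:
  fixes R a b :: real
  assumes "R > 0"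
  shows "has_bochner_integral lborel (\<lambda>x. cos (a * x + b) * indicator {-R..R} x)
    (if a = 0 then 2 * R * cos b else 2 * cos b * sin (a * R) / a)"
proof (cases "a = 0")
  case True
  have "has_bochner_integral lborel (\<lambda>x. indicator {-R..R} x *\<^sub>R cos b) (measure lborel {-R..R} *\<^sub>R cos b)"
    using assms by (intro has_bochner_integral_indicator) auto
  then show ?thesis using assms True by (simp add: mult.commute)
next
  case False
  have "has_bochner_integral lborel (\<lambda>x. cos (a * x + b) * indicator {-R..R} x)
      (sin (a * R + b) / a - sin (a * (- R) + b) / a)"
    using assms False by (intro has_bochner_integral_FTC_Icc_real)
      (auto intro!: derivative_eq_intros continuous_intros)
  moreover have "sin (a * R + b) / a - sin (a * (- R) + b) / a = 2 * cos b * sin (a * R) / a"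
    by (simp add: sin_add sin_diff diff_divide_distrib[symmetric])
  ultimately show ?thesis using False by simp
qed

lemma cos_fun_prod_integral:
  assumes "R > 0"
  defines "I \<equiv> \<lambda>a b. if a = 0 then 2 * R * cos b else 2 * cos b * sin (a * R) / a"
  shows "has_bochner_integral lborel (\<lambda>x. cos_fun R a b x * cos_fun R a' b' x)
    ((I (a - a') (b - b') + I (a + a') (b + b')) / 2)"
proof -
  have eq: "cos_fun R a b x * cos_fun R a' b' x
    = (cos ((a - a') * x + (b - b')) * indicator {-R..R} x + cos ((a + a') * x + (b + b')) * indicator {-R..R} x) / 2" for x
    by (simp add: cos_fun_def cos_times_cos indicator_def algebra_simps)
  show ?thesis unfolding eq I_def
    by (intro has_bochner_integral_divide_zero has_bochner_integral_add integral_cos_Icc assms)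
qed

lemma square_integrable_cos_fun:
  assumes "R > 0"
  shows "square_integrable (cos_fun R a b)"
  using cos_fun_prod_integral[OF assms, of a b a b]
  by (simp add: square_integrable_def power2_eq_square has_bochner_integral_iff)

lemma inner_cos_fun:
  assumes "R > 0"
  defines "I \<equiv> \<lambda>a b. if a = 0 then 2 * R * cos b else 2 * cos b * sin (a * R) / a"
  shows "inner (abs_L2 (cos_fun R a b)) (abs_L2 (cos_fun R a' b')) = (I (a - a') (b - b') + I (a + a') (b + b')) / 2"
  using has_bochner_integral_integral_eq[OF cos_fun_prod_integral[OF assms(1)]]
  by (simp add: inner_abs_L2 square_integrable_cos_fun assms)

text \<open>The Fourier basis of [-R, R]: the flag \<open>False\<close> marks cosines,
  \<open>True\<close> marks sines.\<close>

definition trig_basis :: "real \<Rightarrow> nat \<times> bool \<Rightarrow> L2" where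
  "trig_basis R p = abs_L2 (cos_fun R (pi * real (fst p) / R) (if snd p then - pi / 2 else 0)) /\<^sub>R sqrt R"

lemma sin_of_nat_diff_mult_pi: "sin (pi * real i - pi * real j) = 0"
  by (simp add: sin_diff mult.commute)

lemma sin_of_nat_add_mult_pi: "sin (pi * real i + pi * real j) = 0"
  by (simp add: sin_add mult.commute)

text \<open>Index 0 is kept out, since there the cosine has squared norm 2 after scaling and the
  sine vanishes.\<close>

lemma orthonormal_trig_basis:
  assumes "R > 0" "\<And>p. p \<in> T \<Longrightarrow> fst p > 0"
  shows "orthonormal_on T (trig_basis R)"
  unfolding orthonormal_on_def
proof (intro ballI)
  fix p q assume "p \<in> T" "q \<in> T"
  then obtain i j \<sigma> \<tau> where p: "p = (i, \<sigma>)" "i > 0" and q: "q = (j, \<tau>)" "j > 0"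
    using assms(2) by (metis prod.collapse)
  have 1: "(pi * real i / R - pi * real j / R) * R = pi * real i - pi * real j"
    "(pi * real i / R + pi * real j / R) * R = pi * real i + pi * real j"
    using assms(1) by (simp_all add: left_diff_distrib distrib_right)
  have 2: "pi * real i / R + pi * real j / R \<noteq> 0"
    using assms(1) p q by (metis add_pos_pos divide_pos_pos less_irrefl mult_pos_pos of_nat_0_less_iff pi_gt_zero)
  have 3: "pi * real i / R - pi * real j / R = 0 \<longleftrightarrow> i = j"
    using assms(1) by (simp add: divide_simps)
  have "inner (trig_basis R p) (trig_basis R q) = inverse R *
    inner (abs_L2 (cos_fun R (pi * real i / R) (if \<sigma> then - pi / 2 else 0)))
          (abs_L2 (cos_fun R (pi * real j / R) (if \<tau> then - pi / 2 else 0)))"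
    using assms(1) by (simp add: trig_basis_def p q field_simps)
  also have "\<dots> = (if i = j \<and> \<sigma> = \<tau> then 1 else 0)"
    unfolding inner_cos_fun[OF assms(1)] 1 sin_of_nat_diff_mult_pi sin_of_nat_add_mult_pi
    using 2 3 assms(1) by auto
  finally show "inner (trig_basis R p) (trig_basis R q) = (if p = q then 1 else 0)"
    by (simp add: p q)
qed

text \<open>Normalised cosines of pi * j * (x + R) / (2 * R), the Neumann basis of [-R, R]. There is
  one function per index, and each is a polynomial in the first cosine on the interval, which opens
  the way to density by polynomial approximation.\<close>

definition half_range_basis :: "real \<Rightarrow> nat \<Rightarrow> L2" where
  "half_range_basis R j = abs_L2 (cos_fun R (pi * real j / (2 * R)) (pi * real j / 2)) /\<^sub>R sqrt (if j = 0 then 2 * R else R)"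

lemma orthonormal_half_range_basis:
  assumes "R > 0"
  shows "orthonormal_on UNIV (half_range_basis R)"
  unfolding orthonormal_on_def
proof (intro ballI)
  fix i j :: nat
  define I where "I a b = (if a = 0 then 2 * R * cos b else 2 * cos b * sin (a * R) / a)" for a b
  \<comment> \<open>The off-diagonal value contains 2 * cos (pi * n / 2) * sin (pi * n / 2) = sin
    (pi * n), which vanishes at integers. \<open>n\<close> is real because differences of indices
    may be negative.\<close>
  have I: "I (pi * n / (2 * R)) (pi * n / 2) = (if n = 0 then 2 * R else 0)" if "sin (pi * n) = 0" for n
  proof -
    have "2 * (cos (pi * n / 2) * sin (pi * n / 2)) = 0"
      using sin_double[of "pi * n / 2"] that by (simp add: mult.commute)
    then show ?thesis using assms by (auto simp: I_def)
  qed
  have minus: "I (pi * real i / (2 * R) - pi * real j / (2 * R)) (pi * real i / 2 - pi * real j / 2) = (if i = j then 2 * R else 0)"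
    using I[of "real i - real j"] sin_of_nat_diff_mult_pi[of i j]
    by (simp add: right_diff_distrib diff_divide_distrib)
  have plus: "I (pi * real i / (2 * R) + pi * real j / (2 * R)) (pi * real i / 2 + pi * real j / 2) = (if i = 0 \<and> j = 0 then 2 * R else 0)"
    using I[of "real i + real j"] sin_of_nat_add_mult_pi[of i j]
    by (simp add: distrib_left add_divide_distrib)
  show "inner (half_range_basis R i) (half_range_basis R j) = (if i = j then 1 else 0)"
    unfolding half_range_basis_def inner_scaleR_left inner_scaleR_right
      inner_cos_fun[OF assms, folded I_def] minus plus
    using assms by (auto simp: field_simps)
qed

section \<open>The local time tested against cosines\<close>

lemma occupation_measure_integral:
  fixes g :: "real \<Rightarrow> real"
  assumes w: "continuous_on UNIV w" and l: "continuous_on UNIV l" "\<And>x. 0 \<le> l x"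
    and occ: "occupation_measure 1 w = density lborel (\<lambda>x. ennreal (l x))"
    and g: "g \<in> borel_measurable borel"
  shows "(LINT x|lborel. l x * g x) = (\<integral>t. g (w t) \<partial>unit_time)"
proof -
  have [measurable]: "l \<in> borel_measurable borel" "w \<in> borel_measurable borel"
    using w l(1) by (auto intro: borel_measurable_continuous_onI)
  have "(LINT x|lborel. l x * g x) = (\<integral>x. g x \<partial>density lborel (\<lambda>x. ennreal (l x)))"
    using g l by (subst integral_real_density) auto
  also have "\<dots> = (\<integral>t. g (w t) \<partial>unit_time)"
    unfolding occ[symmetric] occupation_measure_def unit_time_def[symmetric]
    using g borel_measurable_unit_time[of w] by (subst integral_distr) auto
  finally show ?thesis .
qed

lemma occupation_density_zero_outside:
  assumes w: "continuous_on UNIV w" and l: "continuous_on UNIV l" "\<And>x. 0 \<le> l x"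
    and occ: "occupation_measure 1 w = density lborel (\<lambda>x. ennreal (l x))"
    and R: "\<And>t. t \<in> {0..1} \<Longrightarrow> \<bar>w t\<bar> \<le> R"
  shows "AE x in lborel. x \<notin> {-R..R} \<longrightarrow> l x = 0"
proof -
  have [measurable]: "l \<in> borel_measurable borel" "w \<in> borel_measurable borel"
    using w l(1) by (auto intro: borel_measurable_continuous_onI)
  have "(\<integral>\<^sup>+x. ennreal (l x) * indicator (- {-R..R}) x \<partial>lborel)
      = emeasure (density lborel (\<lambda>x. ennreal (l x))) (- {-R..R})"
    by (subst emeasure_density) auto
  also have "\<dots> = emeasure unit_time (w -` (- {-R..R}) \<inter> {0..1})"
    unfolding occ[symmetric] occupation_measure_def unit_time_def[symmetric]
    using borel_measurable_unit_time[of w] by (simp add: emeasure_distr)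
  also have "w -` (- {-R..R}) \<inter> {0..1} = {}" using R by (force simp: abs_le_iff)
  finally have "(\<integral>\<^sup>+x. ennreal (l x) * indicator (- {-R..R}) x \<partial>lborel) = 0" by simp
  then have "AE x in lborel. ennreal (l x) * indicator (- {-R..R}) x = 0"
    by (simp add: nn_integral_0_iff_AE)
  then show ?thesis
    by eventually_elim (use l(2) in \<open>auto simp: indicator_def ennreal_eq_0_iff split: if_splits intro: antisym\<close>)
qed

lemma square_integrable_compact_support:
  assumes l: "continuous_on UNIV (l :: real \<Rightarrow> real)"
    and AE: "AE x in lborel. x \<notin> {-R..R} \<longrightarrow> l x = 0"
  shows "square_integrable l"
proof -
  have [measurable]: "l \<in> borel_measurable borel"
    using l by (auto intro: borel_measurable_continuous_onI)
  have "integrable lborel (\<lambda>x. indicator {-R..R} x *\<^sub>R (l x)\<^sup>2)"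
    by (rule borel_integrable_compact) (auto intro!: continuous_intros continuous_on_subset[OF l])
  then have "integrable lborel (\<lambda>x. (l x)\<^sup>2)"
  proof (rule integrable_cong_AE_imp)
    show "AE x in lborel. indicator {-R..R} x *\<^sub>R (l x)\<^sup>2 = (l x)\<^sup>2"
      using AE by eventually_elim auto
  qed measurable
  then show ?thesis by (simp add: square_integrable_def)
qed

text \<open>Along a path confined to [-R, R] the indicator in \<open>cos_fun\<close> equals 1, so
  the occupation formula turns the inner product into a time average.\<close>

lemma inner_occupation_density_cos_fun:
  assumes w: "continuous_on UNIV w" and l: "continuous_on UNIV l" "\<And>x. 0 \<le> l x"
    and occ: "occupation_measure 1 w = density lborel (\<lambda>x. ennreal (l x))"
    and R: "R > 0" "\<And>t. t \<in> {0..1} \<Longrightarrow> \<bar>w t\<bar> \<le> R"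
  shows "inner (abs_L2 l) (abs_L2 (cos_fun R a b)) = (\<integral>t. cos (a * w t + b) \<partial>unit_time)"
proof -
  have sq: "square_integrable l"
    by (rule square_integrable_compact_support[OF l(1) occupation_density_zero_outside[OF w l occ R(2)]])
  have "inner (abs_L2 l) (abs_L2 (cos_fun R a b)) = (LINT x|lborel. l x * cos_fun R a b x)"
    by (rule inner_abs_L2[OF sq square_integrable_cos_fun[OF R(1)]])
  also have "\<dots> = (\<integral>t. cos_fun R a b (w t) \<partial>unit_time)"
    by (rule occupation_measure_integral[OF w l occ]) measurable
  also have "\<dots> = (\<integral>t. cos (a * w t + b) \<partial>unit_time)"
  proof (rule Bochner_Integration.integral_cong[OF refl])
    fix t assume "t \<in> space unit_time"
    then show "cos_fun R a b (w t) = cos (a * w t + b)"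
      using R(2)[of t] by (auto simp: cos_fun_def abs_le_iff indicator_def)
  qed
  finally show ?thesis .
qed

section \<open>Density of the half-range cosines\<close>

lemma abs_L2_add:
  assumes "square_integrable f" "square_integrable g"
  shows "abs_L2 (\<lambda>x. f x + g x) = abs_L2 f + abs_L2 g"
  using assms square_integrable_add[OF assms]
  by (simp add: plus_L2.abs_eq eq_onp_def L2_rel_def)

lemma abs_L2_cmult:
  assumes "square_integrable f"
  shows "abs_L2 (\<lambda>x. c * f x) = c *\<^sub>R abs_L2 f"
  using assms square_integrable_cmult[OF assms]
  by (simp add: scaleR_L2.abs_eq eq_onp_def L2_rel_def)

text \<open>Collecting functions rather than classes lets membership in a span be derived from
  pointwise identities.\<close>

definition L2_span :: "L2 set \<Rightarrow> (real \<Rightarrow> real) set" where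
  "L2_span B = {f. square_integrable f \<and> abs_L2 f \<in> span B}"

lemma L2_span_add: "f \<in> L2_span B \<Longrightarrow> g \<in> L2_span B \<Longrightarrow> (\<lambda>x. f x + g x) \<in> L2_span B"
  by (auto simp: L2_span_def square_integrable_add abs_L2_add span_add)

lemma L2_span_cmult: "f \<in> L2_span B \<Longrightarrow> (\<lambda>x. c * f x) \<in> L2_span B"
  by (auto simp: L2_span_def square_integrable_cmult abs_L2_cmult span_scale)

lemma L2_span_sum:
  assumes "finite I" "\<And>i. i \<in> I \<Longrightarrow> f i \<in> L2_span B"
  shows "(\<lambda>x. \<Sum>i\<in>I. f i x) \<in> L2_span B"
  using assms
proof (induction rule: finite_induct)
  case empty
  have "abs_L2 (\<lambda>x. 0) = 0" by (simp add: zero_L2_def)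
  then show ?case by (simp add: L2_span_def square_integrable_zero span_zero)
next
  case (insert i I)
  then show ?case using L2_span_add[of "f i" B "\<lambda>x. \<Sum>i\<in>I. f i x"] by simp
qed

text \<open>Multiplying cos (j * theta) by cos theta gives half the sum of the cosines at indices
  \<open>j + 1\<close> and \<open>j - 1\<close>. One power is thus traded for a change of
  \<open>j\<close>, hence the induction on \<open>i\<close> with \<open>j\<close> arbitrary.\<close>

lemma cos_power_in_half_range_span:
  assumes "R > 0"
  shows "(\<lambda>x. indicator {-R..R} x * (cos (pi * x / (2 * R) + pi / 2) ^ i * cos (real j * (pi * x / (2 * R) + pi / 2))))
    \<in> L2_span (range (half_range_basis R))"
proof (induction i arbitrary: j)
  case 0
  have eq: "cos_fun R (pi * real j / (2 * R)) (pi * real j / 2)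
      = (\<lambda>x. indicator {-R..R} x * (cos (pi * x / (2 * R) + pi / 2) ^ 0 * cos (real j * (pi * x / (2 * R) + pi / 2))))"
    by (rule ext) (simp add: cos_fun_def distrib_left mult_ac)
  have "abs_L2 (cos_fun R (pi * real j / (2 * R)) (pi * real j / 2)) \<in> span (range (half_range_basis R))"
  proof -
    have "sqrt (if j = 0 then 2 * R else R) *\<^sub>R half_range_basis R j \<in> span (range (half_range_basis R))"
      by (intro span_scale span_base) auto
    then show ?thesis using assms by (simp add: half_range_basis_def split: if_splits)
  qed
  then have "cos_fun R (pi * real j / (2 * R)) (pi * real j / 2) \<in> L2_span (range (half_range_basis R))"
    using square_integrable_cos_fun[OF assms] by (simp add: L2_span_def)
  then show ?case unfolding eq .
next
  case (Suc i)
  let ?\<theta> = "\<lambda>x. pi * x / (2 * R) + pi / 2"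
  \<comment> \<open>\<open>m\<close> stands for |j - 1|; at \<open>j = 0\<close> the evenness of the
    cosine gives 1.\<close>
  obtain m where m: "\<And>x::real. cos (real m * x) = cos (real j * x - x)"
  proof (cases j)
    case 0
    then show ?thesis using that[of 1] by simp
  next
    case (Suc n)
    then show ?thesis using that[of n] by (simp add: distrib_right)
  qed
  have trig: "cos \<theta> * cos (real j * \<theta>) = (1/2) * cos (real (Suc j) * \<theta>) + (1/2) * cos (real m * \<theta>)" for \<theta> :: real
  proof -
    have "real (Suc j) * \<theta> = real j * \<theta> + \<theta>" by (simp add: distrib_right)
    then show ?thesis unfolding m by (simp only: cos_add cos_diff) (simp add: field_simps)
  qed
  have distr: "c * (q ^ Suc i * z) = (1/2) * (c * (q ^ i * x)) + (1/2) * (c * (q ^ i * y))"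
    if "q * z = (1/2) * x + (1/2) * y" for c q x y z :: real
  proof -
    have "c * (q ^ Suc i * z) = c * q ^ i * (q * z)" by simp
    then show ?thesis unfolding that by (simp add: algebra_simps)
  qed
  have eq: "(\<lambda>x. indicator {-R..R} x * (cos (?\<theta> x) ^ Suc i * cos (real j * ?\<theta> x)))
    = (\<lambda>x. (1/2) * (indicator {-R..R} x * (cos (?\<theta> x) ^ i * cos (real (Suc j) * ?\<theta> x)))
       + (1/2) * (indicator {-R..R} x * (cos (?\<theta> x) ^ i * cos (real m * ?\<theta> x))))"
    by (intro ext distr trig)
  show ?case unfolding eq by (intro L2_span_add L2_span_cmult Suc)
qed

text \<open>The cosine of pi * (x + R) / (2 * R) maps [-R, R] bijectively onto [-1, 1].
  Stone-Weierstrass there approximates \<open>l\<close> by a polynomial in this cosine, which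
  \<open>cos_power_in_half_range_span\<close> places in the span.\<close>

lemma half_range_basis_dense:
  assumes R: "R > 0" and l: "continuous_on UNIV l" and AE: "AE x in lborel. x \<notin> {-R..R} \<longrightarrow> l x = 0"
    and \<epsilon>: "\<epsilon> > 0"
  shows "\<exists>y \<in> span (range (half_range_basis R)). dist (abs_L2 l) y < \<epsilon>"
proof -
  \<comment> \<open>A uniform error \<open>\<epsilon>'\<close> on an interval of length
    \<open>2 * R\<close> gives squared L2 error at most
    \<open>\<epsilon>\<^sup>2 / 2\<close>.\<close>
  define \<epsilon>' where "\<epsilon>' = \<epsilon> / (2 * sqrt R)"
  have \<epsilon>': "\<epsilon>' > 0" using R \<epsilon> by (simp add: \<epsilon>'_def)
  have "continuous_on {-1..1} (\<lambda>y. l (2 * R * arccos y / pi - R))"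
    by (rule continuous_on_compose2[OF l]) (auto intro!: continuous_intros)
  then obtain p where p: "real_polynomial_function p" "\<And>y. y \<in> {-1..1} \<Longrightarrow> \<bar>l (2 * R * arccos y / pi - R) - p y\<bar> < \<epsilon>'"
    using Stone_Weierstrass_real_polynomial_function[of "{-1..1::real}" _ \<epsilon>'] \<epsilon>' by auto
  obtain a n where a: "p = (\<lambda>y. \<Sum>i\<le>n. a i * y ^ i)"
    using p(1) unfolding real_polynomial_function_iff_sum by auto
  let ?\<theta> = "\<lambda>x. pi * x / (2 * R) + pi / 2"
  define f where "f x = indicator {-R..R} x * p (cos (?\<theta> x))" for x
  have "f = (\<lambda>x. \<Sum>i\<le>n. a i * (indicator {-R..R} x * (cos (?\<theta> x) ^ i * cos (real 0 * ?\<theta> x))))"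
    by (rule ext) (simp add: f_def a sum_distrib_left mult_ac)
  then have f: "f \<in> L2_span (range (half_range_basis R))"
    using cos_power_in_half_range_span[OF R, of _ 0] by (auto intro!: L2_span_sum L2_span_cmult)
  have sq: "square_integrable l" "square_integrable f"
    using square_integrable_compact_support[OF l AE] f by (auto simp: L2_span_def)
  have close: "\<bar>l x - f x\<bar> \<le> \<epsilon>'" if "x \<in> {-R..R}" for x
  proof -
    have "0 \<le> pi * (x + R) / (2 * R)" "pi * (x + R) / (2 * R) \<le> pi"
      using that R by (auto simp: divide_simps)
    moreover have \<theta>: "?\<theta> x = pi * (x + R) / (2 * R)" using R by (simp add: field_simps)
    ultimately have "arccos (cos (?\<theta> x)) = ?\<theta> x" by (intro arccos_cos) auto
    then have "2 * R * arccos (cos (?\<theta> x)) / pi - R = x" using R by (simp add: \<theta>)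
    then show ?thesis using p(2)[of "cos (?\<theta> x)"] that by (simp add: f_def)
  qed
  have "(LINT x|lborel. (l x - f x)\<^sup>2) \<le> (LINT x|lborel. indicator {-R..R} x * \<epsilon>'\<^sup>2)"
  proof (rule integral_mono_AE)
    have "square_integrable (\<lambda>x. l x + (-1) * f x)"
      by (intro square_integrable_add square_integrable_cmult sq)
    then show "integrable lborel (\<lambda>x. (l x - f x)\<^sup>2)" by (simp add: square_integrable_def)
    show "integrable lborel (\<lambda>x. indicator {-R..R} x * \<epsilon>'\<^sup>2)"
      by (intro integrable_mult_left integrable_real_indicator)
        (auto simp: emeasure_lborel_Icc_eq)
    show "AE x in lborel. (l x - f x)\<^sup>2 \<le> indicator {-R..R} x * \<epsilon>'\<^sup>2"
      using AE
    proof eventually_elim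
      case (elim x)
      then show ?case
        using close[of x] abs_le_square_iff[of "l x - f x" \<epsilon>'] \<epsilon>' by (auto simp: f_def indicator_def)
    qed
  qed
  also have "\<dots> = 2 * R * \<epsilon>'\<^sup>2" using R by simp
  also have "\<dots> = \<epsilon>\<^sup>2 / 2" using R by (simp add: \<epsilon>'_def power_divide power_mult_distrib)
  also have "\<dots> < \<epsilon>\<^sup>2" using \<epsilon> by simp
  finally have "sqrt (LINT x|lborel. (l x - f x)\<^sup>2) < sqrt (\<epsilon>\<^sup>2)"
    by (rule real_sqrt_less_mono)
  then have "dist (abs_L2 l) (abs_L2 f) < \<epsilon>"
    using dist_abs_L2[OF sq] \<epsilon> by simp
  then show ?thesis using f by (auto simp: L2_span_def)
qed

section \<open>The probability of a small distance\<close>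

context brownian_path
begin

text \<open>Only rational times are tested, to make the event measurable; continuity gives all of \<open>[0, 1]\<close>.\<close>

definition confined :: "real \<Rightarrow> 'a set" where
  "confined R = {\<omega> \<in> space M. \<forall>n. \<forall>k\<in>{..Suc n}. \<bar>X (real k / real (Suc n)) \<omega>\<bar> \<le> R}"

lemma confined_measurable [measurable]: "confined R \<in> sets M"
  unfolding confined_def by measurable

lemma confinedD:
  assumes "\<omega> \<in> confined R" "t \<in> {0..1}"
  shows "\<bar>X t \<omega>\<bar> \<le> R"
proof -
  have \<omega>: "\<omega> \<in> space M" using assms by (simp add: confined_def)
  have cont: "isCont (\<lambda>t. X t \<omega>) t" for t
    using X_cont[OF \<omega>] continuous_on_eq_continuous_at[of UNIV] by auto
  have approx: "\<bar>X (real_of_int \<lfloor>real (Suc n) * t\<rfloor> / real (Suc n)) \<omega>\<bar> \<le> R" for n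
  proof -
    define k where "k = nat \<lfloor>real (Suc n) * t\<rfloor>"
    have k: "real_of_int \<lfloor>real (Suc n) * t\<rfloor> = real k"
      using assms(2) by (simp add: k_def)
    have "real (Suc n) * t \<le> real (Suc n) * 1" using assms(2) by (intro mult_left_mono) auto
    then have "real k \<le> real (Suc n)" unfolding k[symmetric]
      using of_int_floor_le order_trans by (metis mult.right_neutral)
    then have "k \<in> {..Suc n}" by simp
    then show ?thesis using assms(1) unfolding k confined_def by blast
  qed
  have "(\<lambda>n. \<bar>X (real_of_int \<lfloor>real (Suc n) * t\<rfloor> / real (Suc n)) \<omega>\<bar>) \<longlonglongrightarrow> \<bar>X t \<omega>\<bar>"
    by (intro tendsto_rabs isCont_tendsto_compose[OF cont] floor_approx_tendsto)
  then show ?thesis by (rule LIMSEQ_le_const2) (use approx in blast)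
qed

text \<open>A continuous path is bounded on [0, 1], so these increasing events exhaust the
  space.\<close>

lemma prob_confined_tendsto: "(\<lambda>n. prob (confined (real n))) \<longlonglongrightarrow> 1"
proof -
  have "(\<Union>n. confined (real n)) = space M"
  proof (intro equalityI subsetI)
    fix \<omega> assume \<omega>: "\<omega> \<in> space M"
    then have "compact ((\<lambda>t. X t \<omega>) ` {0..1})"
      by (intro compact_continuous_image continuous_on_subset[OF X_cont]) auto
    then have "\<exists>b. \<forall>t\<in>{0..1}. \<bar>X t \<omega>\<bar> \<le> b"
      by (auto dest!: compact_imp_bounded simp: bounded_iff)
    then obtain b where b: "\<And>t. t \<in> {0..1} \<Longrightarrow> \<bar>X t \<omega>\<bar> \<le> b" by blast
    obtain n where "b \<le> real n" using real_arch_simple by blast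
    have "\<bar>X (real i / real (Suc m)) \<omega>\<bar> \<le> real n" if "i \<in> {..Suc m}" for i m
      using that by (intro order_trans[OF b \<open>b \<le> real n\<close>]) simp
    then have "\<omega> \<in> confined (real n)"
      using \<omega> unfolding confined_def by blast
    then show "\<omega> \<in> (\<Union>n. confined (real n))" by blast
  qed (auto simp: confined_def)
  moreover have "(\<lambda>n. prob (confined (real n))) \<longlonglongrightarrow> prob (\<Union>n. confined (real n))"
    by (intro finite_Lim_measure_incseq) (force simp: incseq_def confined_def)+
  ultimately show ?thesis by (simp add: prob_space)
qed

lemma confined_exhausts:
  assumes "\<epsilon> > 0"
  obtains n where "real n \<ge> K" "prob (space M - confined (real n)) \<le> \<epsilon>"
proof -
  have "\<forall>\<^sub>F n in sequentially. prob (confined (real n)) > 1 - \<epsilon>"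
    using prob_confined_tendsto assms by (intro order_tendstoD(1)) auto
  moreover have "\<forall>\<^sub>F n in sequentially. real n \<ge> K"
    using eventually_ge_at_top[of "nat \<lceil>K\<rceil>"] by eventually_elim linarith
  ultimately have "\<forall>\<^sub>F n in sequentially. prob (confined (real n)) > 1 - \<epsilon> \<and> real n \<ge> K"
    by eventually_elim simp
  then obtain n where "prob (confined (real n)) > 1 - \<epsilon>" "real n \<ge> K"
    using eventually_happens'[OF sequentially_bot] by blast
  then show ?thesis using that[of n] by (simp add: prob_compl)
qed

lemma Re_fcoef:
  assumes "\<omega> \<in> space M"
  shows "Re (fcoef \<xi> \<omega>) = (\<integral>t. cos (\<xi> * X t \<omega>) \<partial>unit_time)"
    and "Im (fcoef \<xi> \<omega>) = (\<integral>t. sin (\<xi> * X t \<omega>) \<partial>unit_time)"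
proof -
  have "integrable unit_time (\<lambda>t. iexp (\<xi> * X t \<omega>))"
    using assms by (intro integrable_unit_time_bounded[where K = 1]) auto
  from integral_Re[OF this] integral_Im[OF this]
  show "Re (fcoef \<xi> \<omega>) = (\<integral>t. cos (\<xi> * X t \<omega>) \<partial>unit_time)"
    and "Im (fcoef \<xi> \<omega>) = (\<integral>t. sin (\<xi> * X t \<omega>) \<partial>unit_time)"
    by (simp_all add: fcoef_def Re_exp Im_exp)
qed

text \<open>The phase \<open>b\<close> only rotates the coefficient: the integral is the real part
  of \<open>iexp b\<close> times \<open>fcoef \<xi> \<omega>\<close>.\<close>

lemma abs_integral_cos_le_fcoef:
  assumes "\<omega> \<in> space M"
  shows "\<bar>\<integral>t. cos (\<xi> * X t \<omega> + b) \<partial>unit_time\<bar> \<le> norm (fcoef \<xi> \<omega>)"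
proof -
  have "integrable unit_time (\<lambda>t. iexp b * iexp (\<xi> * X t \<omega>))"
    using assms by (intro integrable_unit_time_bounded[where K = 1]) (auto simp: norm_mult)
  from integral_Re[OF this]
  have "(\<integral>t. cos (\<xi> * X t \<omega> + b) \<partial>unit_time) = Re (CLINT t|unit_time. iexp b * iexp (\<xi> * X t \<omega>))"
    by (simp add: Re_exp Im_exp cos_add mult.commute)
  also have "\<dots> = Re (iexp b * fcoef \<xi> \<omega>)"
    unfolding fcoef_def by (simp only: integral_mult_right_zero)
  finally have "\<bar>\<integral>t. cos (\<xi> * X t \<omega> + b) \<partial>unit_time\<bar> \<le> norm (iexp b * fcoef \<xi> \<omega>)"
    using abs_Re_le_cmod by metis
  then show ?thesis by (simp add: norm_mult)
qed

end

locale brownian_local_time = brownian_path M X for M :: "'a measure" and X +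
  fixes L :: "real \<Rightarrow> 'a \<Rightarrow> real"
  assumes L_AE: "AE \<omega> in M. continuous_on UNIV (\<lambda>x. L x \<omega>) \<and> (\<forall>x. 0 \<le> L x \<omega>) \<and>
        occupation_measure 1 (\<lambda>t. X t \<omega>) = density lborel (\<lambda>x. ennreal (L x \<omega>))"
begin

abbreviation L_vec :: "'a \<Rightarrow> L2" where
  "L_vec \<omega> \<equiv> abs_L2 (\<lambda>x. L x \<omega>)"

text \<open>One null set serves all \<open>R\<close>, \<open>a\<close> and \<open>b\<close> at once.
  Continuity and support are recorded as well, being the hypotheses of
  \<open>half_range_basis_dense\<close>.\<close>

lemma L_inner_AE:
  "AE \<omega> in M. \<forall>R>0. \<omega> \<in> confined R \<longrightarrow>
     continuous_on UNIV (\<lambda>x. L x \<omega>) \<and> (AE x in lborel. x \<notin> {-R..R} \<longrightarrow> L x \<omega> = 0) \<and>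
     (\<forall>a b. inner (L_vec \<omega>) (abs_L2 (cos_fun R a b)) = (\<integral>t. cos (a * X t \<omega> + b) \<partial>unit_time))"
  using L_AE
proof eventually_elim
  case (elim \<omega>)
  show ?case
  proof (intro allI impI)
    fix R :: real assume R: "R > 0" and \<omega>: "\<omega> \<in> confined R"
    have path: "continuous_on UNIV (\<lambda>t. X t \<omega>)"
      using \<omega> by (intro X_cont) (simp add: confined_def)
    note l = conjunct1[OF elim] spec[OF conjunct1[OF conjunct2[OF elim]]] conjunct2[OF conjunct2[OF elim]]
    show "continuous_on UNIV (\<lambda>x. L x \<omega>) \<and> (AE x in lborel. x \<notin> {-R..R} \<longrightarrow> L x \<omega> = 0) \<and>
     (\<forall>a b. inner (L_vec \<omega>) (abs_L2 (cos_fun R a b)) = (\<integral>t. cos (a * X t \<omega> + b) \<partial>unit_time))"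
      using occupation_density_zero_outside[OF path l, of R]
        inner_occupation_density_cos_fun[OF path l R] confinedD[OF \<omega>] l(1) by auto
  qed
qed

lemma L_trig_basis_AE:
  "AE \<omega> in M. \<forall>R>0. \<omega> \<in> confined R \<longrightarrow> (\<forall>j.
     inner (L_vec \<omega>) (trig_basis R (j, False)) = Re (fcoef (pi * real j / R) \<omega>) / sqrt R \<and>
     inner (L_vec \<omega>) (trig_basis R (j, True)) = Im (fcoef (pi * real j / R) \<omega>) / sqrt R)"
  using L_inner_AE
proof eventually_elim
  case (elim \<omega>)
  show ?case
  proof (intro allI impI)
    fix R :: real and j assume R: "R > 0" and \<omega>: "\<omega> \<in> confined R"
    then have *: "\<omega> \<in> space M" "inner (L_vec \<omega>) (abs_L2 (cos_fun R a b)) = (\<integral>t. cos (a * X t \<omega> + b) \<partial>unit_time)" for a b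
      using elim by (auto simp: confined_def)
    have cos_shift: "cos (x + - pi / 2) = sin x" for x :: real
      using cos_diff[of x "pi / 2"] by simp
    have inner: "inner (L_vec \<omega>) (trig_basis R (j, \<sigma>))
        = (\<integral>t. cos (pi * real j / R * X t \<omega> + (if \<sigma> then - pi / 2 else 0)) \<partial>unit_time) / sqrt R" for \<sigma>
      unfolding trig_basis_def inner_scaleR_right *(2) fst_conv snd_conv
      by (simp only: divide_inverse mult.commute)
    show "inner (L_vec \<omega>) (trig_basis R (j, False)) = Re (fcoef (pi * real j / R) \<omega>) / sqrt R \<and>
     inner (L_vec \<omega>) (trig_basis R (j, True)) = Im (fcoef (pi * real j / R) \<omega>) / sqrt R"
      unfolding inner Re_fcoef[OF *(1)] by (simp only: if_True if_False add_0_right cos_shift simp_thms)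
  qed
qed

text \<open>\<open>G\<close> covers, up to a null set, the outcomes whose distance is below
  \<open>\<delta>\<close>. Working with a measurable cover avoids any discussion of the
  measurability of the distance.\<close>

lemma small_distance_event:
  assumes V: "V \<in> subspaces_dim_le k" and k: "k \<ge> 1" and \<delta>: "\<delta> > 0"
  shows "\<exists>G \<in> sets M. prob G \<le> 2 * 10^8 * real k * \<delta>\<^sup>2 \<and>
     (AE \<omega> in M. \<omega> \<notin> G \<longrightarrow> \<delta> \<le> infdist (L_vec \<omega>) V)"
proof (cases "2 * 10^8 * \<delta>\<^sup>2 < 1")
  \<comment> \<open>For such \<open>\<delta>\<close> the claimed bound is at least 1, and the whole
    space serves as \<open>G\<close>.\<close>
  case False
  have "real k * (2 * 10^8 * \<delta>\<^sup>2) \<ge> 1 * 1" using False k by (intro mult_mono) auto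
  then show ?thesis using order_trans[OF prob_le_1[of "space M"]]
    by (intro bexI[of _ "space M"] conjI) (auto simp: mult_ac)
next
  case \<delta>_small: True
  \<comment> \<open>The radius may depend on \<open>\<delta>\<close>: apart from this escape
    probability, the final bounds involve only the ratio \<open>R / real N\<close>.\<close>
  obtain n where n: "real n \<ge> 1" "prob (space M - confined (real n)) \<le> \<delta>\<^sup>2"
    using confined_exhausts[of "\<delta>\<^sup>2" 1] \<delta> by auto
  define R where "R = real n"
  have R: "R \<ge> 1" "R > 0" "prob (space M - confined R) \<le> \<delta>\<^sup>2" using n by (auto simp: R_def)
  \<comment> \<open>The constant 800 exceeds 72 * pi^2, which in the end makes
    \<open>m / 4 / R\<close> at least \<open>\<delta>\<^sup>2\<close>. Rounding costs at most a
    factor 2, because the quotient is at least 1.\<close>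
  define N where "N = nat \<lfloor>R / (800 * \<delta>\<^sup>2)\<rfloor>"
  have ratio: "R / (800 * \<delta>\<^sup>2) \<ge> 1"
  proof -
    have "800 * \<delta>\<^sup>2 \<le> 1" using \<delta>_small by simp
    then show ?thesis using R \<delta> by (simp add: divide_simps)
  qed
  have N_le: "real N \<le> R / (800 * \<delta>\<^sup>2)" using ratio by (simp add: N_def)
  have N_pos: "N \<ge> 1" using ratio by (simp add: N_def le_nat_iff)
  have "R / (800 * \<delta>\<^sup>2) < real N + 1" using ratio unfolding N_def by linarith
  also have "\<dots> \<le> 2 * real N" using N_pos by simp
  finally have N_ge: "R / real N \<le> 1600 * \<delta>\<^sup>2" using \<delta> N_pos by (simp add: divide_simps mult_ac)
  define \<Lambda> where "\<Lambda> = 2 * pi * real N / R"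
  define \<xi> where "\<xi> j = pi * real j / R" for j :: nat
  \<comment> \<open>These frequencies lie between \<open>\<Lambda>\<close> and
    \<open>3 / 2 * \<Lambda>\<close>, so they differ by at most \<open>\<Lambda> / 2\<close>, well
    within what the covariance bounds allow.\<close>
  define J where "J = {2 * N..<3 * N}"
  have J: "finite J" "card J = N" by (auto simp: J_def)
  have \<Lambda>_pos: "\<Lambda> > 0" using R N_pos by (simp add: \<Lambda>_def)
  \<comment> \<open>This secures the condition \<open>(\<xi> j)\<^sup>2 \<ge> 2\<close> of the lower
    moment bound.\<close>
  have \<Lambda>_ge: "\<Lambda> \<ge> 2"
  proof -
    have "R / real N \<le> 1" using N_ge \<delta>_small by simp
    then have "R \<le> real N" using N_pos by (simp add: divide_simps)
    moreover have "2 * real N \<le> 2 * pi * real N" using pi_gt3 by (intro mult_right_mono) auto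
    ultimately have "2 * R \<le> 2 * pi * real N" by linarith
    then show ?thesis using R by (simp add: \<Lambda>_def divide_simps)
  qed
  have \<xi>_ge: "\<Lambda> \<le> \<xi> j" if "j \<in> J" for j
    using that R by (auto simp: \<Lambda>_def \<xi>_def J_def intro!: divide_right_mono)
  have \<xi>_le: "\<xi> j \<le> 3 / 2 * \<Lambda>" if "j \<in> J" for j
    using that R by (auto simp: \<Lambda>_def \<xi>_def J_def intro!: divide_right_mono)
  have near: "(\<xi> i - \<xi> j)\<^sup>2 \<le> \<Lambda>\<^sup>2 / 2" if "i \<in> J" "j \<in> J" for i j
  proof -
    have "\<bar>\<xi> i - \<xi> j\<bar> \<le> \<Lambda> / 2" using \<xi>_ge[OF that(1)] \<xi>_ge[OF that(2)] \<xi>_le[OF that(1)] \<xi>_le[OF that(2)]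
      by linarith
    then have "(\<xi> i - \<xi> j)\<^sup>2 \<le> (\<Lambda> / 2)\<^sup>2" by (metis abs_ge_zero power2_abs power_mono)
    also have "\<dots> \<le> \<Lambda>\<^sup>2 / 2" by (simp add: power_divide)
    finally show ?thesis .
  qed
  have S: "(\<Sum>j\<in>J. 1 / (1 + (\<xi> i - \<xi> j)\<^sup>2)) \<le> 2 * R" for i
    using sum_inverse_one_plus_square_diff_le[OF R(2) J(1), of i] R(1) unfolding \<xi>_def by linarith
  \<comment> \<open>There are \<open>N\<close> terms, each of mean at least
    \<open>1 / (2 * (\<xi> j)\<^sup>2)\<close>, where \<open>\<xi> j\<close> is at most
    \<open>3 / 2 * \<Lambda>\<close>.\<close>
  define m where "m = 2 * real N / (9 * \<Lambda>\<^sup>2)"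
  have m_pos: "m > 0" using N_pos \<Lambda>_pos by (simp add: m_def)
  define Z where "Z \<omega> = (\<Sum>j\<in>J. (norm (fcoef (\<xi> j) \<omega>))\<^sup>2)" for \<omega>
  have [measurable]: "Z \<in> borel_measurable M" unfolding Z_def[abs_def] by measurable
  have Z_mean: "m \<le> expectation Z"
  proof -
    have "m = (\<Sum>j\<in>J. 2 / (9 * \<Lambda>\<^sup>2))" by (simp add: m_def J)
    also have "\<dots> \<le> (\<Sum>j\<in>J. expectation (\<lambda>\<omega>. (norm (fcoef (\<xi> j) \<omega>))\<^sup>2))"
    proof (rule sum_mono)
      fix j assume j: "j \<in> J"
      have sq: "\<Lambda>\<^sup>2 \<le> (\<xi> j)\<^sup>2" "(\<xi> j)\<^sup>2 \<le> (3 / 2 * \<Lambda>)\<^sup>2"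
        using \<xi>_ge[OF j] \<xi>_le[OF j] \<Lambda>_pos by (auto intro!: power_mono)
      have "2\<^sup>2 \<le> \<Lambda>\<^sup>2" using \<Lambda>_ge by (intro power_mono) auto
      then have "(\<xi> j)\<^sup>2 \<ge> 2" "\<xi> j \<noteq> 0" using sq by auto
      moreover have "2 / (9 * \<Lambda>\<^sup>2) \<le> 1 / (2 * (\<xi> j)\<^sup>2)"
        using sq \<Lambda>_pos \<open>\<xi> j \<noteq> 0\<close> by (simp add: divide_simps power_mult_distrib power_divide)
      ultimately show "2 / (9 * \<Lambda>\<^sup>2) \<le> expectation (\<lambda>\<omega>. (norm (fcoef (\<xi> j) \<omega>))\<^sup>2)"
        using expectation_norm_fcoef_square_ge[of "\<xi> j"] by linarith
    qed
    also have "\<dots> = expectation Z" unfolding Z_def by simp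
    finally show ?thesis .
  qed
  have Z_int: "integrable M (\<lambda>\<omega>. (Z \<omega>)\<^sup>2)"
    unfolding Z_def power2_eq_square[of "sum _ _"] sum_product by simp
  \<comment> \<open>Outside \<open>A\<close> the sum \<open>Z\<close> exceeds \<open>m / 2\<close>,
    and outside the event \<open>E\<close> below \<open>Y\<close> is less than \<open>m / 4\<close>;
    the difference keeps \<open>m / 4\<close>.\<close>
  define A where "A = {\<omega> \<in> space M. m / 2 \<le> \<bar>Z \<omega> - expectation Z\<bar>}"
  have A: "A \<in> sets M" unfolding A_def by measurable
  have prob_A: "prob A \<le> 103680 * (R / real N)"
  proof -
    have "prob A \<le> variance Z / (m / 2)\<^sup>2"
      unfolding A_def using m_pos by (intro Chebyshev_inequality Z_int) auto
    also have "\<dots> \<le> (640 / \<Lambda>^4 * (real N * (2 * R))) / (m / 2)\<^sup>2"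
      using variance_sum_norm_fcoef_square_le[OF J(1) \<xi>_ge \<Lambda>_pos near S]
      unfolding J(2) Z_def[symmetric] by (intro divide_right_mono) auto
    also have "\<dots> = 103680 * (R / real N)"
      using \<Lambda>_pos N_pos by (simp add: m_def field_simps power2_eq_square power4_eq_xxxx)
    finally show ?thesis .
  qed
  obtain b where b: "finite b" "span b = V" "card b \<le> k"
    using V by (auto simp: subspaces_dim_le_def)
  define T where "T = J \<times> (UNIV :: bool set)"
  have T: "finite T" "orthonormal_on T (trig_basis R)"
    using N_pos by (auto simp: T_def J intro!: orthonormal_trig_basis R(2)) (auto simp: J_def)
  obtain W where W: "finite W" "card W \<le> k" "\<And>w. w \<in> W \<Longrightarrow> (\<Sum>i\<in>T. (w i)\<^sup>2) = 1"
    "\<And>x. (\<Sum>i\<in>T. (inner x (trig_basis R i))\<^sup>2) - (\<Sum>w\<in>W. (\<Sum>i\<in>T. w i * inner x (trig_basis R i))\<^sup>2)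
            \<le> (infdist x V)\<^sup>2"
    using infdist_span_ge[OF T b(1,3)] b(2) by auto
  \<comment> \<open>The minus sign makes the real part of \<open>z w j * c\<close> equal to
    \<open>w (j, False) * Re c + w (j, True) * Im c\<close>, the pairing of real
    coordinates.\<close>
  define z where "z w j = Complex (w (j, False)) (- w (j, True))" for w :: "nat \<times> bool \<Rightarrow> real" and j
  have sum_T: "(\<Sum>i\<in>T. h i) = (\<Sum>j\<in>J. h (j, False) + h (j, True))" for h :: "nat \<times> bool \<Rightarrow> real"
  proof -
    have "(\<Sum>i\<in>T. h i) = (\<Sum>j\<in>J. \<Sum>\<sigma>\<in>UNIV. h (j, \<sigma>))"
      by (simp add: T_def sum.cartesian_product)
    then show ?thesis by (simp add: UNIV_bool)
  qed
  define Y where "Y \<omega> = (\<Sum>w\<in>W. (norm (\<Sum>j\<in>J. z w j * fcoef (\<xi> j) \<omega>))\<^sup>2)" for \<omega>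
  have Y_int: "integrable M (\<lambda>\<omega>. (norm (\<Sum>j\<in>J. z w j * fcoef (\<xi> j) \<omega>))\<^sup>2)" for w
  proof (rule integrable_const_bound)
    have "norm (\<Sum>j\<in>J. z w j * fcoef (\<xi> j) \<omega>) \<le> (\<Sum>j\<in>J. norm (z w j))" for \<omega>
      by (intro order_trans[OF norm_sum] sum_mono)
        (simp add: norm_mult mult_left_le norm_fcoef_le)
    then show "AE \<omega> in M. norm ((norm (\<Sum>j\<in>J. z w j * fcoef (\<xi> j) \<omega>))\<^sup>2) \<le> (\<Sum>j\<in>J. norm (z w j))\<^sup>2"
      by (auto intro!: AE_I2 power_mono)
  qed measurable
  have Y_mean: "expectation Y \<le> real k * (80 * R / \<Lambda>\<^sup>2)"
  proof -
    have "expectation Y = (\<Sum>w\<in>W. expectation (\<lambda>\<omega>. (norm (\<Sum>j\<in>J. z w j * fcoef (\<xi> j) \<omega>))\<^sup>2))"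
      unfolding Y_def using Y_int by simp
    also have "\<dots> \<le> (\<Sum>w\<in>W. 80 * R / \<Lambda>\<^sup>2)"
    proof (rule sum_mono)
      fix w assume "w \<in> W"
      then have "(\<Sum>j\<in>J. (norm (z w j))\<^sup>2) = 1"
        using W(3)[of w] unfolding sum_T by (simp add: z_def cmod_power2)
      then show "expectation (\<lambda>\<omega>. (norm (\<Sum>j\<in>J. z w j * fcoef (\<xi> j) \<omega>))\<^sup>2) \<le> 80 * R / \<Lambda>\<^sup>2"
        using expectation_norm_sum_fcoef_square_le[OF J(1) \<xi>_ge \<Lambda>_pos near S, of "z w"] by simp
    qed
    also have "\<dots> = real (card W) * (80 * R / \<Lambda>\<^sup>2)" by simp
    also have "\<dots> \<le> real k * (80 * R / \<Lambda>\<^sup>2)" using W(2) R by (intro mult_right_mono) auto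
    finally show ?thesis .
  qed
  have [measurable]: "Y \<in> borel_measurable M" unfolding Y_def[abs_def] by measurable
  define E where "E = {\<omega> \<in> space M. m / 4 \<le> Y \<omega>}"
  have E: "E \<in> sets M" unfolding E_def by measurable
  have prob_E: "prob E \<le> 1440 * real k * (R / real N)"
  proof -
    have "prob E \<le> expectation Y / (m / 4)"
      unfolding E_def using m_pos Y_int
      by (intro integral_Markov_inequality_measure[where A = "{}"]) (auto simp: Y_def sum_nonneg)
    also have "\<dots> \<le> (real k * (80 * R / \<Lambda>\<^sup>2)) / (m / 4)"
      using Y_mean m_pos by (intro divide_right_mono) auto
    also have "\<dots> = 1440 * real k * (R / real N)"
      using \<Lambda>_pos N_pos by (simp add: m_def field_simps power2_eq_square)
    finally show ?thesis .
  qed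
  define G where "G = (space M - confined R) \<union> A \<union> E"
  have G: "G \<in> sets M" unfolding G_def using A E by measurable
  have "prob G \<le> prob (space M - confined R) + prob A + prob E"
    unfolding G_def using A E by (intro order_trans[OF measure_Un_le] add_mono measure_Un_le order_refl) auto
  also have "\<dots> \<le> \<delta>\<^sup>2 + 103680 * (1600 * \<delta>\<^sup>2) + 1440 * real k * (1600 * \<delta>\<^sup>2)"
    using N_ge by (intro add_mono R(3) order_trans[OF prob_A] order_trans[OF prob_E] mult_left_mono) auto
  \<comment> \<open>Numerically 1 + 103680 * 1600 + 1440 * 1600 is below 2 * 10^8, and
    \<open>\<delta>\<^sup>2\<close> is at most \<open>\<delta>\<^sup>2 * real k\<close>.\<close>
  also have "\<dots> \<le> 2 * 10^8 * real k * \<delta>\<^sup>2"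
  proof -
    have "\<delta>\<^sup>2 * 1 \<le> \<delta>\<^sup>2 * real k" using k by (intro mult_left_mono) auto
    moreover have "d + 103680 * (1600 * d) + 1440 * l * (1600 * d) \<le> 2 * 10^8 * l * d"
      if "d * 1 \<le> d * l" "0 \<le> d" for d l :: real
      using that by (simp add: mult_ac)
    ultimately show ?thesis using zero_le_power2 by blast
  qed
  finally have prob_G: "prob G \<le> 2 * 10^8 * real k * \<delta>\<^sup>2" .
  have "AE \<omega> in M. \<omega> \<notin> G \<longrightarrow> \<delta> \<le> infdist (L_vec \<omega>) V"
    using L_trig_basis_AE AE_space
  proof eventually_elim
    case (elim \<omega>)
    show ?case
    proof
      assume "\<omega> \<notin> G"
      then have \<omega>: "\<omega> \<in> confined R" "\<bar>Z \<omega> - expectation Z\<bar> < m / 2" "Y \<omega> < m / 4"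
        using elim(2) by (auto simp: G_def A_def E_def)
      have inner: "inner (L_vec \<omega>) (trig_basis R (j, False)) = Re (fcoef (\<xi> j) \<omega>) / sqrt R"
        "inner (L_vec \<omega>) (trig_basis R (j, True)) = Im (fcoef (\<xi> j) \<omega>) / sqrt R" for j
        using elim(1) R(2) \<omega>(1) by (auto simp: \<xi>_def)
      have 1: "(\<Sum>i\<in>T. (inner (L_vec \<omega>) (trig_basis R i))\<^sup>2) = Z \<omega> / R"
        unfolding sum_T inner Z_def sum_divide_distrib cmod_power2
        using R(2) by (simp add: power_divide add_divide_distrib)
      have 2: "(\<Sum>w\<in>W. (\<Sum>i\<in>T. w i * inner (L_vec \<omega>) (trig_basis R i))\<^sup>2) \<le> Y \<omega> / R"
        unfolding Y_def sum_divide_distrib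
      proof (rule sum_mono)
        fix w
        have "(\<Sum>i\<in>T. w i * inner (L_vec \<omega>) (trig_basis R i)) = Re (\<Sum>j\<in>J. z w j * fcoef (\<xi> j) \<omega>) / sqrt R"
          unfolding sum_T inner Re_sum sum_divide_distrib
          by (simp add: z_def add_divide_distrib)
        then have "(\<Sum>i\<in>T. w i * inner (L_vec \<omega>) (trig_basis R i))\<^sup>2 = (Re (\<Sum>j\<in>J. z w j * fcoef (\<xi> j) \<omega>))\<^sup>2 / R"
          using R(2) by (simp add: power_divide)
        also have "\<dots> \<le> (norm (\<Sum>j\<in>J. z w j * fcoef (\<xi> j) \<omega>))\<^sup>2 / R"
          using R(2) by (intro divide_right_mono) (simp_all add: cmod_power2)
        finally show "(\<Sum>i\<in>T. w i * inner (L_vec \<omega>) (trig_basis R i))\<^sup>2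
          \<le> (norm (\<Sum>j\<in>J. z w j * fcoef (\<xi> j) \<omega>))\<^sup>2 / R" .
      qed
      have "m / 4 \<le> Z \<omega> - Y \<omega>" using \<omega>(2,3) Z_mean by linarith
      then have "m / 4 / R \<le> (Z \<omega> - Y \<omega>) / R" using R(2) by (intro divide_right_mono) auto
      also have "\<dots> \<le> (infdist (L_vec \<omega>) V)\<^sup>2"
        using W(4)[of "L_vec \<omega>"] 1 2 by (simp add: diff_divide_distrib)
      finally have 3: "m / 4 / R \<le> (infdist (L_vec \<omega>) V)\<^sup>2" .
      have "\<delta>\<^sup>2 \<le> m / 4 / R"
      proof -
        have "m / 4 / R = R / (72 * pi\<^sup>2 * real N)"
          using R N_pos by (simp add: m_def \<Lambda>_def field_simps power2_eq_square)
        moreover have "\<delta>\<^sup>2 \<le> R / (72 * pi\<^sup>2 * real N)"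
        proof -
          have "pi\<^sup>2 \<le> 3.2\<^sup>2" using pi_approx by (intro power_mono) auto
          then have "72 * pi\<^sup>2 * real N \<le> 800 * real N" by (intro mult_right_mono) (auto simp: power2_eq_square)
          then have "\<delta>\<^sup>2 * (72 * pi\<^sup>2 * real N) \<le> \<delta>\<^sup>2 * (800 * real N)" by (intro mult_left_mono) auto
          also have "\<dots> \<le> R" using N_le \<delta> by (simp add: field_simps)
          finally show ?thesis using N_pos by (simp add: field_simps)
        qed
        ultimately show ?thesis by simp
      qed
      then have "\<delta>\<^sup>2 \<le> (infdist (L_vec \<omega>) V)\<^sup>2" using 3 by linarith
      then show "\<delta> \<le> infdist (L_vec \<omega>) V" by (rule power2_le_imp_le) (rule infdist_nonneg)
    qed
  qed
  then show ?thesis using G prob_G by blast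
qed

end

section \<open>The expected inverse distance\<close>

context brownian_local_time
begin

text \<open>A dyadic decomposition: outside \<open>G j\<close> the inverse distance is at most
  \<open>2 ^ j * sqrt (real k)\<close>, while \<open>G j\<close> has probability of order 4^(-j), so
  the contributions form a convergent geometric series. The first level
  \<open>1 / sqrt (real k)\<close> already has the expected order.\<close>

lemma nn_integral_inverse_distance_le:
  assumes V: "V \<in> subspaces_dim_le k" and k: "k \<ge> 1"
  shows "(\<integral>\<^sup>+\<omega>. inverse (ennreal (infdist (L_vec \<omega>) V)) \<partial>M) \<le> ennreal ((1 + 8 * 10^8) * sqrt (real k))"
proof -
  define \<delta> where "\<delta> j = 1 / (2 ^ j * sqrt (real k))" for j :: nat
  have \<delta>_pos: "\<delta> j > 0" for j using k by (simp add: \<delta>_def)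
  have k_\<delta>: "2 * 10^8 * real k * (\<delta> j)\<^sup>2 = 2 * 10^8 * (1 / 4) ^ j" for j
  proof -
    have "(2 ^ j)\<^sup>2 = ((2 :: real)\<^sup>2) ^ j" by (simp only: power_mult[symmetric] mult.commute)
    then have "(2 ^ j)\<^sup>2 = (4 ^ j :: real)" by simp
    then show ?thesis using k by (simp add: \<delta>_def power_divide power_mult_distrib)
  qed
  obtain G where G: "\<And>j. G j \<in> sets M" "\<And>j. prob (G j) \<le> 2 * 10^8 * (1 / 4) ^ j"
    "\<And>j. AE \<omega> in M. \<omega> \<notin> G j \<longrightarrow> \<delta> j \<le> infdist (L_vec \<omega>) V"
  proof -
    have "\<forall>j. \<exists>G. G \<in> sets M \<and> prob G \<le> 2 * 10^8 * (1 / 4) ^ j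
        \<and> (AE \<omega> in M. \<omega> \<notin> G \<longrightarrow> \<delta> j \<le> infdist (L_vec \<omega>) V)"
      using small_distance_event[OF V k \<delta>_pos] unfolding k_\<delta> by blast
    from choice[OF this] show ?thesis using that by blast
  qed
  note [measurable] = G(1)
  \<comment> \<open>The term of index \<open>j\<close> pays for outcomes that lie in
    \<open>G j\<close> but not in \<open>G (Suc j)\<close>, hence the exponent
    \<open>Suc j\<close>.\<close>
  define U where "U \<omega> = ennreal (sqrt (real k)) + (\<Sum>j. ennreal (2 ^ Suc j * sqrt (real k)) * indicator (G j) \<omega>)" for \<omega>
  have "AE \<omega> in M. \<forall>j. \<omega> \<notin> G j \<longrightarrow> \<delta> j \<le> infdist (L_vec \<omega>) V"
    using G(3) by (simp add: AE_all_countable)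
  then have "AE \<omega> in M. inverse (ennreal (infdist (L_vec \<omega>) V)) \<le> U \<omega>"
  proof eventually_elim
    case (elim \<omega>)
    let ?f = "\<lambda>j. ennreal (2 ^ Suc j * sqrt (real k)) * indicator (G j) \<omega>"
    have term_le: "?f j \<le> (\<Sum>j. ?f j)" for j
    proof -
      have "sum ?f {j} \<le> (\<Sum>j. ?f j)" by (rule sum_le_suminf) auto
      moreover have "sum ?f {j} = ?f j" by (subst sum.insert) simp_all
      ultimately show ?thesis by (simp only:)
    qed
    have inv_le: "inverse (ennreal (infdist (L_vec \<omega>) V)) \<le> ennreal (2 ^ j * sqrt (real k))" if "\<omega> \<notin> G j" for j
    proof -
      have "\<delta> j \<le> infdist (L_vec \<omega>) V" using elim that by blast
      then have "inverse (infdist (L_vec \<omega>) V) \<le> inverse (\<delta> j)" "infdist (L_vec \<omega>) V > 0"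
        using \<delta>_pos[of j] by (auto intro: le_imp_inverse_le)
      then show ?thesis using k by (simp add: \<delta>_def inverse_ennreal ennreal_leI)
    qed
    show ?case
    proof (cases "\<exists>j. \<omega> \<notin> G j")
      case True
      define j where "j = (LEAST j. \<omega> \<notin> G j)"
      have j: "\<omega> \<notin> G j" "\<And>i. i < j \<Longrightarrow> \<omega> \<in> G i"
        using LeastI_ex[OF True] not_less_Least unfolding j_def by blast+
      show ?thesis
      proof (cases j)
        case 0
        then have "inverse (ennreal (infdist (L_vec \<omega>) V)) \<le> ennreal (sqrt (real k))"
          using inv_le[OF j(1)] by simp
        also have "\<dots> \<le> U \<omega>" unfolding U_def by simp
        finally show ?thesis .
      next
        case (Suc i)
        then have "inverse (ennreal (infdist (L_vec \<omega>) V)) \<le> ?f i"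
          using inv_le[OF j(1)] j(2)[of i] by simp
        also have "\<dots> \<le> (\<Sum>j. ?f j)" by (rule term_le)
        also have "\<dots> \<le> U \<omega>" unfolding U_def by simp
        finally show ?thesis .
      qed
    next
      case False
      \<comment> \<open>An outcome in every \<open>G j\<close>, possibly at distance 0, is covered
        because the majorant is infinite there.\<close>
      have "(\<Sum>j. ?f j) = top"
      proof (rule ccontr)
        assume "(\<Sum>j. ?f j) \<noteq> top"
        then obtain r where r: "(\<Sum>j. ?f j) = ennreal r" "r \<ge> 0" by (cases "\<Sum>j. ?f j") auto
        have "2 ^ Suc j * sqrt (real k) \<le> r" for j
          using term_le[of j] False r by (simp add: ennreal_le_iff del: power_Suc)
        moreover obtain j where "r < 2 ^ j" using real_arch_pow[of 2 r] by auto
        moreover have "2 ^ j \<le> 2 ^ Suc j * sqrt (real k)" for j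
          using mult_mono[of "2 ^ j" "2 ^ Suc j" 1 "sqrt (real k)"] k by simp
        ultimately show False by (metis less_le_trans not_le order_trans)
      qed
      then show ?thesis by (simp add: U_def)
    qed
  qed
  then have "(\<integral>\<^sup>+\<omega>. inverse (ennreal (infdist (L_vec \<omega>) V)) \<partial>M) \<le> (\<integral>\<^sup>+\<omega>. U \<omega> \<partial>M)"
    by (rule nn_integral_mono_AE)
  also have "\<dots> = ennreal (sqrt (real k)) + (\<Sum>j. ennreal (2 ^ Suc j * sqrt (real k)) * emeasure M (G j))"
    unfolding U_def by (simp add: nn_integral_add nn_integral_suminf nn_integral_cmult_indicator emeasure_space_1)
  also have "\<dots> \<le> ennreal (sqrt (real k)) + (\<Sum>j. ennreal (4 * 10^8 * sqrt (real k) * (1 / 2) ^ j))"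
  proof (intro add_left_mono suminf_le)
    fix j
    have "ennreal (2 ^ Suc j * sqrt (real k)) * emeasure M (G j) = ennreal (2 ^ Suc j * sqrt (real k) * prob (G j))"
      by (simp add: emeasure_eq_measure ennreal_mult)
    also have "\<dots> \<le> ennreal (2 ^ Suc j * sqrt (real k) * (2 * 10^8 * (1 / 4) ^ j))"
      using G(2)[of j] by (intro ennreal_leI mult_left_mono) auto
    also have "2 ^ Suc j * sqrt (real k) * (2 * 10^8 * (1 / 4) ^ j) = 4 * 10^8 * sqrt (real k) * (2 ^ j * (1 / 4) ^ j)"
      by simp
    also have "2 ^ j * (1 / 4) ^ j = (1 / 2 :: real) ^ j" by (simp flip: power_mult_distrib)
    finally show "ennreal (2 ^ Suc j * sqrt (real k)) * emeasure M (G j) \<le> ennreal (4 * 10^8 * sqrt (real k) * (1 / 2) ^ j)" .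
  qed auto
  also have "(\<Sum>j. ennreal (4 * 10^8 * sqrt (real k) * (1 / 2) ^ j)) = ennreal (4 * 10^8 * sqrt (real k) * 2)"
  proof (rule suminf_ennreal_eq)
    have "(\<lambda>j. (1 / 2 :: real) ^ j) sums 2" using geometric_sums[of "1 / 2 :: real"] by simp
    then show "(\<lambda>j. 4 * 10^8 * sqrt (real k) * (1 / 2) ^ j) sums (4 * 10^8 * sqrt (real k) * 2)"
      by (rule sums_mult)
  qed simp
  also have "ennreal (sqrt (real k)) + ennreal (4 * 10^8 * sqrt (real k) * 2) = ennreal ((1 + 8 * 10^8) * sqrt (real k))"
    by (simp flip: ennreal_plus)
  finally show ?thesis .
qed

text \<open>The space \<open>V\<close> is spanned by the first \<open>k\<close> half-range cosines.
  On confined paths the mean squared tail is O(R / k), so by Markov the distance is at most 4 * sqrt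
  (R / k) with probability at least 1/2. The radius is fixed before \<open>k\<close>, so
  \<open>c\<close> does not depend on \<open>k\<close>.\<close>

lemma nn_integral_inverse_distance_ge:
  obtains c where "c > 0"
    "\<And>k. k \<ge> 1 \<Longrightarrow> \<exists>V\<in>subspaces_dim_le k.
       ennreal (c * sqrt (real k)) \<le> (\<integral>\<^sup>+\<omega>. inverse (ennreal (infdist (L_vec \<omega>) V)) \<partial>M)"
proof -
  obtain n where n: "real n \<ge> 1" "prob (space M - confined (real n)) \<le> 1 / 4"
    using confined_exhausts[of "1/4" 1] by auto
  define R where "R = real n"
  have R: "R > 0" "prob (space M - confined R) \<le> 1 / 4" using n by (auto simp: R_def)
  define e where "e = half_range_basis R"
  have main: "\<exists>V\<in>subspaces_dim_le k.
       ennreal (1 / (8 * sqrt R) * sqrt (real k)) \<le> (\<integral>\<^sup>+\<omega>. inverse (ennreal (infdist (L_vec \<omega>) V)) \<partial>M)"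
    if k: "k \<ge> 1" for k
  proof
    let ?V = "span (e ` {..<k})"
    show "?V \<in> subspaces_dim_le k"
    proof -
      \<comment> \<open>\<open>subspaces_dim_le\<close> asks for an explicit basis, so one is
        extracted from the spanning family.\<close>
      obtain b where b: "b \<subseteq> e ` {..<k}" "independent b" "e ` {..<k} \<subseteq> span b"
        using maximal_independent_subset by blast
      have "span b = ?V" using b(1,3) by (metis span_mono span_span subset_antisym)
      moreover have "card b \<le> k" using card_mono[OF _ b(1)] card_image_le[of "{..<k}" e] by simp
      moreover have "finite b" using b(1) finite_subset by auto
      ultimately show ?thesis using b(2) by (auto simp: subspaces_dim_le_def)
    qed
    \<comment> \<open>The tail starts at index \<open>k \<ge> 1\<close>, so no frequency
      vanishes.\<close>
    define \<xi> where "\<xi> j = pi * real (j + k) / (2 * R)" for j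
    define D where "D \<omega> = (\<Sum>j. ennreal ((norm (fcoef (\<xi> j) \<omega>))\<^sup>2 / R))" for \<omega>
    have [measurable]: "D \<in> borel_measurable M" unfolding D_def[abs_def] by measurable
    have D: "AE \<omega> in M. \<omega> \<in> confined R \<longrightarrow> ennreal ((infdist (L_vec \<omega>) ?V)\<^sup>2) \<le> D \<omega>"
      using L_inner_AE
    proof eventually_elim
      case (elim \<omega>)
      show ?case
      proof
        assume \<omega>: "\<omega> \<in> confined R"
        note L = mp[OF mp[OF spec[OF elim] R(1)] \<omega>]
        have "ennreal ((infdist (L_vec \<omega>) ?V)\<^sup>2) \<le> (\<Sum>j. ennreal ((inner (L_vec \<omega>) (e (j + k)))\<^sup>2))"
          unfolding e_def using L
          by (intro infdist_span_le orthonormal_half_range_basis half_range_basis_dense R) auto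
        also have "\<dots> \<le> D \<omega>"
          unfolding D_def
        proof (intro suminf_le ennreal_leI)
          fix j
          let ?I = "\<integral>t. cos (\<xi> j * X t \<omega> + pi * real (j + k) / 2) \<partial>unit_time"
          have "inner (L_vec \<omega>) (e (j + k)) = ?I / sqrt R"
          proof -
            have nonzero: "(j + k = 0) = False" using k by simp
            have cos_fun: "inner (L_vec \<omega>) (abs_L2 (cos_fun R a b)) = (\<integral>t. cos (a * X t \<omega> + b) \<partial>unit_time)" for a b
              using L by blast
            show ?thesis
              unfolding e_def half_range_basis_def \<xi>_def nonzero if_False inner_scaleR_right cos_fun
              by (simp only: divide_inverse mult.commute)
          qed
          then have "(inner (L_vec \<omega>) (e (j + k)))\<^sup>2 = ?I\<^sup>2 / R"
            using R(1) by (simp add: power_divide)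
          also have "\<dots> \<le> (norm (fcoef (\<xi> j) \<omega>))\<^sup>2 / R"
          proof -
            have "\<bar>?I\<bar>\<^sup>2 \<le> (norm (fcoef (\<xi> j) \<omega>))\<^sup>2"
              using \<omega> by (intro power_mono abs_integral_cos_le_fcoef) (auto simp: confined_def)
            then show ?thesis using R(1) by (simp add: divide_right_mono)
          qed
          finally show "(inner (L_vec \<omega>) (e (j + k)))\<^sup>2 \<le> (norm (fcoef (\<xi> j) \<omega>))\<^sup>2 / R" .
        qed auto
        finally show "ennreal ((infdist (L_vec \<omega>) ?V)\<^sup>2) \<le> D \<omega>" .
      qed
    qed
    have D_int: "(\<integral>\<^sup>+\<omega>. D \<omega> \<partial>M) \<le> ennreal (4 * R / real k)"
    proof -
      have "(\<integral>\<^sup>+\<omega>. D \<omega> \<partial>M) = (\<Sum>j. \<integral>\<^sup>+\<omega>. ennreal ((norm (fcoef (\<xi> j) \<omega>))\<^sup>2 / R) \<partial>M)"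
        unfolding D_def by (rule nn_integral_suminf) measurable
      also have "\<dots> \<le> (\<Sum>j. ennreal (4 * R * (1 / real (j + k) - 1 / real (Suc j + k))))"
      proof (intro suminf_le)
        fix j
        have \<xi>: "\<xi> j \<noteq> 0" using R k by (simp add: \<xi>_def)
        have "(\<integral>\<^sup>+\<omega>. ennreal ((norm (fcoef (\<xi> j) \<omega>))\<^sup>2 / R) \<partial>M)
            = ennreal (expectation (\<lambda>\<omega>. (norm (fcoef (\<xi> j) \<omega>))\<^sup>2) / R)"
          using R by (subst nn_integral_eq_integral) auto
        also have "\<dots> \<le> ennreal (4 / (\<xi> j)\<^sup>2 / R)"
          using R expectation_norm_fcoef_square_le[OF \<xi>] by (intro ennreal_leI divide_right_mono) auto
        also have "4 / (\<xi> j)\<^sup>2 / R \<le> 4 * R * (1 / real (j + k) - 1 / real (Suc j + k))"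
        proof -
          have pi2: "8 \<le> pi\<^sup>2" using pi_gt3 power_mono[of 3 pi 2] by simp
          \<comment> \<open>The series is made telescoping by 1 / x^2 <= 2 * (1 / x - 1 / (x + 1)),
            valid for x >= 1; the other factor uses 16 / pi^2 <= 2.\<close>
          define x where "x = real (j + k)"
          have x: "x \<ge> 1" using k by (simp add: x_def)
          have "4 / (\<xi> j)\<^sup>2 / R = 16 * R / pi\<^sup>2 * (1 / x\<^sup>2)"
            using R by (simp add: \<xi>_def x_def power_divide power_mult_distrib power2_eq_square)
          also have "\<dots> \<le> 2 * R * (1 / x\<^sup>2)"
            using R pi2 by (intro mult_right_mono) (auto simp: divide_simps)
          also have "\<dots> \<le> 2 * R * (2 * (1 / x - 1 / (x + 1)))"
            using R x by (intro mult_left_mono) (auto simp: divide_simps power2_eq_square)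
          finally have "4 / (\<xi> j)\<^sup>2 / R \<le> 2 * R * (2 * (1 / x - 1 / (x + 1)))" .
          moreover have "2 * R * (2 * y) = 4 * R * y" for y :: real by simp
          moreover have "real (Suc j + k) = x + 1" by (simp add: x_def)
          ultimately show ?thesis unfolding x_def[symmetric] by (simp only:)
        qed
        finally show "(\<integral>\<^sup>+\<omega>. ennreal ((norm (fcoef (\<xi> j) \<omega>))\<^sup>2 / R) \<partial>M)
            \<le> ennreal (4 * R * (1 / real (j + k) - 1 / real (Suc j + k)))"
          by (simp add: ennreal_leI)
      qed auto
      also have "\<dots> = ennreal (4 * R * (1 / real k))"
      proof (rule suminf_ennreal_eq)
        have "(\<lambda>j. 1 / real (j + k)) \<longlonglongrightarrow> 0"
          by (rule LIMSEQ_ignore_initial_segment[OF lim_1_over_n])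
        from telescope_sums'[OF this]
        show "(\<lambda>j. 4 * R * (1 / real (j + k) - 1 / real (Suc j + k))) sums (4 * R * (1 / real k))"
          by (intro sums_mult) simp
        show "0 \<le> 4 * R * (1 / real (j + k) - 1 / real (Suc j + k))" for j
          using R k by (intro mult_nonneg_nonneg) (auto simp: divide_simps)
      qed
      finally show ?thesis by simp
    qed
    \<comment> \<open>Scaled so that Markov bounds the probability of a large tail by 1/4. As escape
      from [-R, R] costs at most another 1/4, \<open>F\<close> keeps probability at least
      1/2.\<close>
    define c where "c = ennreal (real k / (16 * R))"
    define F where "F = confined R - {\<omega> \<in> space M. 1 \<le> c * D \<omega>}"
    have F: "F \<in> sets M" unfolding F_def by measurable
    have "emeasure M {\<omega> \<in> space M. 1 \<le> c * D \<omega>} \<le> c * (\<integral>\<^sup>+\<omega>. D \<omega> * indicator (space M) \<omega> \<partial>M)"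
      by (rule nn_integral_Markov_inequality) measurable
    also have "(\<integral>\<^sup>+\<omega>. D \<omega> * indicator (space M) \<omega> \<partial>M) = (\<integral>\<^sup>+\<omega>. D \<omega> \<partial>M)"
      by (rule nn_integral_cong) simp
    also have "c * \<dots> \<le> c * ennreal (4 * R / real k)" by (intro mult_left_mono D_int) auto
    also have "\<dots> = ennreal (1 / 4)" unfolding c_def using R k by (simp flip: ennreal_mult)
    finally have markov: "prob {\<omega> \<in> space M. 1 \<le> c * D \<omega>} \<le> 1 / 4"
      by (simp add: emeasure_eq_measure)
    have prob_F: "1 / 2 \<le> prob F"
    proof -
      have "prob (confined R) = 1 - prob (space M - confined R)" by (simp add: prob_compl)
      moreover have "prob (confined R) \<le> prob (F \<union> {\<omega> \<in> space M. 1 \<le> c * D \<omega>})"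
        using F by (intro finite_measure_mono) (auto simp: F_def)
      moreover have "\<dots> \<le> prob F + prob {\<omega> \<in> space M. 1 \<le> c * D \<omega>}"
        using F by (intro measure_Un_le) auto
      ultimately show ?thesis using R(2) markov by linarith
    qed
    have low: "AE \<omega> in M. ennreal (sqrt (real k) / (4 * sqrt R)) * indicator F \<omega>
        \<le> inverse (ennreal (infdist (L_vec \<omega>) ?V))"
      using D
    proof eventually_elim
      case (elim \<omega>)
      show ?case
      proof (cases "\<omega> \<in> F")
        case True
        then have \<omega>: "\<omega> \<in> confined R" "c * D \<omega> < 1" by (auto simp: F_def confined_def not_le)
        define d where "d = infdist (L_vec \<omega>) ?V"
        have d0: "d \<ge> 0" by (simp add: d_def infdist_nonneg)
        have "c * ennreal (d\<^sup>2) \<le> c * D \<omega>" using elim \<omega>(1) by (intro mult_left_mono) (auto simp: d_def)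
        also have "\<dots> < 1" by (rule \<omega>(2))
        finally have "c * ennreal (d\<^sup>2) < 1" .
        moreover have "ennreal (real k / (16 * R) * d\<^sup>2) = c * ennreal (d\<^sup>2)"
          unfolding c_def using R by (intro ennreal_mult) auto
        ultimately have less: "ennreal (real k / (16 * R) * d\<^sup>2) < ennreal 1"
          by (simp only: ennreal_1)
        have "0 \<le> real k / (16 * R) * d\<^sup>2" using R by simp
        from iffD1[OF ennreal_less_iff[OF this] less] have "real k / (16 * R) * d\<^sup>2 < 1" .
        then have "d\<^sup>2 \<le> 16 * R / real k" using R k by (simp add: field_simps)
        then have "d \<le> sqrt (16 * R / real k)" using d0 real_le_rsqrt by blast
        also have "\<dots> = 4 * sqrt R / sqrt (real k)" by (simp add: real_sqrt_divide real_sqrt_mult)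
        finally have d: "d \<le> 4 * sqrt R / sqrt (real k)" .
        show ?thesis
        \<comment> \<open>At distance 0 the \<open>ennreal\<close> inverse is infinite and the bound
          is trivial.\<close>
        proof (cases "d = 0")
          case False
          then have "inverse (4 * sqrt R / sqrt (real k)) \<le> inverse d"
            using d d0 by (intro le_imp_inverse_le) auto
          then show ?thesis
            using True False d0 by (simp add: inverse_ennreal ennreal_leI flip: d_def)
        qed (simp flip: d_def)
      qed simp
    qed
    have "ennreal (1 / (8 * sqrt R) * sqrt (real k)) \<le> ennreal (sqrt (real k) / (4 * sqrt R) * prob F)"
      using mult_left_mono[OF prob_F, of "sqrt (real k) / (4 * sqrt R)"] R by (intro ennreal_leI) simp
    also have "\<dots> = ennreal (sqrt (real k) / (4 * sqrt R)) * ennreal (prob F)"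
      using R by (intro ennreal_mult) auto
    also have "\<dots> = (\<integral>\<^sup>+\<omega>. ennreal (sqrt (real k) / (4 * sqrt R)) * indicator F \<omega> \<partial>M)"
      using F by (simp add: nn_integral_cmult_indicator emeasure_eq_measure)
    also have "\<dots> \<le> (\<integral>\<^sup>+\<omega>. inverse (ennreal (infdist (L_vec \<omega>) ?V)) \<partial>M)"
      by (rule nn_integral_mono_AE[OF low])
    finally show "ennreal (1 / (8 * sqrt R) * sqrt (real k)) \<le> (\<integral>\<^sup>+\<omega>. inverse (ennreal (infdist (L_vec \<omega>) ?V)) \<partial>M)" .
  qed
  show ?thesis using that[of "1 / (8 * sqrt R)"] main R by simp
qed

lemma sup_expected_inverse_distance_bounds:
  obtains c C where "c > 0" "C > 0"
    "\<And>k. k \<ge> 1 \<Longrightarrow> ennreal (c * sqrt (real k)) \<le> sup_expected_inverse_distance M L k"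
    "\<And>k. k \<ge> 1 \<Longrightarrow> sup_expected_inverse_distance M L k \<le> ennreal (C * sqrt (real k))"
proof -
  obtain c where c: "c > 0" "\<And>k. k \<ge> 1 \<Longrightarrow> \<exists>V\<in>subspaces_dim_le k.
       ennreal (c * sqrt (real k)) \<le> (\<integral>\<^sup>+\<omega>. inverse (ennreal (infdist (L_vec \<omega>) V)) \<partial>M)"
    using nn_integral_inverse_distance_ge by blast
  show ?thesis
  proof
    show "ennreal (c * sqrt (real k)) \<le> sup_expected_inverse_distance M L k" if "k \<ge> 1" for k
      unfolding sup_expected_inverse_distance_def using c(2)[OF that] by (auto intro: SUP_upper2)
    show "sup_expected_inverse_distance M L k \<le> ennreal ((1 + 8 * 10^8) * sqrt (real k))" if "k \<ge> 1" for k
      unfolding sup_expected_inverse_distance_def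
      by (rule SUP_least) (rule nn_integral_inverse_distance_le[OF _ that])
  qed (use c in auto)
qed

end

section \<open>From square-root bounds to the stated asymptotics\<close>

lemma sqrt_order_exponent:
  fixes S :: "nat \<Rightarrow> ennreal"
  assumes c: "c > 0" "C > 0"
    and lower: "\<And>k. k \<ge> 1 \<Longrightarrow> ennreal (c * sqrt (real k)) \<le> S k"
    and upper: "\<And>k. k \<ge> 1 \<Longrightarrow> S k \<le> ennreal (C * sqrt (real k))"
  shows "\<exists>\<epsilon> :: nat \<Rightarrow> real. \<epsilon> \<in> o(\<lambda>_. 1) \<and>
            (\<forall>\<^sub>F k in sequentially. S k = ennreal (real k powr (1/2 + \<epsilon> k)))"
proof -
  define r where "r k = enn2real (S k)" for k
  have S: "S k = ennreal (r k)" if "k \<ge> 1" for k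
    using le_less_trans[OF upper[OF that] ennreal_less_top] by (simp add: r_def)
  have r: "c * sqrt (real k) \<le> r k" "r k \<le> C * sqrt (real k)" if "k \<ge> 1" for k
  proof -
    have "0 \<le> r k" "0 \<le> C * sqrt (real k)" using c by (simp_all add: r_def)
    then show "c * sqrt (real k) \<le> r k" "r k \<le> C * sqrt (real k)"
      using lower[OF that] upper[OF that] unfolding S[OF that] by (metis ennreal_le_iff)+
  qed
  have r_pos: "r k > 0" if "k \<ge> 1" for k
    by (rule less_le_trans[OF _ r(1)[OF that]]) (use c that in simp)
  \<comment> \<open>The identity forces this value. The numerator stays between \<open>ln c\<close>
    and \<open>ln C\<close> while the denominator diverges; restricting to \<open>k \<ge> 2\<close>
    avoids ln 1 = 0.\<close>
  define \<epsilon> where "\<epsilon> k = ln (r k / sqrt (real k)) / ln (real k)" for k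
  have "\<epsilon> \<longlonglongrightarrow> 0"
  proof (rule tendsto_sandwich)
    have ln_k: "filterlim (\<lambda>k. ln (real k)) at_top sequentially"
      by (rule filterlim_compose[OF ln_at_top filterlim_real_sequentially])
    show "(\<lambda>k. ln c / ln (real k)) \<longlonglongrightarrow> 0" "(\<lambda>k. ln C / ln (real k)) \<longlonglongrightarrow> 0"
      by (rule tendsto_divide_0[OF tendsto_const filterlim_at_top_imp_at_infinity[OF ln_k]])+
    show "\<forall>\<^sub>F k in sequentially. ln c / ln (real k) \<le> \<epsilon> k"
      using eventually_ge_at_top[of 2]
    proof eventually_elim
      case (elim k)
      then have "c \<le> r k / sqrt (real k)" using r(1)[of k] by (simp add: field_simps)
      then show ?case unfolding \<epsilon>_def using c elim by (intro divide_right_mono) auto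
    qed
    show "\<forall>\<^sub>F k in sequentially. \<epsilon> k \<le> ln C / ln (real k)"
      using eventually_ge_at_top[of 2]
    proof eventually_elim
      case (elim k)
      then have "r k / sqrt (real k) \<le> C" "r k / sqrt (real k) > 0"
        using r(2)[of k] r_pos[of k] by (simp_all add: field_simps)
      then show ?case unfolding \<epsilon>_def using c elim by (intro divide_right_mono) auto
    qed
  qed
  then have "\<epsilon> \<in> o(\<lambda>_. 1)" by (intro smalloI_tendsto) auto
  moreover have "\<forall>\<^sub>F k in sequentially. S k = ennreal (real k powr (1/2 + \<epsilon> k))"
    using eventually_ge_at_top[of 2]
  proof eventually_elim
    case (elim k)
    have "real k powr \<epsilon> k = r k / sqrt (real k)"
      using elim r_pos[of k] by (simp add: powr_def \<epsilon>_def)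
    then have "real k powr (1/2 + \<epsilon> k) = r k"
      using elim by (simp add: powr_add powr_half_sqrt)
    then show ?case using S[of k] elim by simp
  qed
  ultimately show ?thesis by blast
qed

lemma sqrt_order_powr_bounds:
  fixes S :: "nat \<Rightarrow> ennreal"
  assumes c: "c > 0" "C > 0"
    and lower: "\<And>k. k \<ge> 1 \<Longrightarrow> ennreal (c * sqrt (real k)) \<le> S k"
    and upper: "\<And>k. k \<ge> 1 \<Longrightarrow> S k \<le> ennreal (C * sqrt (real k))"
  shows "\<exists>K > 1. \<forall>\<eta>\<ge>0. \<forall>k\<ge>1. ennreal (inverse K * real k powr (1/2 - \<eta>)) \<le> S k \<and>
            S k \<le> ennreal (K * real k powr (1/2 + \<eta>))"
proof -
  \<comment> \<open>One constant above both \<open>C\<close> and \<open>inverse c\<close> serves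
    every \<open>\<eta> \<ge> 0\<close>, since powers of \<open>k \<ge> 1\<close> increase with the
    exponent.\<close>
  define K where "K = 1 + C + inverse c"
  have K: "K > 1" "C \<le> K" "inverse K \<le> c"
  proof -
    have "inverse K \<le> inverse (inverse c)" using c by (intro le_imp_inverse_le) (auto simp: K_def)
    then show "inverse K \<le> c" by simp
  qed (use c in \<open>auto simp: K_def add_pos_pos\<close>)
  have "ennreal (inverse K * real k powr (1/2 - \<eta>)) \<le> S k \<and> S k \<le> ennreal (K * real k powr (1/2 + \<eta>))"
    if "\<eta> \<ge> 0" "k \<ge> 1" for \<eta> k
  proof
    have "real k powr (1/2 - \<eta>) \<le> real k powr (1/2)" "real k powr (1/2) \<le> real k powr (1/2 + \<eta>)"
      using that by (auto intro!: powr_mono)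
    then have k: "real k powr (1/2 - \<eta>) \<le> sqrt (real k)" "sqrt (real k) \<le> real k powr (1/2 + \<eta>)"
      by (simp_all add: powr_half_sqrt)
    have "inverse K * real k powr (1/2 - \<eta>) \<le> c * sqrt (real k)"
      using k K c by (intro mult_mono) auto
    then show "ennreal (inverse K * real k powr (1/2 - \<eta>)) \<le> S k"
      by (rule order_trans[OF ennreal_leI lower[OF that(2)]])
    have "C * sqrt (real k) \<le> K * real k powr (1/2 + \<eta>)"
      using k K c by (intro mult_mono) auto
    then show "S k \<le> ennreal (K * real k powr (1/2 + \<eta>))"
      by (rule order_trans[OF upper[OF that(2)] ennreal_leI])
  qed
  then show ?thesis using K(1) by blast
qed

theorem theorem2:
  fixes M :: "'a measure" and B L :: "real \<Rightarrow> 'a \<Rightarrow> real"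
  assumes "standard_brownian_motion M B"
    and "is_local_time M B 1 L"
  shows "(\<exists>\<epsilon> :: nat \<Rightarrow> real. \<epsilon> \<in> o(\<lambda>_. 1) \<and>
            (\<forall>\<^sub>F k in sequentially.
               sup_expected_inverse_distance M L k = ennreal (real k powr (1/2 + \<epsilon> k)))) \<and>
         (\<forall>\<eta>\<^sub>0 :: real. \<eta>\<^sub>0 > 0 \<longrightarrow> (\<exists>C :: real. C > 1 \<and> (\<forall>k :: nat. k \<ge> 1 \<longrightarrow>
            ennreal (inverse C * real k powr (1/2 - \<eta>\<^sub>0)) \<le> sup_expected_inverse_distance M L k \<and>
            sup_expected_inverse_distance M L k \<le> ennreal (C * real k powr (1/2 + \<eta>\<^sub>0)))))"
proof -
  obtain X where X: "\<And>t. X t \<in> borel_measurable M"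
    "\<And>\<omega>. \<omega> \<in> space M \<Longrightarrow> continuous_on UNIV (\<lambda>t. X t \<omega>)"
    "\<And>\<omega>. \<omega> \<in> space M \<Longrightarrow> X 0 \<omega> = 0"
    "AE \<omega> in M. \<forall>t\<ge>0. X t \<omega> = B t \<omega>"
    by (rule brownian_regularization[OF assms(1)]) blast
  interpret prob_space M using assms(1) by (simp add: standard_brownian_motion_def)
  interpret brownian_local_time M X L
  proof unfold_locales
    show "AE \<omega> in M. continuous_on UNIV (\<lambda>x. L x \<omega>) \<and> (\<forall>x. 0 \<le> L x \<omega>) \<and>
        occupation_measure 1 (\<lambda>t. X t \<omega>) = density lborel (\<lambda>x. ennreal (L x \<omega>))"
      using conjunct2[OF assms(2)[unfolded is_local_time_def]] X(4)
    proof eventually_elim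
      case (elim \<omega>)
      \<comment> \<open>Almost surely \<open>X\<close> and \<open>B\<close> agree on [0, 1], so
        \<open>L\<close> is a local time of \<open>X\<close> too.\<close>
      have "occupation_measure 1 (\<lambda>t. X t \<omega>) = occupation_measure 1 (\<lambda>t. B t \<omega>)"
        unfolding occupation_measure_def using elim(2)
        by (intro distr_cong refl) (simp add: space_restrict_space)
      then show ?case using elim(1) by simp
    qed
  qed (use X brownian_char[OF assms(1) X(1,2,4)] in auto)
  obtain c C where bounds: "c > 0" "C > 0"
    "\<And>k. k \<ge> 1 \<Longrightarrow> ennreal (c * sqrt (real k)) \<le> sup_expected_inverse_distance M L k"
    "\<And>k. k \<ge> 1 \<Longrightarrow> sup_expected_inverse_distance M L k \<le> ennreal (C * sqrt (real k))"
    using sup_expected_inverse_distance_bounds by blast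
  show ?thesis
    using sqrt_order_exponent[OF bounds] sqrt_order_powr_bounds[OF bounds] by (meson less_imp_le)
qed

end
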